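(* Let $G$ be a finite group. Every subgroup of $G$ is a Hall $S$-quasinormally embedded subgroup of $G$ if and only if $G=D\rtimes M$, where $D=G^{\mathfrak N}$ is a cyclic Hall subgroup of $G$ of square-free order and $M$ is a Carter subgroup of $G$.
   Context: All groups are finite. $G^{\mathfrak N}$ is the nilpotent residual of $G$: the intersection of all normal subgroups $N$ of $G$ with $G/N$ nilpotent. A subgroup $A$ of $G$ is $S$-quasinormal (or $S$-permutable) in $G$ if $AP=PA$ for all Sylow subgroups $P$ of $G$. A subgroup $A$ of $G$ is Hall $S$-quasinormally embedded in $G$ if $A$ is a Hall subgroup of some $S$-quasinormal subgroup of $G$ (a Hall subgroup being one whose order is coprime to its index). A Carter subgroup is a nilpotent self-normalizing subgroup. *)

theory Defs
  imports
    "HOL-Algebra.Sylow"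
    "HOL-Algebra.Group_Action"
    "HOL-Algebra.Generated_Groups"
    "HOL-Algebra.Elementary_Groups"
    "HOL-Computational_Algebra.Squarefree"
begin

definition commutator :: "('a, 'b) monoid_scheme \<Rightarrow> 'a set \<Rightarrow> 'a set \<Rightarrow> 'a set" where
  "commutator G H K =
     generate G {h \<otimes>\<^bsub>G\<^esub> k \<otimes>\<^bsub>G\<^esub> inv\<^bsub>G\<^esub> h \<otimes>\<^bsub>G\<^esub> inv\<^bsub>G\<^esub> k | h k. h \<in> H \<and> k \<in> K}"

primrec lower_central :: "('a, 'b) monoid_scheme \<Rightarrow> nat \<Rightarrow> 'a set" where
  "lower_central G 0 = carrier G"
| "lower_central G (Suc n) = commutator G (lower_central G n) (carrier G)"

definition nilpotent_group :: "('a, 'b) monoid_scheme \<Rightarrow> bool" where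
  "nilpotent_group G \<longleftrightarrow> group G \<and> (\<exists>n. lower_central G n = {\<one>\<^bsub>G\<^esub>})"

text \<open>For a group \<open>G\<close> the family intersected here is never empty: it contains the carrier of \<open>G\<close>.\<close>

definition nilpotent_residual :: "('a, 'b) monoid_scheme \<Rightarrow> 'a set" where
  "nilpotent_residual G = \<Inter>{N. N \<lhd> G \<and> nilpotent_group (G Mod N)}"

text \<open>The prime is not required to divide the order of \<open>G\<close>; for a prime that does not, the
  only Sylow subgroup is the trivial one.\<close>

definition sylow_subgroup :: "'a set \<Rightarrow> ('a, 'b) monoid_scheme \<Rightarrow> bool" where
  "sylow_subgroup P G \<longleftrightarrow>
     subgroup P G \<and> (\<exists>p::nat. prime p \<and> card P = p ^ multiplicity p (order G))"

definition S_quasinormal :: "'a set \<Rightarrow> ('a, 'b) monoid_scheme \<Rightarrow> bool" where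
  "S_quasinormal A G \<longleftrightarrow>
     subgroup A G \<and> (\<forall>P. sylow_subgroup P G \<longrightarrow> A <#>\<^bsub>G\<^esub> P = P <#>\<^bsub>G\<^esub> A)"

definition hall_subgroup :: "'a set \<Rightarrow> ('a, 'b) monoid_scheme \<Rightarrow> bool" where
  "hall_subgroup H G \<longleftrightarrow> subgroup H G \<and> coprime (card H) (card (rcosets\<^bsub>G\<^esub> H))"

definition hall_S_quasinormally_embedded :: "'a set \<Rightarrow> ('a, 'b) monoid_scheme \<Rightarrow> bool" where
  "hall_S_quasinormally_embedded A G \<longleftrightarrow>
     (\<exists>E. S_quasinormal E G \<and> hall_subgroup A (G\<lparr>carrier := E\<rparr>))"

definition carter_subgroup :: "'a set \<Rightarrow> ('a, 'b) monoid_scheme \<Rightarrow> bool" where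
  "carter_subgroup M G \<longleftrightarrow>
     subgroup M G \<and> nilpotent_group (G\<lparr>carrier := M\<rparr>) \<and> normalizer G M = M"

definition semidirect_decomposition :: "('a, 'b) monoid_scheme \<Rightarrow> 'a set \<Rightarrow> 'a set \<Rightarrow> bool" where
  "semidirect_decomposition G D M \<longleftrightarrow>
     D \<lhd> G \<and> subgroup M G \<and> D <#>\<^bsub>G\<^esub> M = carrier G \<and> D \<inter> M = {\<one>\<^bsub>G\<^esub>}"

end

theory Submission
  imports Defs "HOL-Algebra.Multiplicative_Group" "HOL-Number_Theory.Cong"
begin

text \<open>
  Let every subgroup be a Hall subgroup of an S-quasinormal one. An S-quasinormal \<open>E\<close> contains all
  elements of \<open>EQ\<close> whose order is prime to \<open>q\<close>, for every Sylow \<open>q\<close>-subgroup \<open>Q\<close>. Hence a \<open>p\<close>-subgroup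
  \<open>A \<noteq> 1\<close> is a Sylow subgroup of a subgroup normalized by all \<open>p'\<close>-elements, and (from the subgroup
  \<open>A\<langle>y\<rangle>\<close>) a \<open>q\<close>-element \<open>y\<close> normalizing \<open>A \<le> S\<close> and the \<open>p\<close>-subgroup \<open>S\<close> satisfies \<open>[S, y] \<le> A\<close>. When
  the Sylow \<open>p\<close>-subgroups do not have order \<open>p\<close>, this is Burnside's fusion condition, and
  transfer yields a normal \<open>p\<close>-complement, so that \<open>p\<close> does not divide the order of the residual \<open>D\<close>.
  Taking the primes in increasing order, transfer also shows that the elements all of whose prime
  divisors are at least \<open>m\<close> form a characteristic subgroup \<open>K\<^sub>m\<close>. If \<open>p\<close> divides the order of \<open>D\<close>, a Sylow \<open>p\<close>-subgroup \<open>P\<close>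
  has order \<open>p\<close>, lies in \<open>D \<le> [G, G]\<close>, and so centralizes the factors \<open>K\<^sub>r/K\<^sub>r\<^sub>+\<^sub>1\<close>, \<open>r \<noteq> p\<close>; descending
  with the Frattini argument, \<open>P\<close> is normal in \<open>G\<close>. This gives the structure of \<open>D\<close>.
  A subgroup \<open>M\<close> minimal with \<open>DM = G\<close> is a complement, because \<open>D = [D, G]\<close> has no
  central Sylow subgroup. Conversely, \<open>A\<close> is a Hall subgroup of the S-quasinormal subgroup \<open>DA\<close>.
\<close>

text \<open>Order \<open>p\<close> is a genuine exception: every subgroup of the symmetric group of
  degree 3 is embedded as required, yet there is no normal 3-complement. The source of the exception
  is that the hypothesis says nothing about the trivial subgroup. If transfer is done in a group
  whose Sylow \<open>p\<close>-subgroup has order \<open>p\<close>, the subgroup \<open>A\<close> of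
  index \<open>p\<close> is trivial and controls no fusion. When the Sylow subgroups of the whole
  group are larger, elements outside the small one restore the control. When they have order
  \<open>p\<close>, only arithmetic is left: a \<open>q\<close>-element with
  \<open>q \<ge> p\<close> that normalizes a group of order \<open>p\<close> centralizes it. This is
  why the primes are taken in increasing order.

  Membership of \<open>P\<close> in the commutator subgroup matters because a factor of order
  \<open>r\<close> has an abelian automorphism group. If the Sylow \<open>r\<close>-subgroups do not
  have order \<open>r\<close>, the normal \<open>r\<close>-complement takes over this role.

  Minimality of the supplement serves in place of a splitting theorem, and the absence of central
  Sylow subgroups yields both the trivial intersection and self-normalization.\<close>

locale finite_group = group G for G (structure) +
  assumes fin: "finite (carrier G)"
begin

section \<open>Products of subgroups and fixed points of actions of \<open>p\<close>-groups\<close>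

abbreviation conjugate :: "'a \<Rightarrow> 'a \<Rightarrow> 'a" where
  "conjugate g x \<equiv> g \<otimes> x \<otimes> inv g"

abbreviation comm :: "'a \<Rightarrow> 'a \<Rightarrow> 'a" where
  "comm x y \<equiv> x \<otimes> y \<otimes> inv x \<otimes> inv y"

lemma inv_cancel_left [simp]:
  "\<lbrakk>x \<in> carrier G; y \<in> carrier G\<rbrakk> \<Longrightarrow> inv x \<otimes> (x \<otimes> y) = y"
  "\<lbrakk>x \<in> carrier G; y \<in> carrier G\<rbrakk> \<Longrightarrow> x \<otimes> (inv x \<otimes> y) = y"
  by (simp_all add: m_assoc[symmetric])

lemmas group_simps = m_assoc inv_mult_group

lemma subgroup_finite: "subgroup H G \<Longrightarrow> finite H"
  using fin finite_subset subgroup.subset by blast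

lemma subgroup_card_pos: "subgroup H G \<Longrightarrow> card H > 0"
  using subgroup_finite subgroup.one_closed card_gt_0_iff by blast

lemma subgroup_carrier: "subgroup H G \<Longrightarrow> x \<in> H \<Longrightarrow> x \<in> carrier G"
  using subgroup.mem_carrier by fast

lemma finite_group_subgroup: "subgroup H G \<Longrightarrow> finite_group (G\<lparr>carrier := H\<rparr>)"
  using subgroup_imp_group subgroup_finite by (simp add: finite_group_def finite_group_axioms_def)

lemma subgroup_card_dvd:
  assumes "subgroup H G" "subgroup K G" "H \<subseteq> K"
  shows "card H dvd card K"
proof -
  interpret K: finite_group "G\<lparr>carrier := K\<rparr>" using finite_group_subgroup assms by blast
  have "subgroup H (G\<lparr>carrier := K\<rparr>)" using assms subgroup_incl by blast
  from K.lagrange[OF this] have "card (rcosets\<^bsub>G\<lparr>carrier := K\<rparr>\<^esub> H) * card H = card K" by (simp add: order_def)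
  then show ?thesis using dvd_triv_right by metis
qed

lemma subgroup_pow: "subgroup H G \<Longrightarrow> x \<in> H \<Longrightarrow> x [^] (n::nat) \<in> H"
  by (induction n) (auto simp: subgroup.one_closed subgroup.m_closed)

lemma subgroupI_finite:
  assumes "H \<subseteq> carrier G" "\<one> \<in> H" "\<And>x y. x \<in> H \<Longrightarrow> y \<in> H \<Longrightarrow> x \<otimes> y \<in> H"
  shows "subgroup H G"
proof (rule subgroupI)
  fix x assume x: "x \<in> H"
  have pow: "x [^] (n::nat) \<in> H" for n by (induction n) (use assms x in auto)
  have xc: "x \<in> carrier G" using x assms by auto
  obtain m where m: "ord x = Suc m" using ord_ge_1[OF fin xc] by (cases "ord x") auto
  then have "x [^] m \<otimes> x = \<one>" using pow_ord_eq_1[OF xc] by simp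
  then have "inv x = x [^] m" using xc inv_equality by simp
  then show "inv x \<in> H" using pow by simp
qed (use assms in auto)

lemma set_multI: "h \<in> H \<Longrightarrow> k \<in> K \<Longrightarrow> h \<otimes> k \<in> H <#> K"
  by (auto simp: set_mult_def)

text \<open>Each fibre of multiplication is a torsor under \<open>H \<inter> K\<close>, the element
  \<open>t\<close> sending \<open>(h, k)\<close> to
  \<open>(h \<otimes> t, inv t \<otimes> k)\<close>. Counting fibres also covers products that are
  not subgroups.\<close>

lemma card_set_mult:
  assumes H: "subgroup H G" and K: "subgroup K G"
  shows "card (H <#> K) * card (H \<inter> K) = card H * card K"
proof -
  let ?f = "\<lambda>(h,k). h \<otimes> k"
  have im: "?f ` (H \<times> K) = H <#> K" by (auto simp: set_mult_def image_def)
  have fH: "finite H" "finite K" using H K subgroup_finite by auto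
  have cc: "\<And>h. h \<in> H \<Longrightarrow> h \<in> carrier G" "\<And>h. h \<in> K \<Longrightarrow> h \<in> carrier G" using H K subgroup_carrier by auto
  have fib: "card {z \<in> H \<times> K. ?f z = w} = card (H \<inter> K)" if "w \<in> H <#> K" for w
  proof -
    obtain h k where hk: "h \<in> H" "k \<in> K" "w = h \<otimes> k" using \<open>w \<in> H <#> K\<close> by (auto simp: set_mult_def)
    have "bij_betw (\<lambda>t. (h \<otimes> t, inv t \<otimes> k)) (H \<inter> K) {z \<in> H \<times> K. ?f z = w}"
    proof (rule bij_betwI[where g="\<lambda>z. inv h \<otimes> fst z"])
      show "(\<lambda>t. (h \<otimes> t, inv t \<otimes> k)) \<in> H \<inter> K \<rightarrow> {z \<in> H \<times> K. ?f z = w}"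
        using hk H K cc by (auto simp: group_simps subgroup.m_closed subgroup.m_inv_closed)
      show "(\<lambda>z. inv h \<otimes> fst z) \<in> {z \<in> H \<times> K. ?f z = w} \<rightarrow> H \<inter> K"
      proof
        fix z assume "z \<in> {z \<in> H \<times> K. ?f z = w}"
        then obtain a b where ab: "a \<in> H" "b \<in> K" "a \<otimes> b = w" "z = (a, b)" by auto
        then have "inv h \<otimes> a = k \<otimes> inv b" using hk cc
          by (metis inv_closed inv_solve_left inv_solve_right m_assoc m_closed)
        then show "inv h \<otimes> fst z \<in> H \<inter> K"
          using ab hk H K by (metis Int_iff fst_conv subgroup.m_closed subgroup.m_inv_closed)
      qed
      show "\<And>x. x \<in> H \<inter> K \<Longrightarrow> inv h \<otimes> fst (h \<otimes> x, inv x \<otimes> k) = x" using hk cc by auto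
      show "\<And>y. y \<in> {z \<in> H \<times> K. ?f z = w} \<Longrightarrow> (h \<otimes> (inv h \<otimes> fst y), inv (inv h \<otimes> fst y) \<otimes> k) = y"
      proof -
        fix z assume "z \<in> {z \<in> H \<times> K. ?f z = w}"
        then obtain a b where ab: "a \<in> H" "b \<in> K" "a \<otimes> b = w" "z = (a, b)" by auto
        then have "inv (inv h \<otimes> a) \<otimes> k = inv a \<otimes> (h \<otimes> k)" using hk cc by (simp add: group_simps)
        also have "\<dots> = inv a \<otimes> (a \<otimes> b)" using ab hk by simp
        also have "\<dots> = b" using ab(1,2) cc by simp
        finally have "inv (inv h \<otimes> a) \<otimes> k = b" .
        then show "(h \<otimes> (inv h \<otimes> fst z), inv (inv h \<otimes> fst z) \<otimes> k) = z" using ab hk cc by simp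
      qed
    qed
    then have "card (H \<inter> K) = card {z \<in> H \<times> K. ?f z = w}" by (rule bij_betw_same_card)
    then show ?thesis by simp
  qed
  have "card (H \<times> K) = (\<Sum>w\<in>H <#> K. card {z \<in> H \<times> K. ?f z = w})"
    using sum.image_gen[of "H \<times> K" "\<lambda>_. 1::nat" ?f] fH im by simp
  also have "\<dots> = card (H <#> K) * card (H \<inter> K)" using fib by simp
  finally show ?thesis by (simp add: card_cartesian_product)
qed

lemma set_mult_subgroup:
  assumes H: "subgroup H G" and K: "subgroup K G" and nrm: "\<And>h k. h \<in> H \<Longrightarrow> k \<in> K \<Longrightarrow> conjugate k h \<in> H"
  shows "subgroup (H <#> K) G"
proof (rule subgroupI_finite)
  show "H <#> K \<subseteq> carrier G" using H K by (auto simp: set_mult_def subgroup_carrier)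
  show "\<one> \<in> H <#> K" using set_multI[of \<one> H \<one> K] H K by (simp add: subgroup.one_closed)
  fix x y assume "x \<in> H <#> K" "y \<in> H <#> K"
  then obtain h k h' k' where *: "h \<in> H" "k \<in> K" "h' \<in> H" "k' \<in> K" "x = h \<otimes> k" "y = h' \<otimes> k'"
    by (auto simp: set_mult_def)
  then have "x \<otimes> y = (h \<otimes> conjugate k h') \<otimes> (k \<otimes> k')" using H K by (simp add: group_simps subgroup_carrier)
  moreover have "h \<otimes> conjugate k h' \<in> H" using * nrm H by (simp add: subgroup.m_closed)
  moreover have "k \<otimes> k' \<in> K" using * K by (simp add: subgroup.m_closed)
  ultimately show "x \<otimes> y \<in> H <#> K" by (auto simp: set_mult_def)
qed

lemma set_mult_incl:
  assumes "subgroup H G" "subgroup K G"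
  shows "H \<subseteq> H <#> K" "K \<subseteq> H <#> K"
  using set_multI[of _ H \<one> K] set_multI[of \<one> H _ K] assms
  by (auto simp: subgroup.one_closed subgroup_carrier)

text \<open>The kernel \<open>N\<close> makes the congruence available for groups that act through a \<open>p\<close>-group.\<close>

lemma card_fixed_points:
  assumes A: "subgroup A G" and N: "subgroup N G" "N \<subseteq> A" and card: "card A = card N * p ^ k" and p: "prime (p::nat)"
    and X: "finite X"
    and cl: "\<And>a x. a \<in> A \<Longrightarrow> x \<in> X \<Longrightarrow> act a x \<in> X"
    and one: "\<And>x. x \<in> X \<Longrightarrow> act \<one> x = x"
    and mul: "\<And>a b x. a \<in> A \<Longrightarrow> b \<in> A \<Longrightarrow> x \<in> X \<Longrightarrow> act (a \<otimes> b) x = act a (act b x)"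
    and triv: "\<And>n x. n \<in> N \<Longrightarrow> x \<in> X \<Longrightarrow> act n x = x"
  shows "[card X = card {x\<in>X. \<forall>a\<in>A. act a x = x}] (mod p)"
proof -
  let ?A = "G\<lparr>carrier := A\<rparr>" let ?\<phi> = "\<lambda>a. \<lambda>x\<in>X. act a x"
  interpret A: finite_group ?A using finite_group_subgroup A by blast
  have invA: "\<And>a. a \<in> A \<Longrightarrow> inv a \<in> A" using A by (simp add: subgroup.m_inv_closed)
  have Ac: "\<And>a. a \<in> A \<Longrightarrow> a \<in> carrier G" using A subgroup_carrier by auto
  have bij: "?\<phi> a \<in> Bij X" if a: "a \<in> A" for a
  proof -
    have "bij_betw (?\<phi> a) X X"
    proof (rule bij_betwI[where g="act (inv a)"])
      show "\<And>x. x \<in> X \<Longrightarrow> act (inv a) (?\<phi> a x) = x"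
        using a invA by (simp add: mul[symmetric] Ac one)
      show "\<And>x. x \<in> X \<Longrightarrow> ?\<phi> a (act (inv a) x) = x"
        using a invA by (simp add: cl mul[symmetric] Ac one)
    qed (use a cl invA in auto)
    then show ?thesis by (auto simp: Bij_def)
  qed
  have hom: "?\<phi> \<in> hom ?A (BijGroup X)"
    by (rule homI) (use bij cl mul in \<open>auto simp: BijGroup_def compose_def\<close>)
  interpret act: group_action ?A X ?\<phi>
    unfolding group_action_def group_hom_def group_hom_axioms_def using hom A.group_axioms group_BijGroup by blast
  let ?F = "{x\<in>X. \<forall>a\<in>A. act a x = x}"
  have orb: "card o' = 1 \<and> o' \<subseteq> ?F \<or> p dvd card o' \<and> o' \<inter> ?F = {}" if that': "o' \<in> orbits ?A X ?\<phi>" for o'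
  proof -
    obtain x where x: "x \<in> X" and o': "o' = orbit ?A ?\<phi> x" using that' unfolding orbits_def by blast
    have oeq: "o' = (\<lambda>a. act a x) ` A" using o' x by (auto simp: orbit_def)
    let ?S = "stabilizer ?A ?\<phi> x"
    have S: "subgroup ?S ?A" using act.stabilizer_subgroup x by blast
    have S': "subgroup ?S G" using S A incl_subgroup by blast
    have NS: "N \<subseteq> ?S" using N triv x by (auto simp: stabilizer_def)
    have "card o' * card ?S = card N * p ^ k"
      using act.orbit_stabilizer_theorem[OF x] o' card by (simp add: order_def)
    \<comment> \<open>The stabilizer contains \<open>N\<close>, so the length of the orbit divides
      the index of \<open>N\<close> in \<open>A\<close>, a power of \<open>p\<close>.\<close>
    moreover obtain m where m: "card ?S = card N * m" using subgroup_card_dvd[OF N(1) S' NS] by (auto elim: dvdE)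
    ultimately have "card o' * m = p ^ k" using subgroup_card_pos[OF N(1)] by (simp add: mult.left_commute)
    then have "card o' dvd p ^ k" by (metis dvd_triv_left)
    then obtain j where j: "card o' = p ^ j" using p divides_primepow_nat by blast
    have xo: "x \<in> o'" using oeq one[OF x] A subgroup.one_closed by force
    show ?thesis
    proof (cases "card o' = 1")
      case True
      then have "o' = {x}" using xo by (auto simp: card_1_singleton_iff)
      then show ?thesis using True x oeq by auto
    next
      case False
      then have "p dvd card o'" using j by (cases j) auto
      moreover have "o' \<inter> ?F = {}"
      proof (rule ccontr)
        assume "o' \<inter> ?F \<noteq> {}"
        then obtain b where b: "b \<in> A" "act b x \<in> ?F" using oeq by auto
        then have "act (inv b) (act b x) = act b x" using invA by auto
        then have "act b x = x" using mul[OF invA[OF b(1)] b(1) x] one x b Ac by simp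
        then have "o' = {x}" using oeq b xo by auto
        then show False using False by simp
      qed
      ultimately show ?thesis by blast
    qed
  qed
  let ?O = "orbits ?A X ?\<phi>"
  have un: "\<Union>?O = X" using act.orbits_coverture .
  have finO: "finite ?O" using un X by (metis finite_UnionD)
  have fo: "\<And>o'. o' \<in> ?O \<Longrightarrow> finite o'" using un X by (metis Union_upper finite_subset)
  have disj: "pairwise disjnt ?O"
    using act.disjoint_union by (auto simp: pairwise_def disjnt_def)
  have c1: "card X = (\<Sum>o'\<in>?O. card o')"
    using card_Union_disjoint[OF disj] fo un by metis
  have c2: "card ?F = (\<Sum>o'\<in>?O. card (o' \<inter> ?F))"
  proof -
    have "?F = (\<Union>o'\<in>?O. o' \<inter> ?F)" using un by auto
    moreover have "card (\<Union>o'\<in>?O. o' \<inter> ?F) = (\<Sum>o'\<in>?O. card (o' \<inter> ?F))"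
      by (rule card_UN_disjoint) (use finO fo disj in \<open>auto simp: pairwise_def disjnt_def\<close>)
    ultimately show ?thesis by simp
  qed
  have "[card o' = card (o' \<inter> ?F)] (mod p)" if "o' \<in> ?O" for o'
    using orb[OF that] by (auto simp: Int_absorb2 cong_0_iff)
  then show ?thesis unfolding c1 c2 by (rule cong_sum)
qed

end

section \<open>Sylow subgroups and elements of prime power order\<close>

context finite_group begin

definition psubgroup :: "nat \<Rightarrow> 'a set \<Rightarrow> bool" where
  "psubgroup p A \<longleftrightarrow> subgroup A G \<and> (\<exists>k. card A = p ^ k)"

text \<open>The identity satisfies this for every \<open>p\<close>;
  \<open>prime_power_generation\<close> treats it as a 2-element.\<close>

definition pelement :: "nat \<Rightarrow> 'a \<Rightarrow> bool" where
  "pelement p x \<longleftrightarrow> x \<in> carrier G \<and> (\<exists>k. x [^] (p ^ k) = \<one>)"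

text \<open>The ambient subgroup is an argument, so that Sylow theory inside a subgroup needs no
  passage to its own group record.\<close>

definition sylow_in :: "nat \<Rightarrow> 'a set \<Rightarrow> 'a set \<Rightarrow> bool" where
  "sylow_in p P H \<longleftrightarrow> subgroup P G \<and> P \<subseteq> H \<and> card P = p ^ multiplicity p (card H)"

text \<open>Only one inclusion is required; finiteness turns it into an equality
  (\<open>normalizes_image\<close>).\<close>

definition normalizes :: "'a \<Rightarrow> 'a set \<Rightarrow> bool" where
  "normalizes g S \<longleftrightarrow> g \<in> carrier G \<and> (\<forall>s\<in>S. conjugate g s \<in> S)"

lemma sylow_inD: "sylow_in p P H \<Longrightarrow> subgroup P G" "sylow_in p P H \<Longrightarrow> P \<subseteq> H" "sylow_in p P H \<Longrightarrow> psubgroup p P"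
  by (auto simp: sylow_in_def psubgroup_def)

lemma pelement_carrier: "pelement p x \<Longrightarrow> x \<in> carrier G" by (simp add: pelement_def)

lemma normalizes_carrier: "normalizes g S \<Longrightarrow> g \<in> carrier G" by (simp add: normalizes_def)

lemma pow_card_subgroup:
  assumes "subgroup H G" "x \<in> H"
  shows "x [^] card H = \<one>"
proof -
  interpret H: finite_group "G\<lparr>carrier := H\<rparr>" using finite_group_subgroup assms by blast
  show ?thesis using H.pow_order_eq_1 assms by (simp add: order_def nat_pow_consistent[symmetric])
qed

lemma psubgroup_pelement: "psubgroup p A \<Longrightarrow> x \<in> A \<Longrightarrow> pelement p x"
  unfolding psubgroup_def pelement_def using pow_card_subgroup subgroup_carrier by metis

lemma pelement_ord: "prime p \<Longrightarrow> pelement p x \<Longrightarrow> \<exists>k. ord x = p ^ k"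
  unfolding pelement_def using pow_eq_id divides_primepow_nat by metis

lemma generate_singleton:
  assumes "x \<in> carrier G" shows "generate G {x} = range (\<lambda>k::nat. x [^] k)"
  using generate_pow_nat[OF assms] ord_ge_1[OF fin assms] by (auto simp: image_def)

lemma generate_singleton_mem: "x \<in> carrier G \<Longrightarrow> x \<in> generate G {x}"
  by (auto intro: generate.incl)

lemma card_generate_singleton: "x \<in> carrier G \<Longrightarrow> card (generate G {x}) = ord x"
  using generate_pow_card by simp

lemma subgroup_generate: "S \<subseteq> carrier G \<Longrightarrow> subgroup (generate G S) G"
  by (rule generate_is_subgroup)

lemma psubgroup_generate: "prime p \<Longrightarrow> pelement p x \<Longrightarrow> psubgroup p (generate G {x})"
  using pelement_ord by (simp add: psubgroup_def card_generate_singleton pelement_carrier subgroup_generate)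

lemma ord_subgroup_dvd: "subgroup H G \<Longrightarrow> x \<in> H \<Longrightarrow> ord x dvd card H"
  using pow_card_subgroup subgroup_carrier by (simp add: pow_eq_id[symmetric])

lemma cauchy_subgroup:
  assumes "prime p" "subgroup H G" "p ^ j dvd card H"
  shows "\<exists>K. subgroup K G \<and> K \<subseteq> H \<and> card K = p ^ j"
proof -
  interpret H: finite_group "G\<lparr>carrier := H\<rparr>" using finite_group_subgroup assms by blast
  obtain m where "card H = p ^ j * m" using assms(3) by (elim dvdE)
  then obtain K where "subgroup K (G\<lparr>carrier := H\<rparr>)" "card K = p ^ j"
    using sylow_thm[OF assms(1) H.group_axioms _ H.fin] by (auto simp: order_def)
  then show ?thesis using incl_subgroup[OF assms(2)] subgroup.subset by fastforce
qed

lemma sylow_exists: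
  assumes "prime p" "subgroup H G" shows "\<exists>P. sylow_in p P H"
  using cauchy_subgroup[OF assms multiplicity_dvd] by (auto simp: sylow_in_def)

lemma cauchy_element:
  assumes "prime p" "subgroup H G" "p dvd card H"
  shows "\<exists>x\<in>H. ord x = p"
proof -
  obtain K where K: "subgroup K G" "K \<subseteq> H" "card K = p" using cauchy_subgroup[of p H 1] assms by auto
  have "\<exists>x\<in>K. x \<noteq> \<one>"
  proof (rule ccontr)
    assume "\<not> (\<exists>x\<in>K. x \<noteq> \<one>)"
    then have "K = {\<one>}" using K(1) subgroup.one_closed by auto
    then show False using K(3) assms(1) not_prime_1 by auto
  qed
  then obtain x where x: "x \<in> K" "x \<noteq> \<one>" by blast
  have "ord x dvd p" using ord_subgroup_dvd K x by metis
  moreover have "ord x \<noteq> 1" using x K subgroup_carrier ord_eq_1 by metis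
  ultimately have "ord x = p" using assms(1) prime_nat_iff by blast
  then show ?thesis using x K by auto
qed

lemma sylow_index:
  assumes p: "prime p" and H: "subgroup H G" and P: "sylow_in p P H" and X: "card H = card P * m"
  shows "\<not> p dvd m"
proof
  assume "p dvd m"
  then have "p ^ Suc (multiplicity p (card H)) dvd card H"
    using P X unfolding sylow_in_def by (metis dvd_refl mult_dvd_mono power_Suc2)
  moreover have "\<not> is_unit p" using p not_prime_unit by blast
  ultimately have "Suc (multiplicity p (card H)) \<le> multiplicity p (card H)"
    using subgroup_card_pos[OF H] by (intro multiplicity_geI) simp_all
  then show False by simp
qed

lemma sylow_inI:
  assumes p: "prime p" and P: "psubgroup p P" "P \<subseteq> H" and X: "card H = card P * m" "\<not> p dvd m"
  shows "sylow_in p P H"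
proof -
  obtain k where k: "card P = p ^ k" using P by (auto simp: psubgroup_def)
  have "multiplicity p (card H) = k"
    using X k p by (simp add: multiplicity_eqI mult.commute prime_gt_0_nat)
  then show ?thesis using P k by (simp add: sylow_in_def psubgroup_def)
qed

lemma lcoset_eq:
  assumes P: "subgroup P G" and g: "g \<in> carrier G" "h \<in> carrier G" and m: "inv g \<otimes> h \<in> P"
  shows "h <# P = g <# P"
proof -
  have *: "h \<otimes> x \<in> g <# P" if "inv g \<otimes> h \<in> P" "x \<in> P" "g \<in> carrier G" "h \<in> carrier G" for g h x
  proof -
    have "inv g \<otimes> h \<otimes> x \<in> P" using that P by (simp add: subgroup.m_closed)
    moreover have "h \<otimes> x = g \<otimes> (inv g \<otimes> h \<otimes> x)" using that P by (simp add: m_assoc subgroup_carrier)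
    ultimately show ?thesis unfolding l_coset_def by blast
  qed
  have "inv h \<otimes> g = inv (inv g \<otimes> h)" using g by (simp add: inv_mult_group)
  then have "inv h \<otimes> g \<in> P" using m P by (simp add: subgroup.m_inv_closed)
  then show ?thesis using *[OF m _ g] *[OF _ _ g(2,1)] by (auto simp: l_coset_def)
qed

lemma lcoset_eqD:
  assumes P: "subgroup P G" and g: "g \<in> carrier G" "h \<in> carrier G" and m: "h <# P = g <# P"
  shows "inv g \<otimes> h \<in> P"
proof -
  have "h \<otimes> \<one> \<in> h <# P" using P by (auto simp: l_coset_def subgroup.one_closed)
  then obtain x where "x \<in> P" "h = g \<otimes> x" using m g by (auto simp: l_coset_def)
  then show ?thesis using g P by (simp add: subgroup_carrier)
qed

lemma card_lcosets:
  assumes P: "subgroup P G" and H: "subgroup H G" and PH: "P \<subseteq> H"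
  shows "card ((\<lambda>h. h <# P) ` H) * card P = card H"
proof -
  let ?f = "\<lambda>h. h <# P"
  have fib: "card {z \<in> H. ?f z = w} = card P" if w: "w \<in> ?f ` H" for w
  proof -
    obtain h where h: "h \<in> H" "w = ?f h" using w by auto
    have hc: "h \<in> carrier G" using h H subgroup_carrier by blast
    have "{z \<in> H. ?f z = w} = (\<lambda>x. h \<otimes> x) ` P"
    proof (intro equalityI subsetI)
      fix z assume "z \<in> {z \<in> H. ?f z = w}"
      then have z: "z \<in> carrier G" "?f z = ?f h" using h H subgroup_carrier by auto
      then have "inv h \<otimes> z \<in> P" using lcoset_eqD[OF P hc] by simp
      moreover have "z = h \<otimes> (inv h \<otimes> z)" using z hc by simp
      ultimately show "z \<in> (\<lambda>x. h \<otimes> x) ` P" by blast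
    next
      fix z assume "z \<in> (\<lambda>x. h \<otimes> x) ` P"
      then obtain x where x: "x \<in> P" "z = h \<otimes> x" by blast
      then have "z \<in> H" using PH H h by (auto intro: subgroup.m_closed)
      moreover have "inv h \<otimes> z \<in> P" using x hc P by (simp add: subgroup_carrier)
      then have "?f z = ?f h" using lcoset_eq[OF P hc] \<open>z \<in> H\<close> H subgroup_carrier by blast
      ultimately show "z \<in> {z \<in> H. ?f z = w}" using h by simp
    qed
    moreover have "inj_on (\<lambda>x. h \<otimes> x) P" using hc P by (auto simp: inj_on_def subgroup_carrier)
    ultimately show ?thesis by (simp add: card_image)
  qed
  have "card H = (\<Sum>w\<in>?f ` H. card {z \<in> H. ?f z = w})"
    using sum.image_gen[of H "\<lambda>_. 1::nat" ?f] subgroup_finite[OF H] by simp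
  then show ?thesis using fib by simp
qed

lemma lcoset_mult:
  assumes "subgroup P G" "a \<in> carrier G" "h \<in> carrier G"
  shows "a <# (h <# P) = (a \<otimes> h) <# P"
  using assms by (simp add: lcos_m_assoc subgroup.subset)

text \<open>\<open>A\<close> acts by left multiplication on the cosets of \<open>P\<close> in
  \<open>H\<close>. Their number is prime to \<open>p\<close>, so some \<open>h <# P\<close> is
  fixed, and this means that conjugation by \<open>inv h\<close> takes \<open>A\<close> into
  \<open>P\<close>.\<close>

lemma sylow_conj_sub:
  assumes p: "prime p" and H: "subgroup H G" and P: "sylow_in p P H" and A: "psubgroup p A" "A \<subseteq> H"
  shows "\<exists>h\<in>H. \<forall>a\<in>A. inv h \<otimes> a \<otimes> h \<in> P"
proof -
  let ?X = "(\<lambda>h. h <# P) ` H" let ?act = "l_coset G"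
  note sP = sylow_inD(1)[OF P]
  obtain k where k: "card A = p ^ k" using A by (auto simp: psubgroup_def)
  have sA: "subgroup A G" using A by (simp add: psubgroup_def)
  have Hc: "\<And>h. h \<in> H \<Longrightarrow> h \<in> carrier G" using H subgroup_carrier by auto
  have Ac: "\<And>h. h \<in> A \<Longrightarrow> h \<in> carrier G" using sA subgroup_carrier by auto
  have "[card ?X = card {x\<in>?X. \<forall>a\<in>A. ?act a x = x}] (mod p)"
  proof (rule card_fixed_points[where N="{\<one>}" and k=k])
    show "subgroup {\<one>} G" by (rule triv_subgroup)
    show "{\<one>} \<subseteq> A" using sA subgroup.one_closed by auto
    show "\<And>a x. a \<in> A \<Longrightarrow> x \<in> ?X \<Longrightarrow> a <# x \<in> ?X"
      using A H Hc by (auto simp: lcoset_mult[OF sP] Ac subset_iff subgroup.m_closed)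
    show "\<And>x. x \<in> ?X \<Longrightarrow> \<one> <# x = x" using Hc by (auto simp: lcoset_mult[OF sP])
    show "\<And>a b x. a \<in> A \<Longrightarrow> b \<in> A \<Longrightarrow> x \<in> ?X \<Longrightarrow> a \<otimes> b <# x = a <# (b <# x)"
      using Hc Ac by (auto simp: lcoset_mult[OF sP] m_assoc)
    show "\<And>n x. n \<in> {\<one>} \<Longrightarrow> x \<in> ?X \<Longrightarrow> n <# x = x" using Hc by (auto simp: lcoset_mult[OF sP])
  qed (use p sA k subgroup_finite[OF H] in auto)
  moreover have "\<not> p dvd card ?X"
    using sylow_index[OF p H P] card_lcosets[OF sP H sylow_inD(2)[OF P]] by (metis mult.commute)
  ultimately have "card {x\<in>?X. \<forall>a\<in>A. ?act a x = x} \<noteq> 0" by (metis cong_0_iff)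
  then obtain h where h: "h \<in> H" "\<forall>a\<in>A. a <# (h <# P) = h <# P" by (auto simp: card_gt_0_iff)
  have "inv h \<otimes> a \<otimes> h \<in> P" if "a \<in> A" for a
    using h that lcoset_eqD[OF sP, of h "a \<otimes> h"] by (simp add: Hc Ac lcoset_mult[OF sP] m_assoc)
  then show ?thesis using h by blast
qed

lemma conj_subgroup:
  assumes "subgroup P G" "h \<in> carrier G"
  shows "subgroup (conjugate h ` P) G" "card (conjugate h ` P) = card P"
proof -
  have Pc: "\<And>x. x \<in> P \<Longrightarrow> x \<in> carrier G" using assms subgroup_carrier by auto
  show "subgroup (conjugate h ` P) G"
  proof (rule subgroupI_finite)
    show "\<one> \<in> conjugate h ` P"
      by (rule image_eqI[of _ _ \<one>]) (use assms subgroup.one_closed in auto)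
    fix x y assume "x \<in> conjugate h ` P" "y \<in> conjugate h ` P"
    then obtain a b where ab: "a \<in> P" "b \<in> P" "x = conjugate h a" "y = conjugate h b" by auto
    then have "x \<otimes> y = conjugate h (a \<otimes> b)" using assms Pc by (simp add: group_simps)
    moreover have "a \<otimes> b \<in> P" using ab assms by (simp add: subgroup.m_closed)
    ultimately show "x \<otimes> y \<in> conjugate h ` P" by (rule image_eqI)
  qed (use assms Pc in auto)
  have "inj_on (\<lambda>x. conjugate h x) P" using assms Pc by (auto simp: inj_on_def)
  then show "card (conjugate h ` P) = card P" by (rule card_image)
qed

lemma mem_conjugate_image:
  assumes "h \<in> carrier G" "a \<in> carrier G" "inv h \<otimes> a \<otimes> h \<in> P"
  shows "a \<in> conjugate h ` P"
proof -
  have "a = conjugate h (inv h \<otimes> a \<otimes> h)" using assms(1,2) by (simp add: group_simps)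
  then show ?thesis using assms(3) by blast
qed

lemma psubgroup_in_sylow:
  assumes p: "prime p" and H: "subgroup H G" and A: "psubgroup p A" "A \<subseteq> H"
  shows "\<exists>Q. sylow_in p Q H \<and> A \<subseteq> Q"
proof -
  obtain P where P: "sylow_in p P H" using sylow_exists p H by blast
  obtain h where h: "h \<in> H" "\<forall>a\<in>A. inv h \<otimes> a \<otimes> h \<in> P" using sylow_conj_sub[OF p H P A] by blast
  let ?Q = "conjugate h ` P"
  have hc: "h \<in> carrier G" using h H subgroup_carrier by blast
  have "?Q \<subseteq> H" using h H sylow_inD[OF P] by (auto simp: subset_iff subgroup.m_closed subgroup.m_inv_closed)
  then have "sylow_in p ?Q H" using P conj_subgroup[OF _ hc] by (simp add: sylow_in_def)
  moreover have "a \<in> ?Q" if "a \<in> A" for a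
    by (rule mem_conjugate_image[OF hc subgroup_carrier[OF H subsetD[OF A(2) that]] bspec[OF h(2) that]])
  ultimately show ?thesis by blast
qed

lemma pelement_in_sylow:
  assumes p: "prime p" and H: "subgroup H G" and x: "pelement p x" "x \<in> H"
  shows "\<exists>Q. sylow_in p Q H \<and> x \<in> Q"
proof -
  have "generate G {x} \<subseteq> H" using generate_subgroup_incl[OF _ H] x by simp
  then obtain Q where "sylow_in p Q H" "generate G {x} \<subseteq> Q"
    using psubgroup_in_sylow[OF p H psubgroup_generate[OF p x(1)]] by auto
  then show ?thesis using generate_singleton_mem[OF pelement_carrier[OF x(1)]] by auto
qed

lemma sylow_maximal:
  assumes p: "prime p" and H: "subgroup H G" and P: "sylow_in p P H" and A: "psubgroup p A" "P \<subseteq> A" "A \<subseteq> H"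
  shows "A = P"
proof -
  obtain h where h: "h \<in> H" "\<forall>a\<in>A. inv h \<otimes> a \<otimes> h \<in> P" using sylow_conj_sub[OF p H P A(1,3)] by blast
  have hc: "h \<in> carrier G" using h H subgroup_carrier by blast
  have sA: "subgroup A G" using A by (simp add: psubgroup_def)
  have fP: "finite P" using sylow_inD[OF P] subgroup_finite by blast
  have "inj_on (\<lambda>a. inv h \<otimes> a \<otimes> h) A" using hc sA subgroup_carrier by (auto simp: inj_on_def)
  then have "card A \<le> card P" using h by (intro card_inj_on_le[where f="\<lambda>a. inv h \<otimes> a \<otimes> h"]) (auto simp: fP)
  then show ?thesis using A(2) subgroup_finite[OF sA] card_seteq by metis
qed

lemma sylow_conj:
  assumes p: "prime p" and H: "subgroup H G" and P: "sylow_in p P H" and A: "sylow_in p A H"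
  shows "\<exists>h\<in>H. A = conjugate h ` P"
proof -
  obtain h where h: "h \<in> H" "\<forall>a\<in>A. inv h \<otimes> a \<otimes> h \<in> P"
    using sylow_conj_sub[OF p H P] sylow_inD[OF A] by blast
  let ?Q = "conjugate h ` P"
  have hc: "h \<in> carrier G" using h H subgroup_carrier by blast
  have "a \<in> ?Q" if "a \<in> A" for a
    by (rule mem_conjugate_image[OF hc subgroup_carrier[OF H subsetD[OF sylow_inD(2)[OF A] that]] bspec[OF h(2) that]])
  moreover have "card ?Q = card A" using conj_subgroup[OF _ hc] P A by (simp add: sylow_in_def)
  moreover have "finite ?Q" using sylow_inD[OF P] subgroup_finite by blast
  ultimately show ?thesis using h card_seteq[of ?Q A] by fastforce
qed

lemma normalizes_image:
  assumes "normalizes g S" "S \<subseteq> carrier G"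
  shows "conjugate g ` S = S"
proof (rule card_seteq)
  show "finite S" using assms fin finite_subset by blast
  show "conjugate g ` S \<subseteq> S" using assms by (auto simp: normalizes_def)
  have "inj_on (\<lambda>x. conjugate g x) S" using assms by (auto simp: inj_on_def normalizes_def subset_iff)
  then show "card S \<le> card (conjugate g ` S)" by (simp add: card_image)
qed

lemma normalizes_mult:
  assumes "normalizes g S" "normalizes h S" "S \<subseteq> carrier G"
  shows "normalizes (g \<otimes> h) S"
proof -
  have "g \<otimes> h \<otimes> s \<otimes> inv (g \<otimes> h) = conjugate g (h \<otimes> s \<otimes> inv h)" if "s \<in> S" for s
    using assms that by (auto simp: normalizes_def group_simps subset_iff)
  then show ?thesis using assms by (auto simp: normalizes_def)
qed

lemma normalizes_inv:
  assumes g: "normalizes g S" and S: "S \<subseteq> carrier G"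
  shows "normalizes (inv g) S"
proof -
  have gc: "g \<in> carrier G" using g by (simp add: normalizes_def)
  have "inv g \<otimes> s \<otimes> inv (inv g) \<in> S" if s: "s \<in> S" for s
  proof -
    obtain t where t: "t \<in> S" "s = conjugate g t" using normalizes_image[OF g S] s by blast
    have "t \<in> carrier G" using t S by blast
    then have "inv g \<otimes> s \<otimes> inv (inv g) = t" using gc t by (simp add: group_simps)
    then show ?thesis using t by simp
  qed
  then show ?thesis using gc by (simp add: normalizes_def)
qed

lemma normalizes_self: "subgroup H G \<Longrightarrow> h \<in> H \<Longrightarrow> normalizes h H"
  by (simp add: normalizes_def subgroup_carrier subgroup.m_closed subgroup.m_inv_closed)

text \<open>Conjugation by \<open>k\<close> takes \<open>P\<close> to a second Sylow subgroup of
  \<open>B\<close>, which some \<open>b\<close> in \<open>B\<close> reaches as well. The form for a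
  single \<open>k\<close> suits applications in which only one element is known to normalize
  \<open>B\<close>.\<close>

lemma frattini:
  assumes p: "prime p" and B: "subgroup B G" and P: "sylow_in p P B" and k: "normalizes k B"
  shows "\<exists>b\<in>B. normalizes (inv b \<otimes> k) P"
proof -
  have kc: "k \<in> carrier G" using k by (simp add: normalizes_def)
  let ?Q = "conjugate k ` P"
  have "?Q \<subseteq> B" using k sylow_inD(2)[OF P] by (auto simp: normalizes_def)
  then have "sylow_in p ?Q B" using P conj_subgroup[OF _ kc] by (simp add: sylow_in_def)
  then obtain b where b: "b \<in> B" "?Q = conjugate b ` P" using sylow_conj[OF p B P] by blast
  have bc: "b \<in> carrier G" using b B subgroup_carrier by blast
  have "inv b \<otimes> k \<otimes> s \<otimes> inv (inv b \<otimes> k) \<in> P" if s: "s \<in> P" for s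
  proof -
    obtain t where t: "t \<in> P" "conjugate k s = conjugate b t" using b s by blast
    have c: "s \<in> carrier G" "t \<in> carrier G" using s t sylow_inD(1)[OF P] subgroup_carrier by auto
    have "inv b \<otimes> k \<otimes> s \<otimes> inv (inv b \<otimes> k) = inv b \<otimes> conjugate k s \<otimes> b" using kc bc c by (simp add: group_simps)
    also have "\<dots> = t" using t bc c by (simp add: group_simps)
    finally show ?thesis using t by simp
  qed
  then show ?thesis using b kc bc by (auto simp: normalizes_def)
qed

text \<open>By induction on its order, an element is a product of powers of itself of prime power
  order. Since \<open>K\<close> is just a set closed under products, it may be given by a condition
  on elements without a proof that it is a subgroup.\<close>

lemma prime_power_generation:
  assumes H: "subgroup H G"
    and pp: "\<And>q x. prime q \<Longrightarrow> pelement q x \<Longrightarrow> x \<in> H \<Longrightarrow> x \<in> K"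
    and mult: "\<And>x y. x \<in> K \<Longrightarrow> y \<in> K \<Longrightarrow> x \<in> H \<Longrightarrow> y \<in> H \<Longrightarrow> x \<otimes> y \<in> K"
  shows "H \<subseteq> K"
proof
  fix x assume "x \<in> H"
  then show "x \<in> K"
  proof (induction "ord x" arbitrary: x rule: less_induct)
    case less
    have xc: "x \<in> carrier G" using less.prems H subgroup_carrier by blast
    have pos: "ord x \<ge> 1" using ord_ge_1[OF fin xc] .
    show ?case
    proof (cases "ord x = 1")
      case True
      then have "x = \<one>" using xc ord_eq_1 by simp
      then have "pelement 2 x" by (auto simp: pelement_def)
      then show ?thesis using pp[OF two_is_prime_nat] less.prems by blast
    next
      case False
      then obtain q where q: "prime q" "q dvd ord x" using prime_factor_nat by blast
      define a where "a = q ^ multiplicity q (ord x)"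
      obtain b where b: "ord x = a * b" and nb: "\<not> q dvd b"
        using multiplicity_decompose'[of "ord x" q] pos q(1) not_prime_unit unfolding a_def by (metis not_one_le_zero)
      show ?thesis
      proof (cases "b = 1")
        case True
        then have "x [^] a = \<one>" using b pow_ord_eq_1[OF xc] by simp
        then have "pelement q x" using xc a_def by (auto simp: pelement_def)
        then show ?thesis using pp q less.prems by blast
      next
        case False
        have cop: "coprime a b" unfolding a_def using prime_imp_coprime[OF q(1) nb] by simp
        have "multiplicity q (ord x) \<noteq> 0" using q(2) b nb a_def by (metis mult_1 power_0)
        then have a1: "a > 1" unfolding a_def by (intro one_less_power prime_gt_1_nat[OF q(1)]) simp
        have ab: "a > 0" "b > 0" using b pos by (auto intro: Nat.gr0I)
        obtain u v where uv: "a * u = b * v + 1" using coprime_bezout_strong[OF cop] False by blast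
        \<comment> \<open>By Bezout, \<open>x\<close> is the product of its powers with exponents
          \<open>- b * v\<close> and \<open>a * u\<close>, whose orders divide \<open>a\<close> and
          \<open>b\<close>. The factor \<open>ord x - 1\<close> expresses the inverse by a natural
          exponent.\<close>
        define y where "y = x [^] a" define z where "z = x [^] (b * v * (ord x - 1))"
        have yH: "y [^] u \<in> H" and zH: "z \<in> H" unfolding y_def z_def using subgroup_pow[OF H] less.prems by auto
        have "x [^] (b * v * (ord x - 1)) \<otimes> x [^] (b * v) = \<one>"
        proof -
          have "b * v * (ord x - 1) + b * v = ord x * (b * v)" using pos by (simp add: diff_mult_distrib2 mult.commute)
          then have "x [^] (b * v * (ord x - 1)) \<otimes> x [^] (b * v) = x [^] (ord x * (b * v))"
            using xc by (simp only: nat_pow_mult)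
          also have "\<dots> = \<one>" using nat_pow_pow[OF xc, of "ord x" "b * v"] xc by simp
          finally show ?thesis .
        qed
        moreover have "y [^] u = x [^] (b * v) \<otimes> x" unfolding y_def using xc by (simp add: nat_pow_pow uv)
        ultimately have "z \<otimes> (y [^] u) = x"
          unfolding z_def using xc by (simp add: m_assoc[symmetric] del: nat_pow_pow)
        moreover have "ord (y [^] u) < ord x"
        proof -
          have "a * u * b = ord x * u" unfolding b by simp
          then have "(y [^] u) [^] b = (x [^] ord x) [^] u" unfolding y_def using xc by (simp only: nat_pow_pow nat_pow_closed)
          then have "(y [^] u) [^] b = \<one>" using xc by simp
          then have "ord (y [^] u) dvd b" using xc pow_eq_id by (simp add: y_def)
          then have "ord (y [^] u) \<le> b" using ab by (simp add: dvd_imp_le)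
          also have "b < ord x" using b a1 ab by simp
          finally show ?thesis .
        qed
        moreover have "ord z < ord x"
        proof -
          have "b * v * c * a = ord x * (v * c)" for c unfolding b by simp
          then have "z [^] a = (x [^] ord x) [^] (v * (ord x - 1))" unfolding z_def using xc by (simp only: nat_pow_pow nat_pow_closed)
          then have "z [^] a = \<one>" using xc by simp
          then have "ord z dvd a" using xc pow_eq_id by (simp add: z_def)
          then have "ord z \<le> a" using ab by (simp add: dvd_imp_le)
          also have "a < ord x" using b False ab by simp
          finally show ?thesis .
        qed
        ultimately show ?thesis using less.hyps yH zH mult by metis
      qed
    qed
  qed
qed

end

section \<open>S-quasinormal subgroups\<close>

context finite_group begin

lemma conj_pow:
  assumes "g \<in> carrier G" "x \<in> carrier G"
  shows "(conjugate g x) [^] (n::nat) = g \<otimes> x [^] n \<otimes> inv g"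
  by (induction n) (use assms in \<open>simp_all add: group_simps\<close>)

lemma pelement_conj:
  assumes "pelement q x" "g \<in> carrier G" shows "pelement q (conjugate g x)"
proof -
  obtain k where "x [^] (q ^ k) = \<one>" and x: "x \<in> carrier G" using assms by (auto simp: pelement_def)
  then have "(conjugate g x) [^] (q ^ k) = \<one>" using assms by (simp add: conj_pow)
  then show ?thesis using x assms by (auto simp: pelement_def)
qed

lemma coprime_pow_one:
  assumes x: "x \<in> carrier G" and m: "x [^] (m::nat) = \<one>" and n: "x [^] (n::nat) = \<one>" and c: "coprime m n"
  shows "x = \<one>"
proof -
  have "ord x dvd m" "ord x dvd n" using m n pow_eq_id[OF x] by simp_all
  then have "ord x dvd 1" using c by (metis coprime_common_divisor)
  then show ?thesis using ord_eq_1[OF x] by simp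
qed

lemma coprime_nat_primeI:
  assumes "\<And>q::nat. prime q \<Longrightarrow> q dvd a \<Longrightarrow> q dvd b \<Longrightarrow> False" shows "coprime a b"
proof (rule ccontr)
  assume "\<not> coprime a b"
  then have "gcd a b \<noteq> 1" by (simp add: coprime_iff_gcd_eq_1)
  then show False using prime_factor_nat[of "gcd a b"] assms by auto
qed

lemma coprime_prime_powers: "prime (p::nat) \<Longrightarrow> prime q \<Longrightarrow> p \<noteq> q \<Longrightarrow> coprime (p ^ i) (q ^ j)"
  by (simp add: primes_coprime)

lemma commuting_product_subgroup:
  assumes E: "subgroup E G" and Q: "subgroup Q G" and c: "E <#> Q = Q <#> E"
  shows "subgroup (E <#> Q) G"
proof (rule subgroupI_finite)
  have Ec: "\<And>x. x \<in> E \<Longrightarrow> x \<in> carrier G" and Qc: "\<And>x. x \<in> Q \<Longrightarrow> x \<in> carrier G"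
    using E Q subgroup_carrier by auto
  show "E <#> Q \<subseteq> carrier G" using Ec Qc by (auto simp: set_mult_def)
  show "\<one> \<in> E <#> Q" using set_multI[of \<one> E \<one> Q] E Q by (simp add: subgroup.one_closed)
  fix x y assume "x \<in> E <#> Q" "y \<in> E <#> Q"
  then obtain e q e' q' where *: "e \<in> E" "q \<in> Q" "e' \<in> E" "q' \<in> Q" "x = e \<otimes> q" "y = e' \<otimes> q'"
    by (auto simp: set_mult_def)
  have "q \<otimes> e' \<in> E <#> Q" unfolding c using * by (simp add: set_multI)
  then obtain a b where ab: "a \<in> E" "b \<in> Q" "q \<otimes> e' = a \<otimes> b" by (auto simp: set_mult_def)
  have "x \<otimes> y = e \<otimes> (q \<otimes> e') \<otimes> q'" using * Ec Qc by (simp add: m_assoc)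
  also have "\<dots> = (e \<otimes> a) \<otimes> (b \<otimes> q')" using ab * Ec Qc by (simp add: m_assoc)
  finally show "x \<otimes> y \<in> E <#> Q" using set_multI[of "e \<otimes> a" E "b \<otimes> q'" Q] ab * E Q
    by (simp add: subgroup.m_closed)
qed

lemma card_between_product:
  assumes q: "prime q" and E: "subgroup E G" and Q: "psubgroup q Q" and K: "subgroup K G" "E \<subseteq> K" "K \<subseteq> E <#> Q"
    and EQ: "subgroup (E <#> Q) G"
  shows "\<exists>j. card K = card E * q ^ j"
proof -
  obtain k where k: "card Q = q ^ k" and sQ: "subgroup Q G" using Q by (auto simp: psubgroup_def)
  obtain a where a: "card K = card E * a" using subgroup_card_dvd[OF E K(1,2)] by (auto elim: dvdE)
  obtain b where b: "card (E <#> Q) = card K * b" using subgroup_card_dvd[OF K(1) EQ K(3)] by (auto elim: dvdE)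
  have "card E * (a * (b * card (E \<inter> Q))) = card E * q ^ k"
    using card_set_mult[OF E sQ] a b k by (simp add: mult.assoc)
  then have "a * (b * card (E \<inter> Q)) = q ^ k" using subgroup_card_pos[OF E] by simp
  then have "a dvd q ^ k" by (metis dvd_triv_left)
  then obtain j where "a = q ^ j" using divides_primepow_nat[OF q] by blast
  then show ?thesis using a by blast
qed

lemma sylow_subgroup_iff: "sylow_subgroup P G \<longleftrightarrow> (\<exists>p. prime p \<and> sylow_in p P (carrier G))"
  by (auto simp: sylow_subgroup_def sylow_in_def order_def subgroup.subset)

lemma S_quasinormalD:
  assumes E: "S_quasinormal E G" and q: "prime q" and Q: "sylow_in q Q (carrier G)"
  shows "subgroup E G" "subgroup (E <#> Q) G"
  using assms commuting_product_subgroup[of E Q] sylow_inD[OF Q] sylow_subgroup_iff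
  by (auto simp: S_quasinormal_def)

text \<open>Let \<open>R\<close> be a Sylow \<open>r\<close>-subgroup containing \<open>x\<close>.
  The index of \<open>E\<close> in the intersection of \<open>E <#> Q\<close> and
  \<open>E <#> R\<close> is a power of \<open>q\<close> and a power of \<open>r\<close>, hence
  1.\<close>

lemma S_quasinormal_pelement:
  assumes E: "S_quasinormal E G" and q: "prime q" "prime r" "q \<noteq> r" and Q: "sylow_in q Q (carrier G)"
    and x: "x \<in> E <#> Q" "pelement r x"
  shows "x \<in> E"
proof -
  obtain R where R: "sylow_in r R (carrier G)" "x \<in> R"
    using pelement_in_sylow[OF q(2) subgroup_self x(2)] pelement_carrier[OF x(2)] by blast
  note sE = S_quasinormalD(1)[OF E q(1) Q] and EQ = S_quasinormalD(2)[OF E q(1) Q] and ER = S_quasinormalD(2)[OF E q(2) R(1)]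
  let ?K = "(E <#> Q) \<inter> (E <#> R)"
  have K: "subgroup ?K G" using EQ ER by (rule subgroups_Inter_pair)
  have EK: "E \<subseteq> ?K" using set_mult_incl(1)[OF sE sylow_inD(1)[OF Q]] set_mult_incl(1)[OF sE sylow_inD(1)[OF R(1)]] by simp
  obtain i where i: "card ?K = card E * q ^ i"
    using card_between_product[OF q(1) sE sylow_inD(3)[OF Q] K EK _ EQ] by auto
  obtain j where j: "card ?K = card E * r ^ j"
    using card_between_product[OF q(2) sE sylow_inD(3)[OF R(1)] K EK _ ER] by auto
  have "q ^ i = r ^ j" using i j subgroup_card_pos[OF sE] by simp
  then have "q ^ i = 1" using coprime_prime_powers[OF q, of i j] by simp
  then have "card E = card ?K" unfolding i by (simp only: mult_1_right)
  then have "E = ?K" by (rule card_subset_eq[OF subgroup_finite[OF K] EK])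
  moreover have "x \<in> E <#> R" using set_mult_incl(2)[OF sE sylow_inD(1)[OF R(1)]] R(2) by blast
  ultimately show ?thesis using x(1) by blast
qed

lemma hall_embeddedE:
  assumes "hall_S_quasinormally_embedded A G"
  obtains E m where "S_quasinormal E G" "subgroup E G" "A \<subseteq> E" "card E = card A * m" "coprime (card A) m"
proof -
  obtain E where E: "S_quasinormal E G" "hall_subgroup A (G\<lparr>carrier := E\<rparr>)"
    using assms by (auto simp: hall_S_quasinormally_embedded_def)
  have sE: "subgroup E G" using E by (simp add: S_quasinormal_def)
  interpret E: finite_group "G\<lparr>carrier := E\<rparr>" using finite_group_subgroup sE by blast
  have A: "subgroup A (G\<lparr>carrier := E\<rparr>)" using E by (simp add: hall_subgroup_def)
  have "A \<subseteq> E" using subgroup.subset[OF A] by simp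
  moreover have "card (rcosets\<^bsub>G\<lparr>carrier := E\<rparr>\<^esub> A) * card A = card E" using E.lagrange[OF A] by (simp add: order_def)
  ultimately show thesis using that[OF E(1) sE, of "card (rcosets\<^bsub>G\<lparr>carrier := E\<rparr>\<^esub> A)"] E(2)
    by (simp add: hall_subgroup_def mult.commute)
qed

lemma sylow_in_between:
  assumes p: "prime p" and E: "subgroup E G" and A: "sylow_in p A E" and B: "subgroup B G" "A \<subseteq> B" "B \<subseteq> E"
  shows "sylow_in p A B"
proof -
  obtain l where l: "card E = card B * l" using subgroup_card_dvd[OF B(1) E B(3)] by (auto elim: dvdE)
  obtain j where j: "card B = card A * j" using subgroup_card_dvd[OF sylow_inD(1)[OF A] B(1,2)] by (auto elim: dvdE)
  have "\<not> p dvd j * l" using sylow_index[OF p E A, of "j * l"] l j by (simp add: mult.assoc)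
  then have "\<not> p dvd j" by auto
  then show ?thesis using sylow_inI[OF p sylow_inD(3)[OF A] B(2) j] by blast
qed

lemma normalizes_generate:
  assumes y: "y \<in> carrier G" and S: "S \<subseteq> carrier G" and n: "\<And>s. s \<in> S \<Longrightarrow> conjugate y s \<in> generate G S"
  shows "normalizes y (generate G S)"
proof -
  let ?T = "{x \<in> carrier G. conjugate y x \<in> generate G S}"
  have sub: "subgroup (generate G S) G" using subgroup_generate[OF S] .
  have "subgroup ?T G"
  proof (rule subgroupI_finite)
    show "\<one> \<in> ?T" using y sub by (simp add: subgroup.one_closed)
    fix a b assume "a \<in> ?T" "b \<in> ?T"
    moreover from this have "conjugate y (a \<otimes> b) = conjugate y a \<otimes> conjugate y b" using y by (simp add: group_simps)
    ultimately show "a \<otimes> b \<in> ?T" using sub by (simp add: subgroup.m_closed)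
  qed auto
  moreover have "S \<subseteq> ?T" using S n by auto
  ultimately have "generate G S \<subseteq> ?T" by (rule generate_subgroup_incl[rotated])
  then show ?thesis using y by (auto simp: normalizes_def)
qed

end

section \<open>First consequences of the embedding hypothesis\<close>

locale hall_embedded_group = finite_group +
  assumes emb: "\<And>A. subgroup A G \<Longrightarrow> hall_S_quasinormally_embedded A G"
begin

text \<open>\<open>A\<close> is a Sylow \<open>p\<close>-subgroup of \<open>A1\<close>. Since
  \<open>A \<noteq> {\<one>}\<close>, the prime \<open>p\<close> divides the order of
  \<open>A1\<close>, so the Hall condition keeps \<open>p\<close> out of the index of
  \<open>A1\<close> in \<open>E\<close>, and \<open>A\<close> stays a Sylow subgroup.\<close>

lemma hall_overgroup:
  assumes p: "prime p" and A: "psubgroup p A" "A \<noteq> {\<one>}" and A1: "subgroup A1 G" "A \<subseteq> A1" "card A1 = card A * i" "\<not> p dvd i"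
  shows "\<exists>E. S_quasinormal E G \<and> subgroup E G \<and> A1 \<subseteq> E \<and> sylow_in p A E"
proof -
  obtain E m where E: "S_quasinormal E G" "subgroup E G" "A1 \<subseteq> E" "card E = card A1 * m" "coprime (card A1) m"
    using hall_embeddedE[OF emb[OF A1(1)]] .
  obtain k where k: "card A = p ^ k" and sA: "subgroup A G" using A by (auto simp: psubgroup_def)
  have "card A \<noteq> 1" using A(2) sA subgroup.one_closed[OF sA] by (auto simp: card_1_singleton_iff)
  then have "p dvd card A" using k by (cases k) auto
  then have "p dvd card A1" using A1(3) by simp
  then have "\<not> p dvd m" using E(5) p by (meson coprime_common_divisor not_prime_unit)
  then have "\<not> p dvd i * m" using A1(4) p prime_dvd_mult_iff by blast
  moreover have "card E = card A * (i * m)" using E(4) A1(3) by simp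
  ultimately have "sylow_in p A E" using sylow_inI[OF p A(1)] A1(2) E(3) by blast
  then show ?thesis using E by blast
qed

text \<open>The hull is generated by the \<open>p\<close>-elements of an S-quasinormal
  \<open>E\<close> in which \<open>A\<close> is a Sylow subgroup. A \<open>q\<close>-element
  \<open>y\<close> of a Sylow subgroup \<open>Q\<close> conjugates a \<open>p\<close>-element of
  \<open>E\<close> to a \<open>p\<close>-element of \<open>E <#> Q\<close>, which lies in
  \<open>E\<close> again. So \<open>y\<close> normalizes the hull, though perhaps not
  \<open>E\<close>.\<close>

lemma strongly_closed_hull:
  assumes p: "prime p" and A: "psubgroup p A" "A \<noteq> {\<one>}"
  shows "\<exists>B. subgroup B G \<and> sylow_in p A B \<and> (\<forall>q y. prime q \<longrightarrow> q \<noteq> p \<longrightarrow> pelement q y \<longrightarrow> normalizes y B)"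
proof -
  have sA: "subgroup A G" using A by (simp add: psubgroup_def)
  obtain E where E: "S_quasinormal E G" "subgroup E G" "A \<subseteq> E" "sylow_in p A E"
    using hall_overgroup[OF p A sA order_refl, of 1] p not_prime_unit by auto
  let ?S = "{x \<in> E. pelement p x}"
  let ?B = "generate G ?S"
  have S: "?S \<subseteq> carrier G" using pelement_carrier by auto
  have B: "subgroup ?B G" using subgroup_generate[OF S] .
  have AS: "A \<subseteq> ?S" using E(3) A(1) psubgroup_pelement by auto
  have SB: "?S \<subseteq> ?B" by (auto intro: generate.incl)
  have BE: "?B \<subseteq> E" by (rule generate_subgroup_incl[OF _ E(2)]) auto
  have "sylow_in p A ?B" using sylow_in_between[OF p E(2,4) B _ BE] AS SB by blast
  moreover have "normalizes y ?B" if q: "prime q" "q \<noteq> p" "pelement q y" for q y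
  proof (rule normalizes_generate[OF pelement_carrier[OF q(3)] S])
    fix s assume s: "s \<in> ?S"
    obtain Q where Q: "sylow_in q Q (carrier G)" "y \<in> Q"
      using pelement_in_sylow[OF q(1) subgroup_self q(3)] pelement_carrier[OF q(3)] by blast
    note EQ = S_quasinormalD(2)[OF E(1) q(1) Q(1)]
    have "s \<in> E <#> Q" "y \<in> E <#> Q"
      using set_mult_incl[OF E(2) sylow_inD(1)[OF Q(1)]] s Q(2) by auto
    then have "conjugate y s \<in> E <#> Q" using EQ by (simp add: subgroup.m_closed subgroup.m_inv_closed)
    moreover have pe: "pelement p (conjugate y s)" using s pelement_conj pelement_carrier[OF q(3)] by blast
    ultimately have "conjugate y s \<in> E" using S_quasinormal_pelement[OF E(1) q(1) p q(2) Q(1)] by blast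
    then show "conjugate y s \<in> ?B" using pe SB by blast
  qed
  ultimately show ?thesis using B by blast
qed

lemma normalizes_powers:
  assumes y: "normalizes y A" and A: "A \<subseteq> carrier G" shows "normalizes (y [^] (n::nat)) A"
proof (induction n)
  case 0
  show ?case using A by (auto simp: normalizes_def)
next
  case (Suc n)
  then show ?case using normalizes_mult[OF Suc y A] by simp
qed

text \<open>The hypothesis is applied to \<open>A <#> ?Y\<close>: its overgroup \<open>E\<close>
  contains \<open>y\<close> and still has \<open>A\<close> as a Sylow \<open>p\<close>-subgroup. The
  conjugate of \<open>y\<close> by \<open>u\<close> is a \<open>q\<close>-element of
  \<open>E <#> P\<close>, hence lies in \<open>E\<close>. So the commutator is in
  \<open>S \<inter> E\<close>, a \<open>p\<close>-subgroup of \<open>E\<close> that contains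
  \<open>A\<close> and therefore equals \<open>A\<close>.\<close>

lemma commutator_in:
  assumes p: "prime p" "prime q" "q \<noteq> p" and A: "psubgroup p A" "A \<noteq> {\<one>}"
    and y: "pelement q y" "normalizes y A" and S: "psubgroup p S" "A \<subseteq> S" and u: "u \<in> S" "comm u y \<in> S"
  shows "comm u y \<in> A"
proof -
  let ?Y = "generate G {y}"
  have sA: "subgroup A G" and sS: "subgroup S G" using A S by (auto simp: psubgroup_def)
  have yc: "y \<in> carrier G" using pelement_carrier y(1) .
  have Y: "psubgroup q ?Y" using psubgroup_generate[OF p(2) y(1)] .
  then have sY: "subgroup ?Y G" by (simp add: psubgroup_def)
  have A1: "subgroup (A <#> ?Y) G"
  proof (rule set_mult_subgroup[OF sA sY])
    fix h k assume h: "h \<in> A" and "k \<in> ?Y"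
    then obtain n where "k = y [^] (n::nat)" using generate_singleton[OF yc] by auto
    then show "conjugate k h \<in> A"
      using normalizes_powers[OF y(2) subgroup.subset[OF sA]] h by (auto simp: normalizes_def)
  qed
  obtain j where j: "card (A <#> ?Y) = card A * q ^ j"
    using card_between_product[OF p(2) sA Y A1 set_mult_incl(1)[OF sA sY] order_refl A1] by blast
  have nd: "\<not> p dvd q ^ j" using p prime_dvd_power_nat primes_dvd_imp_eq by metis
  obtain E where E: "S_quasinormal E G" "subgroup E G" "A <#> ?Y \<subseteq> E" "sylow_in p A E"
    using hall_overgroup[OF p(1) A A1 set_mult_incl(1)[OF sA sY] j nd] by blast
  obtain P where P: "sylow_in p P (carrier G)" "S \<subseteq> P"
    using psubgroup_in_sylow[OF p(1) subgroup_self S(1) subgroup.subset[OF sS]] by blast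
  note EP = S_quasinormalD(2)[OF E(1) p(1) P(1)]
  have yE: "y \<in> E" using set_mult_incl(2)[OF sA sY] E(3) generate_singleton_mem[OF yc] by blast
  have uc: "u \<in> carrier G" using u sS subgroup_carrier by blast
  have "u \<in> E <#> P" "y \<in> E <#> P" using set_mult_incl[OF E(2) sylow_inD(1)[OF P(1)]] u P(2) yE by auto
  then have "conjugate u y \<in> E <#> P" using EP by (simp add: subgroup.m_closed subgroup.m_inv_closed)
  moreover have "pelement q (conjugate u y)" using y(1) uc pelement_conj by blast
  ultimately have "conjugate u y \<in> E" using S_quasinormal_pelement[OF E(1) p(1,2) p(3)[symmetric] P(1)] by blast
  then have w: "comm u y \<in> S \<inter> E" using u(2) yE E(2) by (simp add: subgroup.m_closed subgroup.m_inv_closed)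
  have "subgroup (S \<inter> E) G" using sS E(2) by (rule subgroups_Inter_pair)
  moreover obtain k where k: "card S = p ^ k" using S(1) by (auto simp: psubgroup_def)
  moreover have "card (S \<inter> E) dvd p ^ k" using subgroup_card_dvd[OF \<open>subgroup (S \<inter> E) G\<close> sS] k by simp
  ultimately have "psubgroup p (S \<inter> E)" using divides_primepow_nat[OF p(1)] by (auto simp: psubgroup_def)
  moreover have "A \<subseteq> S \<inter> E" using S(2) sylow_inD(2)[OF E(4)] by blast
  ultimately have "S \<inter> E = A" using sylow_maximal[OF p(1) E(2,4)] by blast
  then show ?thesis using w by blast
qed

end

section \<open>Transfer\<close>

lemma funpow_fixed: "(f ^^ d) c = c \<Longrightarrow> (f ^^ (d * u)) c = c"
  by (induction u) (simp_all add: funpow_add)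

lemma funpow_prime_inj:
  assumes p: "prime (p::nat)" and c: "(f ^^ p) c = c" "f c \<noteq> c"
  shows "inj_on (\<lambda>i. (f ^^ i) c) {..<p}"
proof -
  have key: False if ij: "i < j" "j < p" "(f ^^ i) c = (f ^^ j) c" for i j
  proof -
    \<comment> \<open>No inverse of \<open>f\<close> is at hand, so both sides are moved forward by
      \<open>p - j\<close> steps. Then \<open>c\<close> has the coprime periods \<open>d\<close> and
      \<open>p\<close>.\<close>
    define d where "d = p - (j - i)"
    have d: "0 < d" "d < p" using ij by (auto simp: d_def)
    have "(f ^^ (p - j + i)) c = (f ^^ (p - j + j)) c" using ij by (simp only: funpow_add o_apply)
    then have fd: "(f ^^ d) c = c" using ij c by (simp add: d_def)
    have "coprime d p" using p d by (metis coprime_commute nat_dvd_not_less prime_imp_coprime)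
    moreover have "p \<noteq> 1" using p not_prime_1 by metis
    ultimately obtain u v where uv: "d * u = p * v + 1" using coprime_bezout_strong by blast
    have "c = (f ^^ (d * u)) c" using funpow_fixed[OF fd] by simp
    also have "\<dots> = f ((f ^^ (p * v)) c)" by (simp add: uv)
    also have "\<dots> = f c" using funpow_fixed[OF c(1)] by simp
    finally show False using c(2) by simp
  qed
  show ?thesis
  proof (rule inj_onI)
    fix i j assume "i \<in> {..<p}" "j \<in> {..<p}" "(f ^^ i) c = (f ^^ j) c"
    then show "i = j" using key[of i j] key[of j i] by (cases i j rule: linorder_cases) auto
  qed
qed

text \<open>The combinatorial core of the transfer. Orbits of \<open>\<tau>\<close> have length 1 or
  \<open>p\<close>; the long ones contribute \<open>\<one>\<close> to the product and
  \<open>p\<close> to the cardinality, so the exponent is the number of fixed points.\<close>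

lemma (in comm_group) finprod_prime_orbits:
  assumes p: "prime (p::nat)" and X: "finite X" and \<tau>: "\<And>c. c \<in> X \<Longrightarrow> \<tau> c \<in> X" "\<And>c. c \<in> X \<Longrightarrow> (\<tau> ^^ p) c = c"
    and f: "f \<in> X \<rightarrow> carrier G" and w: "w \<in> carrier G"
    and fixed: "\<And>c. c \<in> X \<Longrightarrow> \<tau> c = c \<Longrightarrow> f c = w"
    and moved: "\<And>c. c \<in> X \<Longrightarrow> \<tau> c \<noteq> c \<Longrightarrow> finprod G (\<lambda>i. f ((\<tau> ^^ i) c)) {..<p} = \<one>"
  shows "\<exists>k. finprod G f X = w [^] (k::nat) \<and> [k = card X] (mod p)"
  using X \<tau> f fixed moved
proof (induction "card X" arbitrary: X rule: less_induct)
  case less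
  show ?case
  proof (cases "\<forall>c\<in>X. \<tau> c = c")
    case True
    have "finprod G f X = finprod G (\<lambda>_. w) X"
      by (rule finprod_cong') (use True less.prems w in auto)
    then have "finprod G f X = w [^] card X" using finprod_const[OF w] by simp
    then show ?thesis using cong_refl by blast
  next
    case False
    then obtain c where c: "c \<in> X" "\<tau> c \<noteq> c" by blast
    define Ob where "Ob = (\<lambda>i. (\<tau> ^^ i) c) ` {..<p}"
    have p0: "p > 0" using p prime_gt_0_nat by blast
    have itX: "(\<tau> ^^ i) c \<in> X" for i by (induction i) (use c less.prems in auto)
    have OX: "Ob \<subseteq> X" using itX by (auto simp: Ob_def)
    have inj: "inj_on (\<lambda>i. (\<tau> ^^ i) c) {..<p}" using funpow_prime_inj[OF p less.prems(3)[OF c(1)] c(2)] .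
    have cO: "card Ob = p" using card_image[OF inj] by (simp add: Ob_def)
    have Ot: "(\<tau> ^^ i) x \<in> Ob" if x: "x \<in> Ob" for i x
    proof -
      obtain j where "x = (\<tau> ^^ j) c" using x by (auto simp: Ob_def)
      then have "(\<tau> ^^ i) x = (\<tau> ^^ (i + j)) c" by (simp add: funpow_add)
      also have "\<dots> = (\<tau> ^^ ((i + j) mod p + p * ((i + j) div p))) c" by simp
      also have "\<dots> = (\<tau> ^^ ((i + j) mod p)) c"
        using funpow_fixed[of p \<tau> c] less.prems(3)[OF c(1)] by (simp only: funpow_add o_apply)
      finally show ?thesis using p0 by (auto simp: Ob_def)
    qed
    have cl: "\<tau> x \<in> X - Ob" if x: "x \<in> X - Ob" for x
    proof -
      have "\<tau> x \<notin> Ob"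
      proof
        assume "\<tau> x \<in> Ob"
        then have "(\<tau> ^^ (p - 1)) (\<tau> x) \<in> Ob" using Ot by blast
        moreover have "(\<tau> ^^ (p - 1)) (\<tau> x) = (\<tau> ^^ Suc (p - 1)) x" by (simp only: funpow_Suc_right o_apply)
        moreover have "Suc (p - 1) = p" using p0 by simp
        ultimately have "x \<in> Ob" using less.prems(3)[of x] x by simp
        then show False using x by simp
      qed
      then show ?thesis using x less.prems(2) by blast
    qed
    have lt: "card (X - Ob) < card X" 
    proof (rule psubset_card_mono[OF less.prems(1)])
      have "c \<in> Ob" unfolding Ob_def by (rule image_eqI[of _ _ 0]) (use p0 in auto)
      then show "X - Ob \<subset> X" using c by blast
    qed
    have "\<exists>k. finprod G f (X - Ob) = w [^] k \<and> [k = card (X - Ob)] (mod p)"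
      by (rule less.hyps[OF lt]) (use less.prems cl in auto)
    then obtain k where k: "finprod G f (X - Ob) = w [^] k" "[k = card (X - Ob)] (mod p)" by blast
    have fO: "finprod G f Ob = \<one>"
    proof -
      have "finprod G f Ob = finprod G (\<lambda>i. f ((\<tau> ^^ i) c)) {..<p}"
        unfolding Ob_def by (rule finprod_reindex[OF _ inj]) (use itX less.prems in auto)
      then show ?thesis using less.prems(6)[OF c] by simp
    qed
    have "X = Ob \<union> (X - Ob)" using OX by blast
    then have "finprod G f X = finprod G f (Ob \<union> (X - Ob))" by simp
    also have "\<dots> = finprod G f Ob \<otimes> finprod G f (X - Ob)"
      by (rule finprod_Un_disjoint) (use less.prems OX finite_subset in auto)
    finally have "finprod G f X = w [^] k" using fO k w by simp
    moreover have "card X = card (X - Ob) + p"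
      using card_Un_disjoint[of "X - Ob" Ob] cO OX less.prems(1) finite_subset[OF OX] by (simp add: Un_absorb2 Int_commute)
    then have "[k = card X] (mod p)" using k(2) by (simp add: cong_def)
    ultimately show ?thesis by blast
  qed
qed

lemma (in finite_group) prime_order_comm:
  assumes "prime (order G)" shows "comm_group G"
proof (rule group_comm_groupI)
  fix x y assume x: "x \<in> carrier G" and y: "y \<in> carrier G"
  show "x \<otimes> y = y \<otimes> x"
  proof (cases "x = \<one>")
    case True then show ?thesis using y by simp
  next
    case False
    have "ord x dvd order G" using ord_dvd_group_order x by blast
    then have "ord x = order G" using assms ord_eq_1[OF x] False prime_nat_iff by blast
    then have "card (generate G {x}) = card (carrier G)" using card_generate_singleton[OF x] by (simp add: order_def)
    moreover have "generate G {x} \<subseteq> carrier G" using x generate_in_carrier[of "{x}"] by blast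
    ultimately have "generate G {x} = carrier G" using fin card_subset_eq by blast
    then obtain n where "y = x [^] (n::nat)" using generate_singleton[OF x] y by auto
    then show ?thesis using x using nat_pow_Suc nat_pow_Suc2 by metis
  qed
qed

context finite_group begin

text \<open>\<open>V\<close> is the transfer into \<open>H/B\<close>, a group of order
  \<open>p\<close>, and \<open>K\<close> is its kernel. By the fusion condition \<open>V x\<close>
  is a power of the class of \<open>x\<close> whose exponent is congruent to the index
  \<open>m\<close> modulo \<open>p\<close>, hence not trivial. A \<open>q\<close>-element with
  \<open>q \<noteq> p\<close> has trivial image in a group of order \<open>p\<close>.\<close>

lemma transfer_p_complement:
  assumes p: "prime p" and H: "subgroup H G" and B: "subgroup B G" "\<And>g. g \<in> carrier G \<Longrightarrow> normalizes g B" "B \<subseteq> H"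
    and card: "card H = p * card B" and idx: "card (carrier G) = card H * m" "\<not> p dvd m"
    and x: "x \<in> H" "x \<notin> B"
    and fusion: "\<And>t. t \<in> carrier G \<Longrightarrow> conjugate t x \<in> H \<Longrightarrow> comm t x \<in> B"
  shows "\<exists>K. subgroup K G \<and> (\<forall>g\<in>carrier G. normalizes g K) \<and> x \<notin> K \<and>
    (\<forall>q y. prime q \<longrightarrow> q \<noteq> p \<longrightarrow> pelement q y \<longrightarrow> y \<in> K)"
proof -
  define Z where "Z = (G\<lparr>carrier := H\<rparr>) Mod B"
  define \<phi> where "\<phi> h = B #> h" for h
  define C where "C = rcosets H"
  define \<sigma> where "\<sigma> c = (SOME y. y \<in> c)" for c :: "'a set"
  \<comment> \<open>\<open>\<sigma> c \<otimes> g\<close> lies in the coset \<open>c #> g\<close>;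
    its factor in \<open>H\<close> relative to the chosen representative of that coset is read
    modulo \<open>B\<close>.\<close>
  let ?F = "\<lambda>g c. \<phi> (\<sigma> c \<otimes> g \<otimes> inv (\<sigma> (c #> g)))"
  define V where "V g = finprod Z (?F g) C" for g
  have Hc: "\<And>h. h \<in> H \<Longrightarrow> h \<in> carrier G" using H subgroup_carrier by auto
  have xc: "x \<in> carrier G" using x Hc by blast
  have Bn: "B \<lhd> G" using B by (intro normal_invI) (auto simp: normalizes_def)
  interpret Bn: normal B G by (rule Bn)
  interpret H: finite_group "G\<lparr>carrier := H\<rparr>" using finite_group_subgroup H by blast
  have BnH: "B \<lhd> (G\<lparr>carrier := H\<rparr>)" using normal_restrict_supergroup[OF H Bn B(3)] .
  interpret BnH: normal B "G\<lparr>carrier := H\<rparr>" by (rule BnH)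
  interpret Z: group Z unfolding Z_def by (rule BnH.factorgroup_is_group)
  have Zc: "carrier Z = \<phi> ` H" by (simp add: Z_def carrier_FactGroup \<phi>_def)
  have Zm: "a \<otimes>\<^bsub>Z\<^esub> b = a <#> b" for a b by (simp add: Z_def)
  have Z1: "\<one>\<^bsub>Z\<^esub> = B" by (simp add: Z_def)
  have \<phi>m: "\<phi> (a \<otimes> b) = \<phi> a \<otimes>\<^bsub>Z\<^esub> \<phi> b" if "a \<in> H" "b \<in> H" for a b
    using that Hc by (simp add: \<phi>_def Zm Bn.rcos_sum)
  have \<phi>c: "\<phi> a \<in> carrier Z" if "a \<in> H" for a using that by (simp add: Zc)
  have \<phi>1: "\<phi> b = \<one>\<^bsub>Z\<^esub> \<longleftrightarrow> b \<in> B" if "b \<in> H" for b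
    using that B(1) Hc coset_join1[of B b] coset_join2[of b B] subgroup.subset[OF B(1)] by (auto simp: \<phi>_def Z1)
  have ordZ: "order Z = p"
  proof -
    have "card (rcosets\<^bsub>G\<lparr>carrier := H\<rparr>\<^esub> B) * card B = card H"
      using H.lagrange[OF BnH.subgroup_axioms] by (simp add: order_def)
    then have "card (rcosets\<^bsub>G\<lparr>carrier := H\<rparr>\<^esub> B) = p" using card subgroup_card_pos[OF B(1)] by simp
    then show ?thesis by (simp add: Z_def order_def FactGroup_def)
  qed
  have finZ: "finite (carrier Z)" using ordZ p prime_gt_0_nat unfolding order_def by (metis card_ge_0_finite)
  interpret Z: finite_group Z by unfold_locales (rule finZ)
  interpret Z: comm_group Z using Z.prime_order_comm ordZ p by simp
  have Zp: "z [^]\<^bsub>Z\<^esub> p = \<one>\<^bsub>Z\<^esub>" if "z \<in> carrier Z" for z using Z.pow_order_eq_1[OF that] ordZ by simp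
  have finC: "finite C" unfolding C_def RCOSETS_def using fin by auto
  have cC: "card C = m"
  proof -
    have "card C * card H = card H * m" using lagrange[OF H] idx(1) by (simp add: C_def order_def)
    then show ?thesis using subgroup_card_pos[OF H] by simp
  qed
  have C1: "\<sigma> c \<in> carrier G \<and> c = H #> \<sigma> c" if c: "c \<in> C" for c
  proof -
    obtain a where a: "a \<in> carrier G" "c = H #> a" using c by (auto simp: C_def RCOSETS_def)
    have "a \<in> c" using rcos_self[OF a(1) H] a(2) by simp
    then have "\<sigma> c \<in> c" unfolding \<sigma>_def by (rule someI)
    then have "\<sigma> c \<in> H #> a" using a(2) by simp
    moreover have "\<sigma> c \<in> carrier G" using calculation r_coset_subset_G[OF subgroup.subset[OF H] a(1)] by blast
    ultimately show ?thesis using a repr_independence[OF _ a(1) H] by simp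
  qed
  have C2: "H #> (\<sigma> c \<otimes> g) = c #> g" if "c \<in> C" "g \<in> carrier G" for c g
    using C1[OF that(1)] that(2) coset_mult_assoc[OF subgroup.subset[OF H], of "\<sigma> c" g] by simp
  have C3: "c #> g \<in> C" if "c \<in> C" "g \<in> carrier G" for c g
  proof -
    have "\<sigma> c \<otimes> g \<in> carrier G" using C1[OF that(1)] that(2) by simp
    then show ?thesis using C2[OF that] by (auto simp: C_def RCOSETS_def)
  qed
  have Csub: "c \<subseteq> carrier G" if "c \<in> C" for c using that by (simp add: C_def subgroup.rcosets_carrier[OF H is_group])
  have Cm: "c #> g #> h = c #> (g \<otimes> h)" if "c \<in> C" "g \<in> carrier G" "h \<in> carrier G" for c g h
    using coset_mult_assoc[OF Csub[OF that(1)]] that by simp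
  have diff: "a \<otimes> inv b \<in> H" if "a \<in> carrier G" "b \<in> carrier G" "H #> a = H #> b" for a b
  proof -
    have "a \<in> H #> b" using rcos_self[OF that(1) H] that(3) by simp
    then obtain h where "h \<in> H" "a = h \<otimes> b" by (auto simp: r_coset_def)
    then show ?thesis using that Hc by (simp add: m_assoc)
  qed
  have inH: "\<sigma> c \<otimes> g \<otimes> inv (\<sigma> (c #> g)) \<in> H" if "c \<in> C" "g \<in> carrier G" for c g
    using diff C1[OF that(1)] C1[OF C3[OF that]] C2[OF that] that(2) by simp
  have fC: "?F g \<in> C \<rightarrow> carrier Z" if "g \<in> carrier G" for g
    using inH that \<phi>c by auto
  have Vc: "V g \<in> carrier Z" if "g \<in> carrier G" for g unfolding V_def using fC[OF that] by (rule Z.finprod_closed)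
  \<comment> \<open>This cocycle identity makes \<open>V\<close> multiplicative once the product
    over \<open>C\<close> is reindexed along \<open>c #> g\<close>.\<close>
  have step: "?F (g \<otimes> h) c =
      ?F g c \<otimes>\<^bsub>Z\<^esub> ?F h (c #> g)"
    if "c \<in> C" "g \<in> carrier G" "h \<in> carrier G" for c g h
  proof -
    have cg: "c #> g \<in> C" "c #> g #> h \<in> C" using C3 that by auto
    have s: "\<sigma> c \<in> carrier G" "\<sigma> (c #> g) \<in> carrier G" "\<sigma> (c #> g #> h) \<in> carrier G" using C1 that cg by auto
    have "\<sigma> c \<otimes> (g \<otimes> h) \<otimes> inv (\<sigma> (c #> g #> h)) =
      (\<sigma> c \<otimes> g \<otimes> inv (\<sigma> (c #> g))) \<otimes> (\<sigma> (c #> g) \<otimes> h \<otimes> inv (\<sigma> (c #> g #> h)))"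
      using s that by (simp add: m_assoc)
    then show ?thesis using \<phi>m inH[OF that(1,2)] inH[OF cg(1) that(3)] Cm[OF that] by simp
  qed
  have Vhom: "V (g \<otimes> h) = V g \<otimes>\<^bsub>Z\<^esub> V h" if gh: "g \<in> carrier G" "h \<in> carrier G" for g h
  proof -
    have inj: "inj_on (\<lambda>c. c #> g) C"
    proof (rule inj_onI)
      fix c d assume cd: "c \<in> C" "d \<in> C" "c #> g = d #> g"
      have "c #> g #> inv g = d #> g #> inv g" using cd(3) by simp
      moreover have "e #> g #> inv g = e" if "e \<in> C" for e
        using Cm[OF that gh(1), of "inv g"] gh(1) coset_mult_one[OF Csub[OF that]] by simp
      ultimately show "c = d" using cd(1,2) by metis
    qed
    have im: "(\<lambda>c. c #> g) ` C = C" by (rule endo_inj_surj[OF finC _ inj]) (use C3 gh in auto)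
    have "V (g \<otimes> h) = finprod Z (\<lambda>c. ?F g c \<otimes>\<^bsub>Z\<^esub> ?F h (c #> g)) C"
      unfolding V_def by (rule Z.finprod_cong') (use gh step fC C3 in \<open>auto simp: Pi_iff\<close>)
    also have "\<dots> = V g \<otimes>\<^bsub>Z\<^esub> finprod Z (\<lambda>c. ?F h (c #> g)) C"
      unfolding V_def by (rule Z.finprod_multf) (use gh fC C3 in \<open>auto simp: Pi_iff\<close>)
    also have "finprod Z (\<lambda>c. ?F h (c #> g)) C = finprod Z (?F h) ((\<lambda>c. c #> g) ` C)"
      by (rule Z.finprod_reindex[symmetric, OF _ inj]) (use im fC[OF gh(2)] in simp)
    finally show ?thesis unfolding im by (simp only: V_def)
  qed
  have hom: "V \<in> hom G Z" using Vc Vhom by (auto simp: hom_def)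
  interpret V: group_hom G Z V by unfold_locales (rule hom)
  define K where "K = kernel G Z V"
  have K: "K \<lhd> G" unfolding K_def by (rule V.normal_kernel)
  have Km: "y \<in> K \<longleftrightarrow> y \<in> carrier G \<and> V y = \<one>\<^bsub>Z\<^esub>" for y by (auto simp: K_def kernel_def)
  have q: "y \<in> K" if q: "prime q" "q \<noteq> p" "pelement q y" for q y
  proof -
    obtain k where k: "y [^] (q ^ k) = \<one>" "y \<in> carrier G" using q by (auto simp: pelement_def)
    have "V y [^]\<^bsub>Z\<^esub> (q ^ k) = V (y [^] (q ^ k))" using V.hom_nat_pow[OF k(2)] by simp
    also have "\<dots> = \<one>\<^bsub>Z\<^esub>" using k(1) by simp
    finally have "V y [^]\<^bsub>Z\<^esub> (q ^ k) = \<one>\<^bsub>Z\<^esub>" .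
    moreover have "coprime (q ^ k) p" using coprime_prime_powers[OF q(1) p q(2), of k 1] by simp
    ultimately have "V y = \<one>\<^bsub>Z\<^esub>" using Z.coprime_pow_one[OF Vc[OF k(2)] _ Zp[OF Vc[OF k(2)]]] by blast
    then show ?thesis using k Km by simp
  qed
  have \<phi>pow: "\<phi> (x [^] n) = \<phi> x [^]\<^bsub>Z\<^esub> (n::nat)" for n
  proof (induction n)
    case 0
    then show ?case using \<phi>1[OF subgroup.one_closed[OF H]] B(1) by (simp add: subgroup.one_closed)
  next
    case (Suc n)
    then show ?case using \<phi>m[OF subgroup_pow[OF H x(1)] x(1), of n] by simp
  qed
  have xp: "x [^] p \<in> B" using \<phi>1[OF subgroup_pow[OF H x(1)]] \<phi>pow[of p] Zp[OF \<phi>c[OF x(1)]] by simp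
  have iter: "((\<lambda>c. c #> x) ^^ i) c = c #> (x [^] i)" if "c \<in> C" for c i
  proof (induction i)
    case 0 then show ?case using Csub[OF that] by simp
  next
    case (Suc i)
    then show ?case using Cm[OF that, of "x [^] i" x] xc by simp
  qed
  have conjB: "\<sigma> c \<otimes> x [^] p \<otimes> inv (\<sigma> c) \<in> B" if "c \<in> C" for c
    using B(2) xp C1[OF that] by (simp add: normalizes_def)
  \<comment> \<open>\<open>x [^] p\<close> lies in \<open>B\<close>, which is normal in
    \<open>G\<close> and contained in \<open>H\<close>, so it fixes every coset: the orbits of
    \<open>x\<close> on \<open>C\<close> have length 1 or \<open>p\<close>.\<close>
  have tp: "c #> (x [^] p) = c" if "c \<in> C" for c
  proof -
    have s: "\<sigma> c \<in> carrier G" "c = H #> \<sigma> c" using C1[OF that] by auto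
    have h: "\<sigma> c \<otimes> x [^] p \<otimes> inv (\<sigma> c) \<in> H" using conjB[OF that] B(3) by blast
    have "c #> (x [^] p) = H #> (\<sigma> c \<otimes> x [^] p)" using C2[OF that] xc by simp
    also have "\<sigma> c \<otimes> x [^] p = (\<sigma> c \<otimes> x [^] p \<otimes> inv (\<sigma> c)) \<otimes> \<sigma> c" using s(1) xc by (simp add: m_assoc)
    also have "H #> \<dots> = H #> (\<sigma> c \<otimes> x [^] p \<otimes> inv (\<sigma> c)) #> \<sigma> c"
      using coset_mult_assoc[OF subgroup.subset[OF H] Hc[OF h] s(1)] by simp
    also have "H #> (\<sigma> c \<otimes> x [^] p \<otimes> inv (\<sigma> c)) = H" using coset_join2[OF Hc[OF h] H h] .
    finally show ?thesis using s(2) by simp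
  qed
  \<comment> \<open>Along an orbit the representatives cancel; for \<open>n = p\<close> a conjugate
    of \<open>x [^] p\<close> remains, which is trivial modulo \<open>B\<close>.\<close>
  have tele: "finprod Z (\<lambda>i. ?F x (c #> x [^] i)) {..<n::nat}
      = ?F (x [^] n) c" if c: "c \<in> C" for c n
  proof (induction n)
    case 0
    show ?case using C1[OF c] Csub[OF c] \<phi>1[OF subgroup.one_closed[OF H]] subgroup.one_closed[OF B(1)] by simp
  next
    case (Suc n)
    have cx: "c #> x [^] i \<in> C" for i :: nat using C3[OF c] xc by simp
    have f: "(\<lambda>i. ?F x (c #> x [^] i)) \<in> A \<rightarrow> carrier Z" for A :: "nat set"
      using inH[OF cx xc] \<phi>c by auto
    have "finprod Z (\<lambda>i. ?F x (c #> x [^] i)) {..<Suc n} =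
      ?F x (c #> x [^] n) \<otimes>\<^bsub>Z\<^esub> ?F (x [^] n) c"
      unfolding lessThan_Suc Suc.IH[symmetric] by (rule Z.finprod_insert) (use f[of UNIV] f in auto)
    also have "\<dots> = ?F (x [^] n) c \<otimes>\<^bsub>Z\<^esub> ?F x (c #> x [^] n)"
      by (rule Z.m_comm) (use inH[OF cx xc] inH[OF c] xc \<phi>c in auto)
    also have "\<dots> = ?F (x [^] n \<otimes> x) c"
      by (rule step[symmetric, OF c _ xc]) (use xc in simp)
    finally show ?case by simp
  qed
  have "\<exists>k. finprod Z (?F x) C = \<phi> x [^]\<^bsub>Z\<^esub> (k::nat) \<and> [k = card C] (mod p)"
  proof (rule Z.finprod_prime_orbits[OF p finC, where \<tau>="\<lambda>c. c #> x"])
    show "\<And>c. c \<in> C \<Longrightarrow> c #> x \<in> C" using C3 xc by blast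
    show "\<And>c. c \<in> C \<Longrightarrow> ((\<lambda>c. c #> x) ^^ p) c = c" using iter tp by simp
    show "?F x \<in> C \<rightarrow> carrier Z" using fC xc by blast
    show "\<phi> x \<in> carrier Z" using \<phi>c x by blast
    fix c assume c: "c \<in> C"
    show "finprod Z (\<lambda>i. \<phi> (\<sigma> (((\<lambda>c. c #> x) ^^ i) c) \<otimes> x \<otimes> inv (\<sigma> (((\<lambda>c. c #> x) ^^ i) c #> x)))) {..<p} = \<one>\<^bsub>Z\<^esub>"
    proof -
      have "\<phi> (\<sigma> c \<otimes> x [^] p \<otimes> inv (\<sigma> c)) = \<one>\<^bsub>Z\<^esub>" using conjB[OF c] \<phi>1 B(3) by blast
      then show ?thesis unfolding iter[OF c] tele[OF c] tp[OF c] .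
    qed
    assume e: "c #> x = c"
    \<comment> \<open>A fixed coset contributes a conjugate of \<open>x\<close> that lies in
      \<open>H\<close>, and by fusion it has the class of \<open>x\<close>.\<close>
    have h: "\<sigma> c \<otimes> x \<otimes> inv (\<sigma> c) \<in> H" using inH[OF c xc] e by simp
    have s: "\<sigma> c \<in> carrier G" using C1[OF c] by blast
    have b: "\<sigma> c \<otimes> x \<otimes> inv (\<sigma> c) \<otimes> inv x \<in> B" using fusion[OF s h] .
    have "\<sigma> c \<otimes> x \<otimes> inv (\<sigma> c) = (\<sigma> c \<otimes> x \<otimes> inv (\<sigma> c) \<otimes> inv x) \<otimes> x" using s xc by (simp add: m_assoc)
    then have "\<phi> (\<sigma> c \<otimes> x \<otimes> inv (\<sigma> c)) = \<phi> (\<sigma> c \<otimes> x \<otimes> inv (\<sigma> c) \<otimes> inv x) \<otimes>\<^bsub>Z\<^esub> \<phi> x"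
      using \<phi>m[of "\<sigma> c \<otimes> x \<otimes> inv (\<sigma> c) \<otimes> inv x" x] b B(3) x(1) by auto
    moreover have "\<phi> (\<sigma> c \<otimes> x \<otimes> inv (\<sigma> c) \<otimes> inv x) = \<one>\<^bsub>Z\<^esub>" using \<phi>1 b B(3) by blast
    ultimately have "\<phi> (\<sigma> c \<otimes> x \<otimes> inv (\<sigma> c)) = \<phi> x" using \<phi>c[OF x(1)] by simp
    then show "?F x c = \<phi> x" unfolding e .
  qed
  then obtain k where k: "V x = \<phi> x [^]\<^bsub>Z\<^esub> k" "[k = m] (mod p)" unfolding cC V_def by blast
  have "x \<notin> K"
  proof
    assume "x \<in> K"
    then have k1: "\<phi> x [^]\<^bsub>Z\<^esub> k = \<one>\<^bsub>Z\<^esub>" using Km k(1) by simp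
    have "\<not> p dvd k" using k(2) idx(2) cong_dvd_iff by blast
    then have "coprime k p" using p prime_imp_coprime coprime_commute by blast
    then have "\<phi> x = \<one>\<^bsub>Z\<^esub>" using Z.coprime_pow_one[OF \<phi>c[OF x(1)] k1 Zp[OF \<phi>c[OF x(1)]]] by blast
    then show False using \<phi>1[OF x(1)] x(2) by simp
  qed
  moreover have "normalizes g K" if "g \<in> carrier G" for g
    using normal_invE(2)[OF K] that by (simp add: normalizes_def)
  ultimately show ?thesis using normal_imp_subgroup[OF K] q by blast
qed

lemma prime_index_maximal:
  assumes p: "prime p" and H: "subgroup H G" and B: "subgroup B G" and T: "subgroup T G" "B \<subseteq> T" "T \<subseteq> H"
    and card: "card H = p * card B" and x: "x \<in> T" "x \<notin> B"
  shows "T = H"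
proof -
  obtain d where d: "card T = card B * d" using subgroup_card_dvd[OF B T(1,2)] by (auto elim: dvdE)
  have "card T dvd card H" using subgroup_card_dvd[OF T(1) H T(3)] .
  then have "d dvd p" using d card subgroup_card_pos[OF B] by (simp add: mult.commute)
  moreover have "d \<noteq> 1"
  proof
    assume "d = 1"
    then have "B = T" using card_subset_eq[OF subgroup_finite[OF T(1)] T(2)] d by simp
    then show False using x by blast
  qed
  ultimately have "d = p" using p prime_nat_iff by blast
  then show ?thesis using card_subset_eq[OF subgroup_finite[OF H] T(3)] d card by simp
qed

text \<open>\<open>H/B\<close> has prime order and is therefore abelian.\<close>

lemma index_prime_commutators:
  assumes p: "prime p" and H: "subgroup H G" and B: "subgroup B G" "B \<subseteq> H" "\<And>h. h \<in> H \<Longrightarrow> normalizes h B"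
    and card: "card H = p * card B" and hk: "h \<in> H" "k \<in> H"
  shows "comm h k \<in> B"
proof -
  let ?H = "G\<lparr>carrier := H\<rparr>"
  have Hc: "\<And>h. h \<in> H \<Longrightarrow> h \<in> carrier G" using H subgroup_carrier by auto
  interpret H: finite_group ?H using finite_group_subgroup H by blast
  have sB: "subgroup B ?H" using subgroup_incl[OF B(1) H B(2)] .
  have Bn: "B \<lhd> ?H"
    by (rule H.normal_invI[OF sB]) (use B(3) in \<open>simp add: normalizes_def m_inv_consistent[OF H]\<close>)
  interpret B: normal B ?H by (rule Bn)
  have grp: "group (?H Mod B)" by (rule B.factorgroup_is_group)
  have ord: "order (?H Mod B) = p"
  proof -
    have "card (rcosets\<^bsub>?H\<^esub> B) * card B = card H"
      using H.lagrange[OF sB] by (simp add: order_def)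
    then have "card (rcosets\<^bsub>?H\<^esub> B) = p" using card subgroup_card_pos[OF B(1)] by simp
    then show ?thesis by (simp add: order_def FactGroup_def)
  qed
  have "finite (carrier (?H Mod B))" using ord p prime_gt_0_nat unfolding order_def by (metis card_ge_0_finite)
  then interpret Z: finite_group "?H Mod B" using grp by (simp add: finite_group_def finite_group_axioms_def)
  have "comm_group (?H Mod B)" using Z.prime_order_comm ord p by simp
  then have "(B #> h) <#> (B #> k) = (B #> k) <#> (B #> h)"
    using hk comm_groupE(4)[of "?H Mod B" "B #> h" "B #> k"] by (auto simp: carrier_FactGroup)
  moreover have "(B #> h) <#> (B #> k) = B #> (h \<otimes> k)" "(B #> k) <#> (B #> h) = B #> (k \<otimes> h)"
    using B.rcos_sum[of h k] B.rcos_sum[of k h] hk by simp_all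
  ultimately have "B #> (h \<otimes> k) = B #> (k \<otimes> h)" by simp
  moreover have "h \<otimes> k \<in> B #> (h \<otimes> k)" using rcos_self[OF _ B(1)] hk Hc by simp
  ultimately have "h \<otimes> k \<in> B #> (k \<otimes> h)" by simp
  then obtain b where b: "b \<in> B" "h \<otimes> k = b \<otimes> (k \<otimes> h)" by (auto simp: r_coset_def)
  have bc: "b \<in> carrier G" using b(1) B(2) Hc by blast
  have "comm h k = b" unfolding b(2) using bc hk Hc by (simp add: m_assoc)
  then show ?thesis using b by simp
qed

section \<open>Transfer inside a subgroup and Burnside's criterion\<close>

lemma normalizer_subgroup:
  assumes "S \<subseteq> carrier G" shows "subgroup {g \<in> carrier G. normalizes g S} G"
proof (rule subgroupI_finite)
  show "\<one> \<in> {g \<in> carrier G. normalizes g S}" using assms by (auto simp: normalizes_def)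
qed (use assms normalizes_mult in auto)

lemma generate_pelements_normal:
  assumes g: "g \<in> carrier G"
  shows "normalizes g (generate G {y. \<exists>q. prime q \<and> Q q \<and> pelement q y})"
proof (rule normalizes_generate[OF g])
  show "{y. \<exists>q. prime q \<and> Q q \<and> pelement q y} \<subseteq> carrier G" using pelement_carrier by auto
  fix s assume "s \<in> {y. \<exists>q. prime q \<and> Q q \<and> pelement q y}"
  then have "conjugate g s \<in> {y. \<exists>q. prime q \<and> Q q \<and> pelement q y}" using pelement_conj g by blast
  then show "conjugate g s \<in> generate G {y. \<exists>q. prime q \<and> Q q \<and> pelement q y}" by (rule generate.incl)
qed

text \<open>This is \<open>transfer_p_complement\<close> in the group record on \<open>R\<close>,
  where products, inverses and powers agree with those of \<open>G\<close>, so that normalizing and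
  being a \<open>p\<close>-element carry over.\<close>

lemma transfer_subgroup:
  assumes p: "prime p" and R: "subgroup R G" and H: "subgroup H G" "H \<subseteq> R"
    and B: "subgroup B G" "\<And>g. g \<in> R \<Longrightarrow> normalizes g B" "B \<subseteq> H"
    and card: "card H = p * card B" and idx: "card R = card H * m" "\<not> p dvd m"
    and x: "x \<in> H" "x \<notin> B"
    and fusion: "\<And>t. t \<in> R \<Longrightarrow> conjugate t x \<in> H \<Longrightarrow> comm t x \<in> B"
  shows "\<exists>K. subgroup K G \<and> K \<subseteq> R \<and> (\<forall>g\<in>R. normalizes g K) \<and> x \<notin> K \<and>
    (\<forall>q y. prime q \<longrightarrow> q \<noteq> p \<longrightarrow> pelement q y \<longrightarrow> y \<in> R \<longrightarrow> y \<in> K)"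
proof -
  interpret R: finite_group "G\<lparr>carrier := R\<rparr>" using finite_group_subgroup R by blast
  have Rc: "\<And>h. h \<in> R \<Longrightarrow> h \<in> carrier G" using R subgroup_carrier by auto
  have n: "R.normalizes g S \<longleftrightarrow> g \<in> R \<and> normalizes g S" for g S
    by (auto simp: R.normalizes_def normalizes_def Rc m_inv_consistent[OF R])
  have pe: "R.pelement q y \<longleftrightarrow> y \<in> R \<and> pelement q y" for q y
    by (auto simp: R.pelement_def pelement_def Rc nat_pow_consistent[symmetric])
  have "\<exists>K. subgroup K (G\<lparr>carrier := R\<rparr>) \<and> (\<forall>g\<in>carrier (G\<lparr>carrier := R\<rparr>). R.normalizes g K) \<and> x \<notin> K \<and>
    (\<forall>q y. prime q \<longrightarrow> q \<noteq> p \<longrightarrow> R.pelement q y \<longrightarrow> y \<in> K)"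
  proof (rule R.transfer_p_complement[OF p])
    show "subgroup H (G\<lparr>carrier := R\<rparr>)" using subgroup_incl[OF H(1) R H(2)] .
    show "subgroup B (G\<lparr>carrier := R\<rparr>)" using subgroup_incl[OF B(1) R] B(3) H(2) by blast
    show "card (carrier (G\<lparr>carrier := R\<rparr>)) = card H * m" using idx by simp
  qed (use assms in \<open>auto simp: n m_inv_consistent[OF R] subset_iff\<close>)
  then obtain K where K: "subgroup K (G\<lparr>carrier := R\<rparr>)" "\<forall>g\<in>R. R.normalizes g K" "x \<notin> K"
    "\<forall>q y. prime q \<longrightarrow> q \<noteq> p \<longrightarrow> R.pelement q y \<longrightarrow> y \<in> K" by auto
  have "subgroup K G" using incl_subgroup[OF R K(1)] .
  moreover have "K \<subseteq> R" using subgroup.subset[OF K(1)] by simp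
  ultimately show ?thesis using K n pe by blast
qed

lemma card_one_iff: "subgroup H G \<Longrightarrow> card H = 1 \<longleftrightarrow> H = {\<one>}"
  using subgroup.one_closed by (auto simp: card_1_singleton_iff)

text \<open>The hypothesis on \<open>N\<^sub>R(S)\<close> is Burnside's fusion condition, taken modulo \<open>B\<close>.\<close>

lemma burnside_transfer:
  assumes p: "prime p" and R: "subgroup R G" and S: "sylow_in p S R"
    and B: "subgroup B G" "B \<subseteq> R" "\<And>g. g \<in> R \<Longrightarrow> normalizes g B"
    and A: "sylow_in p A B" "A \<subseteq> S" "card S = p * card A"
    and x: "x \<in> S" "x \<notin> A"
    and fusion: "\<And>n s. n \<in> R \<Longrightarrow> normalizes n S \<Longrightarrow> s \<in> S \<Longrightarrow> comm n s \<in> B"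
  shows "\<exists>K. subgroup K G \<and> K \<subseteq> R \<and> (\<forall>g\<in>R. normalizes g K) \<and> x \<notin> K \<and>
    (\<forall>q y. prime q \<longrightarrow> q \<noteq> p \<longrightarrow> pelement q y \<longrightarrow> y \<in> R \<longrightarrow> y \<in> K)"
proof -
  have Rc: "\<And>h. h \<in> R \<Longrightarrow> h \<in> carrier G" using R subgroup_carrier by auto
  note sS = sylow_inD(1)[OF S] and SR = sylow_inD(2)[OF S]
  have SB: "S \<inter> B = A"
  proof (rule sylow_maximal[OF p B(1) A(1)])
    have s: "subgroup (S \<inter> B) G" using sS B(1) by (rule subgroups_Inter_pair)
    have "card (S \<inter> B) dvd card S" using subgroup_card_dvd[OF s sS] by simp
    then show "psubgroup p (S \<inter> B)" using s S divides_primepow_nat[OF p] by (auto simp: psubgroup_def sylow_in_def)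
  qed (use A sylow_inD(2)[OF A(1)] in auto)
  \<comment> \<open>Since \<open>S \<inter> B = A\<close> has index \<open>p\<close> in
    \<open>S\<close>, the index of \<open>B\<close> in \<open>H\<close> is \<open>p\<close>; as
    \<open>H\<close> contains \<open>S\<close>, its index in \<open>R\<close> is prime to
    \<open>p\<close>. These are the numbers that transfer asks for.\<close>
  define H where "H = B <#> S"
  have sH: "subgroup H G" unfolding H_def
    by (rule set_mult_subgroup[OF B(1) sS]) (use B(3) SR in \<open>auto simp: normalizes_def\<close>)
  have BH: "B \<subseteq> H" and SH: "S \<subseteq> H" unfolding H_def using set_mult_incl[OF B(1) sS] by auto
  have HR: "H \<subseteq> R" unfolding H_def set_mult_def using B(2) SR R by (auto intro: subgroup.m_closed)
  have cA: "card A > 0" using subgroup_card_pos[OF sylow_inD(1)[OF A(1)]] .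
  have "card H * card A = card B * (p * card A)"
    using card_set_mult[OF B(1) sS] SB A(3) by (simp add: H_def Int_commute)
  then have cH: "card H = p * card B" using cA by simp
  obtain j where j: "card B = card A * j" using subgroup_card_dvd[OF sylow_inD(1)[OF A(1)] B(1) sylow_inD(2)[OF A(1)]] by (auto elim: dvdE)
  have jp: "\<not> p dvd j" using sylow_index[OF p B(1) A(1) j] .
  have SH': "sylow_in p S H"
    by (rule sylow_inI[OF p sylow_inD(3)[OF S] SH _ jp]) (use cH j A(3) in simp)
  obtain m where m: "card R = card H * m" using subgroup_card_dvd[OF sH R HR] by (auto elim: dvdE)
  have "card R = card S * (j * m)" using m cH j A(3) by simp
  then have "\<not> p dvd j * m" using sylow_index[OF p R S] by blast
  then have mp: "\<not> p dvd m" by auto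
  have xB: "x \<notin> B" using x SB by blast
  have xH: "x \<in> H" using x SH by blast
  have HB: "normalizes h B" if "h \<in> H" for h using that HR B(3) by blast
  \<comment> \<open>The elements of \<open>H\<close> that \<open>t\<close> conjugates into
    \<open>H\<close> form a subgroup containing \<open>B\<close> and \<open>x\<close>. As
    \<open>B\<close> has prime index, it is all of \<open>H\<close>, so \<open>t\<close> normalizes
    \<open>H\<close>.\<close>
  have Hgen: "H \<subseteq> {h \<in> carrier G. conjugate t h \<in> H}" if t: "t \<in> R" "conjugate t x \<in> H" for t
  proof -
    let ?T = "{h \<in> carrier G. conjugate t h \<in> H} \<inter> H"
    have tc: "t \<in> carrier G" using t Rc by blast
    have "subgroup {h \<in> carrier G. conjugate t h \<in> H} G"
    proof (rule subgroupI_finite)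
      show "\<one> \<in> {h \<in> carrier G. conjugate t h \<in> H}" using tc subgroup.one_closed[OF sH] by simp
      fix a b assume ab: "a \<in> {h \<in> carrier G. conjugate t h \<in> H}" "b \<in> {h \<in> carrier G. conjugate t h \<in> H}"
      then have "conjugate t (a \<otimes> b) = conjugate t a \<otimes> conjugate t b" using tc by (simp add: group_simps)
      then show "a \<otimes> b \<in> {h \<in> carrier G. conjugate t h \<in> H}" using ab sH by (simp add: subgroup.m_closed)
    qed auto
    then have sT: "subgroup ?T G" using sH by (rule subgroups_Inter_pair)
    have BT: "B \<subseteq> ?T" using B(3)[OF t(1)] BH subgroup.subset[OF B(1)] by (auto simp: normalizes_def)
    have xT: "x \<in> ?T" using t(2) xH HR Rc by blast
    have "?T = H" by (rule prime_index_maximal[OF p sH B(1) sT BT _ cH xT xB]) blast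
    then show ?thesis by blast
  qed
  show ?thesis
  proof (rule transfer_subgroup[OF p R sH HR B(1,3) BH cH m mp xH xB])
    fix t assume t: "t \<in> R" "conjugate t x \<in> H"
    have tc: "t \<in> carrier G" using t Rc by blast
    have "normalizes t H" using Hgen[OF t] tc by (auto simp: normalizes_def)
    then obtain h where h: "h \<in> H" "normalizes (inv h \<otimes> t) S" using frattini[OF p sH SH'] by blast
    \<comment> \<open>The Frattini argument writes \<open>t\<close> as \<open>h \<otimes> ?n\<close>
      with \<open>?n\<close> normalizing \<open>S\<close>. The commutator of \<open>x\<close> with
      \<open>?n\<close> is in \<open>B\<close> by assumption, and that with \<open>h\<close> because
      \<open>H/B\<close> is abelian.\<close>
    let ?n = "inv h \<otimes> t"
    have hc: "h \<in> carrier G" and xc: "x \<in> carrier G" using h xH HR Rc by auto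
    have "?n \<in> R" using h t HR R by (auto intro: subgroup.m_closed subgroup.m_inv_closed)
    then have b: "comm ?n x \<in> B" using fusion h x by blast
    then have "conjugate h (?n \<otimes> x \<otimes> inv ?n \<otimes> inv x) \<in> B" using HB[OF h(1)] by (simp add: normalizes_def)
    moreover have "comm h x \<in> B"
      using index_prime_commutators[OF p sH B(1) BH HB cH h(1) xH] .
    ultimately have "conjugate h (?n \<otimes> x \<otimes> inv ?n \<otimes> inv x) \<otimes> comm h x \<in> B"
      by (rule subgroup.m_closed[OF B(1)])
    moreover have "conjugate h (?n \<otimes> x \<otimes> inv ?n \<otimes> inv x) \<otimes> comm h x = comm t x"
      using tc hc xc by (simp add: group_simps)
    ultimately show "comm t x \<in> B" by simp
  qed
qed

text \<open>The product of \<open>S\<close> with the cyclic group of \<open>n\<close> is a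
  \<open>p\<close>-subgroup of \<open>R\<close> containing \<open>S\<close>, hence equal to
  it.\<close>

lemma sylow_contains_normalizing:
  assumes p: "prime p" and R: "subgroup R G" and S: "sylow_in p S R" and n: "n \<in> R" "pelement p n" "normalizes n S"
  shows "n \<in> S"
proof -
  note sS = sylow_inD(1)[OF S]
  let ?N = "generate G {n}"
  have nc: "n \<in> carrier G" using pelement_carrier n by blast
  have N: "psubgroup p ?N" "subgroup ?N G" using psubgroup_generate[OF p n(2)] by (auto simp: psubgroup_def)
  have sub: "subgroup (S <#> ?N) G"
  proof (rule set_mult_subgroup[OF sS N(2)])
    fix h k assume h: "h \<in> S" and k: "k \<in> ?N"
    have "?N \<subseteq> {g \<in> carrier G. normalizes g S}"
      by (rule generate_subgroup_incl[OF _ normalizer_subgroup[OF subgroup.subset[OF sS]]]) (use n(3) nc in simp)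
    then show "conjugate k h \<in> S" using h k by (auto simp: normalizes_def)
  qed
  have NR: "?N \<subseteq> R" by (rule generate_subgroup_incl[OF _ R]) (use n in simp)
  have in_R: "S <#> ?N \<subseteq> R" unfolding set_mult_def using NR sylow_inD(2)[OF S] R by (auto intro: subgroup.m_closed)
  obtain j where "card (S <#> ?N) = card S * p ^ j"
    using card_between_product[OF p sS N(1) sub set_mult_incl(1)[OF sS N(2)] order_refl sub] by blast
  then have "psubgroup p (S <#> ?N)" using sub S by (auto simp: psubgroup_def sylow_in_def power_add[symmetric])
  then have "S <#> ?N = S" using sylow_maximal[OF p R S _ set_mult_incl(1)[OF sS N(2)] in_R] by blast
  then show ?thesis using set_mult_incl(2)[OF sS N(2)] generate_singleton_mem[OF nc] by blast
qed

lemma psubgroup_inter: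
  assumes "prime p" "psubgroup p S" "subgroup B G" shows "psubgroup p (S \<inter> B)"
proof -
  have s: "subgroup (S \<inter> B) G" using assms by (intro subgroups_Inter_pair) (auto simp: psubgroup_def)
  then have "card (S \<inter> B) dvd card S" using subgroup_card_dvd[OF s] assms by (simp add: psubgroup_def)
  then show ?thesis using s assms divides_primepow_nat by (auto simp: psubgroup_def)
qed

text \<open>The number of fixed points of \<open>Q\<close> on \<open>S\<close> is positive, at most
  \<open>p\<close> and congruent to \<open>p\<close> modulo \<open>q\<close>; with
  \<open>p \<le> q\<close> it must be \<open>p\<close>. This count takes the place of the order
  \<open>p - 1\<close> of the automorphism group of \<open>S\<close>.\<close>

lemma psubgroup_centralizes:
  assumes p: "prime p" "prime q" "p \<le> q" and Q: "psubgroup q Q" and S: "subgroup S G" "card S = p"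
    and n: "\<And>g. g \<in> Q \<Longrightarrow> normalizes g S" and g: "g \<in> Q" "s \<in> S"
  shows "conjugate g s = s"
proof -
  let ?F = "{x\<in>S. \<forall>a\<in>Q. conjugate a x = x}"
  have sQ: "subgroup Q G" using Q by (simp add: psubgroup_def)
  obtain k where k: "card Q = q ^ k" using Q by (auto simp: psubgroup_def)
  have Qc: "\<And>x. x \<in> Q \<Longrightarrow> x \<in> carrier G" and Sc: "\<And>x. x \<in> S \<Longrightarrow> x \<in> carrier G" using sQ S subgroup_carrier by auto
  have cong: "[card S = card ?F] (mod q)"
  proof (rule card_fixed_points[where N="{\<one>}" and k=k])
    show "subgroup {\<one>} G" by (rule triv_subgroup)
    show "{\<one>} \<subseteq> Q" using sQ subgroup.one_closed by auto
    show "\<And>a x. a \<in> Q \<Longrightarrow> x \<in> S \<Longrightarrow> conjugate a x \<in> S" using n by (auto simp: normalizes_def)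
    show "\<And>a b x. a \<in> Q \<Longrightarrow> b \<in> Q \<Longrightarrow> x \<in> S \<Longrightarrow> conjugate (a \<otimes> b) x = conjugate a (conjugate b x)"
      using Qc Sc by (simp add: group_simps)
  qed (use p sQ k subgroup_finite[OF S(1)] Sc in auto)
  have "\<one> \<in> ?F" using Qc subgroup.one_closed[OF S(1)] by simp
  then have pos: "card ?F > 0" using subgroup_finite[OF S(1)] by (simp add: card_gt_0_iff) blast
  have le: "card ?F \<le> card S" by (rule card_mono[OF subgroup_finite[OF S(1)]]) blast
  have "card S \<le> card ?F"
  proof (cases "p = q")
    case True
    then have "q dvd card ?F" using S(2) cong by (simp add: cong_dvd_iff[symmetric])
    then show ?thesis using pos S(2) True by (simp add: dvd_imp_le)
  next
    case False
    then show ?thesis using cong le p(3) S(2) by (simp add: cong_def)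
  qed
  then have "?F = S" using card_seteq[OF subgroup_finite[OF S(1)], of ?F] by blast
  then show ?thesis using g by blast
qed

end

section \<open>Normal complements of large Sylow subgroups\<close>

context finite_group begin

text \<open>In general not a subgroup. Invariance under conjugation is automatic, so closure under
  products is all that a normal \<open>\<pi>\<close>-subgroup of this form requires.\<close>

definition pi_elements :: "(nat \<Rightarrow> bool) \<Rightarrow> 'a set" where
  "pi_elements \<pi> = {x \<in> carrier G. \<forall>q. prime q \<longrightarrow> q dvd ord x \<longrightarrow> \<pi> q}"

lemma pi_elements_carrier: "pi_elements \<pi> \<subseteq> carrier G"
  by (auto simp: pi_elements_def)

lemma pi_elements_Int: "pi_elements \<pi> \<inter> pi_elements \<rho> = pi_elements (\<lambda>q. \<pi> q \<and> \<rho> q)"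
  by (auto simp: pi_elements_def)

lemma pi_elements_mono: "(\<And>q. prime q \<Longrightarrow> \<pi> q \<Longrightarrow> \<rho> q) \<Longrightarrow> pi_elements \<pi> \<subseteq> pi_elements \<rho>"
  by (auto simp: pi_elements_def)

lemma ord_conj:
  assumes "g \<in> carrier G" "x \<in> carrier G" shows "ord (conjugate g x) = ord x"
proof -
  have "(conjugate g x) [^] n = \<one> \<longleftrightarrow> x [^] n = \<one>" for n :: nat
  proof -
    have "g \<otimes> x [^] n \<otimes> inv g = \<one> \<longleftrightarrow> x [^] n = \<one>"
    proof
      assume "g \<otimes> x [^] n \<otimes> inv g = \<one>"
      then have "inv g \<otimes> (g \<otimes> x [^] n \<otimes> inv g) \<otimes> g = \<one>" using assms by simp
      then show "x [^] n = \<one>" using assms by (simp add: m_assoc)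
    qed (use assms in simp)
    then show ?thesis using assms by (simp add: conj_pow)
  qed
  then have "ord (conjugate g x) dvd n \<longleftrightarrow> ord x dvd n" for n
    using assms pow_eq_id[of x n] pow_eq_id[of "conjugate g x" n] by simp
  then show ?thesis by (meson dvd_antisym dvd_refl)
qed

lemma pi_elements_normal: "g \<in> carrier G \<Longrightarrow> normalizes g (pi_elements \<pi>)"
  by (auto simp: normalizes_def pi_elements_def ord_conj)

lemma pelement_pi:
  assumes "prime q" "pelement q x" "\<pi> q" shows "x \<in> pi_elements \<pi>"
proof -
  obtain k where "ord x = q ^ k" using pelement_ord assms by blast
  then have "r = q" if "prime r" "r dvd ord x" for r using that assms(1) by (metis prime_dvd_power primes_dvd_imp_eq)
  then show ?thesis using assms pelement_carrier by (auto simp: pi_elements_def)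
qed

lemma pi_elements_subset:
  assumes K: "subgroup K G" and q: "\<And>q y. prime q \<Longrightarrow> \<pi> q \<Longrightarrow> pelement q y \<Longrightarrow> y \<in> K"
  shows "pi_elements \<pi> \<subseteq> K"
proof
  fix x assume x: "x \<in> pi_elements \<pi>"
  have xc: "x \<in> carrier G" using x by (simp add: pi_elements_def)
  let ?X = "generate G {x}"
  have X: "subgroup ?X G" using subgroup_generate xc by simp
  have "?X \<subseteq> K"
  proof (rule prime_power_generation[OF X])
    fix r y assume r: "prime r" "pelement r y" "y \<in> ?X"
    have yc: "y \<in> carrier G" using pelement_carrier[OF r(2)] .
    show "y \<in> K"
    proof (cases "y = \<one>")
      case True then show ?thesis using subgroup.one_closed[OF K] by simp
    next
      case False
      obtain k where k: "ord y = r ^ k" using pelement_ord r by blast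
      have "k \<noteq> 0" using False k ord_eq_1[OF yc] by (cases k) auto
      then have "r dvd ord y" using k by simp
      also have "ord y dvd ord x" using ord_subgroup_dvd[OF X r(3)] card_generate_singleton[OF xc] by simp
      finally have "\<pi> r" using x r(1) by (simp add: pi_elements_def)
      then show ?thesis using q r by blast
    qed
  qed (use K in \<open>auto intro: subgroup.m_closed\<close>)
  then show "x \<in> K" using generate_singleton_mem[OF xc] by blast
qed

lemma pi_elements_eq:
  assumes K: "subgroup K G" and q: "\<And>q y. prime q \<Longrightarrow> \<pi> q \<Longrightarrow> pelement q y \<Longrightarrow> y \<in> K"
    and c: "\<And>q. prime q \<Longrightarrow> q dvd card K \<Longrightarrow> \<pi> q"
  shows "pi_elements \<pi> = K"
proof
  show "K \<subseteq> pi_elements \<pi>"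
    using ord_subgroup_dvd[OF K] c subgroup_carrier[OF K] by (auto simp: pi_elements_def) (meson dvd_trans)
qed (rule pi_elements_subset[OF K q])

lemma pi_elements_card:
  assumes "subgroup (pi_elements \<pi>) G" "prime q" "q dvd card (pi_elements \<pi>)"
  shows "\<pi> q"
  using cauchy_element[OF assms(2,1,3)] assms(2) by (auto simp: pi_elements_def)

definition centralizer_set :: "'a set \<Rightarrow> 'a set" where
  "centralizer_set S = {c \<in> carrier G. \<forall>s\<in>S. conjugate c s = s}"

lemma centralizer_set_sym:
  assumes "S \<subseteq> carrier G" "T \<subseteq> carrier G" "S \<subseteq> centralizer_set T"
  shows "T \<subseteq> centralizer_set S"
proof -
  have "conjugate t x = x" if t: "t \<in> T" and x: "x \<in> S" for t x
  proof -
    have c: "t \<in> carrier G" "x \<in> carrier G" using t x assms by auto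
    have "t \<otimes> x = conjugate x t \<otimes> x" using t x assms(3) by (auto simp: centralizer_set_def)
    also have "\<dots> = x \<otimes> t" using c by (simp add: m_assoc)
    finally show ?thesis using c by (simp add: m_assoc)
  qed
  then show ?thesis using assms(2) by (auto simp: centralizer_set_def)
qed

lemma centralizer_set_subgroup:
  assumes "S \<subseteq> carrier G" shows "subgroup (centralizer_set S) G"
proof (rule subgroupI_finite)
  show "\<one> \<in> centralizer_set S" using assms by (auto simp: centralizer_set_def)
  fix a b assume ab: "a \<in> centralizer_set S" "b \<in> centralizer_set S"
  have "conjugate (a \<otimes> b) s = s" if s: "s \<in> S" for s
  proof -
    have "a \<in> carrier G" "b \<in> carrier G" "s \<in> carrier G" using ab s assms by (auto simp: centralizer_set_def)
    then have "conjugate (a \<otimes> b) s = conjugate a (b \<otimes> s \<otimes> inv b)"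
      by (simp add: group_simps)
    also have "\<dots> = s" using ab s by (simp add: centralizer_set_def)
    finally show ?thesis .
  qed
  then show "a \<otimes> b \<in> centralizer_set S" using ab by (auto simp: centralizer_set_def)
qed (auto simp: centralizer_set_def)

end

context hall_embedded_group begin

text \<open>For the hull \<open>B\<close> of \<open>A\<close>, maximality of the Sylow subgroup
  \<open>A\<close> gives \<open>S \<inter> B = A\<close>, and \<open>y\<close> normalizes both
  \<open>S\<close> and \<open>B\<close>.\<close>

lemma strongly_closed_normalized:
  assumes p: "prime p" "prime q" "q \<noteq> p" and S: "psubgroup p S" and A: "subgroup A G" "A \<subseteq> S" "A \<noteq> {\<one>}"
    and y: "pelement q y" "normalizes y S"
  shows "normalizes y A"
proof -
  have sS: "subgroup S G" using S by (simp add: psubgroup_def)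
  have A': "psubgroup p A" using psubgroup_inter[OF p(1) S A(1)] A(2) by (simp add: Int_absorb1)
  obtain B where B: "subgroup B G" "sylow_in p A B" "\<forall>q y. prime q \<longrightarrow> q \<noteq> p \<longrightarrow> pelement q y \<longrightarrow> normalizes y B"
    using strongly_closed_hull[OF p(1) A' A(3)] by blast
  have "S \<inter> B = A"
    by (rule sylow_maximal[OF p(1) B(1,2) psubgroup_inter[OF p(1) S B(1)]]) (use A(2) sylow_inD(2)[OF B(2)] in auto)
  moreover have "normalizes y B" using B(3) p y by blast
  ultimately show ?thesis using y(2) by (auto simp: normalizes_def)
qed

text \<open>Take \<open>z\<close> in \<open>P\<close> outside \<open>S\<close>. If the cyclic group
  of \<open>z\<close> meets \<open>S\<close> trivially, then \<open>comm s y\<close> lies in both by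
  \<open>commutator_in\<close>, hence is \<open>\<one>\<close>. Otherwise that cyclic group contains
  \<open>S\<close>; then \<open>comm z y\<close> is in \<open>S\<close>, so it commutes with
  \<open>z\<close> and has order dividing \<open>p\<close>. Therefore \<open>y\<close> centralizes
  \<open>z [^] p\<close>, of which every element of \<open>S\<close> is a power.\<close>

lemma commutes_with_minimal:
  assumes p: "prime p" "prime q" "q \<noteq> p" and P: "psubgroup p P" and S: "subgroup S G" "card S = p" "S \<subseteq> P" "S \<noteq> P"
    and y: "pelement q y" "normalizes y P" "normalizes y S" and s: "s \<in> S"
  shows "conjugate y s = s"
proof -
  have sP: "subgroup P G" using P by (simp add: psubgroup_def)
  have Pc: "\<And>x. x \<in> P \<Longrightarrow> x \<in> carrier G" using sP subgroup_carrier by auto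
  have yc: "y \<in> carrier G" using pelement_carrier[OF y(1)] .
  obtain z where z: "z \<in> P" "z \<notin> S" using S(3,4) by blast
  have zc: "z \<in> carrier G" and sc: "s \<in> carrier G" using z s S(3) Pc by auto
  have pS: "psubgroup p S" using S(1,2) by (auto simp: psubgroup_def intro: exI[of _ 1])
  have S1: "S \<noteq> {\<one>}" using card_one_iff[OF S(1)] S(2) p(1) not_prime_1 by auto
  let ?Z = "generate G {z}"
  have pz: "pelement p z" using psubgroup_pelement[OF P z(1)] .
  have Z: "psubgroup p ?Z" "subgroup ?Z G" using psubgroup_generate[OF p(1) pz] by (auto simp: psubgroup_def)
  have ZP: "?Z \<subseteq> P" by (rule generate_subgroup_incl[OF _ sP]) (use z in simp)
  have zZ: "z \<in> ?Z" using generate_singleton_mem[OF zc] .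
  have comm_in: "comm u y \<in> T" if "u \<in> T" "subgroup T G" "normalizes y T" for u T
  proof -
    have "conjugate y (inv u) \<in> T" using that by (simp add: normalizes_def subgroup.m_inv_closed)
    then have "u \<otimes> conjugate y (inv u) \<in> T" using that by (simp add: subgroup.m_closed)
    then show ?thesis using that yc subgroup_carrier by (simp add: m_assoc)
  qed
  have SZ: "subgroup (S \<inter> ?Z) G" using S(1) Z(2) by (rule subgroups_Inter_pair)
  have "card (S \<inter> ?Z) dvd p" using subgroup_card_dvd[OF SZ S(1)] S(2) by simp
  then have "card (S \<inter> ?Z) = 1 \<or> card (S \<inter> ?Z) = p" using p(1) prime_nat_iff by blast
  then show ?thesis
  proof
    assume "card (S \<inter> ?Z) = 1"
    then have tr: "S \<inter> ?Z = {\<one>}" using card_one_iff[OF SZ] by simp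
    have "?Z \<noteq> {\<one>}" using zZ z(2) subgroup.one_closed[OF S(1)] by auto
    then have "normalizes y ?Z" using strongly_closed_normalized[OF p P Z(2) ZP] y by blast
    then have "comm s y \<in> ?Z"
      using commutator_in[OF p Z(1) \<open>?Z \<noteq> {\<one>}\<close> y(1) _ P ZP] comm_in[OF _ sP y(2)] s S(3) by blast
    moreover have "comm s y \<in> S" using comm_in[OF s S(1) y(3)] .
    ultimately have "comm s y = \<one>" using tr by blast
    then have "s \<otimes> conjugate y (inv s) = \<one>" using sc yc by (simp add: m_assoc)
    then have "inv (conjugate y (inv s)) = s" using sc yc by (intro inv_equality) auto
    then show ?thesis using sc yc by (simp add: group_simps)
  next
    assume c: "card (S \<inter> ?Z) = p"
    then have "S \<inter> ?Z = S" using card_subset_eq[OF subgroup_finite[OF S(1)], of "S \<inter> ?Z"] S(2) by simp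
    then have SsZ: "S \<subseteq> ?Z" by blast
    define w where "w = comm z y"
    have w: "w \<in> S" unfolding w_def
      using commutator_in[OF p pS S1 y(1,3) P S(3) z(1)] comm_in[OF z(1) sP y(2)] by blast
    have wc: "w \<in> carrier G" using w S(3) Pc by blast
    obtain n where n: "w = z [^] (n::nat)" using w SsZ generate_singleton[OF zc] by auto
    have "inv w \<otimes> z = conjugate y z" unfolding w_def using zc yc by (simp add: group_simps)
    moreover have "(inv w \<otimes> z) [^] p = z [^] p"
    proof -
      have "w \<otimes> z = z \<otimes> w" unfolding n using zc nat_pow_Suc nat_pow_Suc2 by metis
      then have "inv w \<otimes> z = z \<otimes> inv w" using wc zc by (metis inv_closed inv_solve_left inv_solve_right m_assoc m_closed)
      then have "(inv w \<otimes> z) [^] p = inv w [^] p \<otimes> z [^] p" using pow_mult_distrib[of "inv w" z p] wc zc by simp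
      moreover have "inv w [^] p = \<one>"
        using pow_card_subgroup[OF S(1), of "inv w"] w S(1,2) by (simp add: subgroup.m_inv_closed)
      ultimately show ?thesis using zc by simp
    qed
    ultimately have yz: "y \<otimes> z [^] p \<otimes> inv y = z [^] p" using conj_pow[OF yc zc, of p] by simp
    obtain i where i: "s = z [^] (i::nat)" using s SsZ generate_singleton[OF zc] by auto
    \<comment> \<open>If \<open>p\<close> did not divide \<open>i\<close>, then \<open>z\<close>
      would be a power of \<open>s\<close> and lie in \<open>S\<close>.\<close>
    have "p dvd i"
    proof (rule ccontr)
      assume nd: "\<not> p dvd i"
      obtain k where k: "z [^] (p ^ k) = \<one>" using pz by (auto simp: pelement_def)
      have "coprime i (p ^ k)" using prime_imp_coprime[OF p(1) nd] by (simp add: coprime_commute)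
      moreover have "p ^ k \<noteq> 1"
      proof
        assume "p ^ k = 1"
        then have "z [^] (1::nat) = \<one>" using k by metis
        then have "z = \<one>" using zc by simp
        then show False using z(2) subgroup.one_closed[OF S(1)] by simp
      qed
      ultimately obtain u v where uv: "i * u = p ^ k * v + 1" using coprime_bezout_strong by blast
      have "s [^] u = z [^] (p ^ k * v + 1)" unfolding i using zc by (simp only: nat_pow_pow uv)
      also have "\<dots> = z" using k zc nat_pow_pow[OF zc, of "p ^ k" v] by simp
      finally have "z \<in> S" using subgroup_pow[OF S(1) s, of u] by simp
      then show False using z(2) by blast
    qed
    then obtain j where "i = p * j" by (elim dvdE)
    then have sj: "s = (z [^] p) [^] j" unfolding i using zc by (simp add: nat_pow_pow)
    show ?thesis unfolding sj using conj_pow[OF yc, of "z [^] p" j] yz zc by simp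
  qed
qed

text \<open>\<open>R\<close> is the group usually written O^p(G). If \<open>p\<close> divided its
  order, transfer in \<open>R\<close> would give a subgroup \<open>K\<close> that misses an element
  of \<open>R\<close> but contains all generators of \<open>R\<close>. So \<open>R\<close> is a
  \<open>p'\<close>-group and consists of all \<open>p'\<close>-elements.\<close>

lemma p_complement_of_large_sylow:
  assumes p: "prime p" and P0: "sylow_in p P0 (carrier G)" "card P0 \<noteq> p"
  shows "subgroup (pi_elements (\<lambda>q. q \<noteq> p)) G"
proof -
  let ?Y = "{y. \<exists>q. prime q \<and> q \<noteq> p \<and> pelement q y}"
  define R where "R = generate G ?Y"
  have Yc: "?Y \<subseteq> carrier G" using pelement_carrier by auto
  have R: "subgroup R G" unfolding R_def using subgroup_generate[OF Yc] .
  have Rn: "normalizes g R" if "g \<in> carrier G" for g unfolding R_def using generate_pelements_normal[OF that] .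
  have Rc: "\<And>x. x \<in> R \<Longrightarrow> x \<in> carrier G" using R subgroup_carrier by auto
  have YR: "y \<in> R" if "prime q" "q \<noteq> p" "pelement q y" for q y unfolding R_def using that by (auto intro: generate.incl)
  have "\<not> p dvd card R"
  proof
    assume pd: "p dvd card R"
    obtain S where S: "sylow_in p S R" using sylow_exists[OF p R] by blast
    note sS = sylow_inD(1)[OF S] and SR = sylow_inD(2)[OF S] and pS = sylow_inD(3)[OF S]
    obtain P where P: "sylow_in p P (carrier G)" "S \<subseteq> P"
      using psubgroup_in_sylow[OF p subgroup_self pS subgroup.subset[OF sS]] by blast
    note sP = sylow_inD(1)[OF P(1)] and pP = sylow_inD(3)[OF P(1)]
    have PR: "P \<inter> R = S" by (rule sylow_maximal[OF p R S psubgroup_inter[OF p pP R]]) (use P SR in auto)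
    have nPS: "normalizes g S" if "g \<in> P" for g
      using that Rn normalizes_self[OF sP that] PR subgroup_carrier[OF sP that] unfolding normalizes_def by blast
    obtain s where s: "card S = p ^ Suc s"
    proof -
      have "1 \<le> multiplicity p (card R)" using pd p subgroup_card_pos[OF R] not_prime_unit
        by (intro multiplicity_geI) auto
      then show thesis using S that[of "multiplicity p (card R) - 1"] by (simp add: sylow_in_def)
    qed
    obtain A where A: "subgroup A G" "A \<subseteq> S" "card A = p ^ s"
      using cauchy_subgroup[OF p sS, of s] s by auto
    have "card A < card S" using A s prime_gt_1_nat[OF p] by simp
    then obtain x where x: "x \<in> S" "x \<notin> A" using A(2) by (metis less_irrefl subsetI subset_antisym)
    have pA: "psubgroup p A" using A by (auto simp: psubgroup_def)
    have cSA: "card S = p * card A" using s A by simp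
    \<comment> \<open>Needed is a normal subgroup of \<open>R\<close> with Sylow subgroup
      \<open>A\<close>, modulo which the normalizer of \<open>S\<close> in \<open>R\<close>
      centralizes \<open>S\<close>: the hull of \<open>A\<close> cut down to \<open>R\<close> if
      \<open>A\<close> is not trivial, and the trivial group otherwise.\<close>
    have "\<exists>B. subgroup B G \<and> B \<subseteq> R \<and> (\<forall>g\<in>R. normalizes g B) \<and> sylow_in p A B \<and>
      (\<forall>n\<in>R. normalizes n S \<longrightarrow> (\<forall>s\<in>S. comm n s \<in> B))"
    proof (cases "A = {\<one>}")
      case False
      obtain B0 where B0: "subgroup B0 G" "sylow_in p A B0" "\<forall>q y. prime q \<longrightarrow> q \<noteq> p \<longrightarrow> pelement q y \<longrightarrow> normalizes y B0"
        using strongly_closed_hull[OF p pA False] by blast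
      define B where "B = B0 \<inter> R"
      have B: "subgroup B G" unfolding B_def using B0(1) R by (rule subgroups_Inter_pair)
      have "R \<subseteq> {g \<in> carrier G. normalizes g B0}" unfolding R_def
        by (rule generate_subgroup_incl[OF _ normalizer_subgroup[OF subgroup.subset[OF B0(1)]]])
          (use B0(3) pelement_carrier in blast)
      then have nB: "normalizes g B" if "g \<in> R" for g using that Rn[OF Rc[OF that]] unfolding B_def normalizes_def by blast
      have AB: "sylow_in p A B"
        by (rule sylow_in_between[OF p B0(1,2) B]) (use A SR sylow_inD(2)[OF B0(2)] in \<open>auto simp: B_def\<close>)
      have SB: "S \<inter> B = A"
        by (rule sylow_maximal[OF p B AB psubgroup_inter[OF p pS B]]) (use A sylow_inD(2)[OF AB] in auto)
      have nSA: "normalizes g A" if "g \<in> R" "normalizes g S" for g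
        using that nB[OF that(1)] SB unfolding normalizes_def by blast
      let ?N = "{g \<in> carrier G. normalizes g S} \<inter> R"
      let ?K = "{n \<in> R. \<forall>s\<in>S. comm n s \<in> B}"
      have N: "subgroup ?N G" using normalizer_subgroup[OF subgroup.subset[OF sS]] R by (rule subgroups_Inter_pair)
      \<comment> \<open>A \<open>p\<close>-element of \<open>?N\<close> lies in \<open>S\<close>,
        and \<open>S/A\<close> is abelian; for the other primes \<open>commutator_in\<close>
        applies.\<close>
      have "?N \<subseteq> ?K"
      proof (rule prime_power_generation[OF N])
        fix q n assume q: "prime q" "pelement q n" and n: "n \<in> ?N"
        have nR: "n \<in> R" "n \<in> carrier G" "normalizes n S" using n by auto
        have "comm n s \<in> B" if s: "s \<in> S" for s
        proof (cases "q = p")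
          case True
          then have "n \<in> S" using sylow_contains_normalizing[OF p R S nR(1) _ nR(3)] q by simp
          then have "comm n s \<in> A"
            using index_prime_commutators[OF p sS A(1,2) _ cSA _ s] nSA SR normalizes_self[OF sS] by blast
          then show ?thesis using SB by blast
        next
          case False
          have sc: "s \<in> carrier G" using s sS subgroup_carrier by blast
          have "conjugate n (inv s) \<in> S" using nR(3) s sS by (simp add: normalizes_def subgroup.m_inv_closed)
          then have "s \<otimes> conjugate n (inv s) \<in> S" using s sS by (simp add: subgroup.m_closed)
          then have "comm s n \<in> S" using sc nR(2) by (simp add: m_assoc)
          then have "comm s n \<in> A"
            using commutator_in[OF p q(1) False pA \<open>A \<noteq> {\<one>}\<close> q(2) nSA[OF nR(1,3)] pS A(2) s] by blast
          then have "inv (comm s n) \<in> A" using A(1) by (simp add: subgroup.m_inv_closed)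
          moreover have "inv (comm s n) = comm n s" using sc nR(2) by (simp add: group_simps)
          ultimately show ?thesis using SB by auto
        qed
        then show "n \<in> ?K" using nR by blast
      next
        fix m n assume mn: "m \<in> ?K" "n \<in> ?K" "m \<in> ?N" "n \<in> ?N"
        have "comm (m \<otimes> n) s \<in> B" if s: "s \<in> S" for s
        proof -
          have sc: "s \<in> carrier G" using s sS subgroup_carrier by blast
          have "conjugate m (n \<otimes> s \<otimes> inv n \<otimes> inv s) \<in> B" using nB[of m] mn s by (simp add: normalizes_def)
          moreover have "comm m s \<in> B" using mn s by simp
          ultimately have "conjugate m (n \<otimes> s \<otimes> inv n \<otimes> inv s) \<otimes> comm m s \<in> B"
            by (rule subgroup.m_closed[OF B])
          moreover have "conjugate m (n \<otimes> s \<otimes> inv n \<otimes> inv s) \<otimes> comm m s = comm (m \<otimes> n) s"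
            using mn sc by (simp add: group_simps)
          ultimately show ?thesis by simp
        qed
        moreover have "m \<otimes> n \<in> R" using mn R by (auto intro: subgroup.m_closed)
        ultimately show "m \<otimes> n \<in> ?K" by blast
      qed
      then have "\<forall>n\<in>R. normalizes n S \<longrightarrow> (\<forall>s\<in>S. comm n s \<in> B)" using Rc by blast
      then show ?thesis using B nB AB B_def by blast
    next
      case True
      \<comment> \<open>\<open>S\<close> has order \<open>p\<close> and the Frattini argument gives \<open>N(S) = C(S) (N(S) \<inter> N(P))\<close>.\<close>
      have cS: "card S = p" using cSA True by simp
      \<comment> \<open>Here the exclusion of order \<open>p\<close> enters:
        \<open>commutes_with_minimal\<close> needs an element of \<open>P\<close> outside
        \<open>S\<close>.\<close>
      have SP: "S \<noteq> P" using cS P0 P(1) by (auto simp: sylow_in_def)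
      have Sc: "S \<subseteq> carrier G" using subgroup.subset[OF sS] .
      define C where "C = centralizer_set S"
      have C: "subgroup C G" unfolding C_def using centralizer_set_subgroup[OF Sc] .
      have PC: "P \<subseteq> C"
        using psubgroup_centralizes[OF p p order_refl pP sS cS nPS] subgroup_carrier[OF sP] by (auto simp: C_def centralizer_set_def)
      have sPC: "sylow_in p P C" by (rule sylow_in_between[OF p subgroup_self P(1) C PC subgroup.subset[OF C]])
      have "comm n s \<in> {\<one>}" if n: "n \<in> R" "normalizes n S" and s: "s \<in> S" for n s
      proof -
        have nc: "n \<in> carrier G" and sc: "s \<in> carrier G" using n Rc s Sc by auto
        have "normalizes n C"
        proof -
          have "conjugate n c \<in> C" if c: "c \<in> C" for c
          proof -
            have cc: "c \<in> carrier G" using c C subgroup_carrier by blast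
            have "conjugate (n \<otimes> c \<otimes> inv n) t = t" if t: "t \<in> S" for t
            proof -
              have tc: "t \<in> carrier G" using t Sc by blast
              have "inv n \<otimes> t \<otimes> n \<in> S" using normalizes_inv[OF n(2) Sc] t nc by (simp add: normalizes_def)
              then have "conjugate c (inv n \<otimes> t \<otimes> n) = inv n \<otimes> t \<otimes> n" using c by (simp add: C_def centralizer_set_def)
              moreover have "conjugate (n \<otimes> c \<otimes> inv n) t = n \<otimes> conjugate c (inv n \<otimes> t \<otimes> n) \<otimes> inv n"
                using nc cc tc by (simp add: group_simps)
              ultimately show ?thesis using nc tc by (simp add: group_simps)
            qed
            then show ?thesis using nc cc by (simp add: C_def centralizer_set_def)
          qed
          then show ?thesis using nc by (simp add: normalizes_def)
        qed
        then obtain c where c: "c \<in> C" "normalizes (inv c \<otimes> n) P" using frattini[OF p C sPC] by blast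
        have cc: "c \<in> carrier G" using c(1) C subgroup_carrier by blast
        have cS': "normalizes c S" using c(1) by (auto simp: C_def centralizer_set_def normalizes_def)
        have mS: "normalizes (inv c \<otimes> n) S" using normalizes_mult[OF normalizes_inv[OF cS' Sc] n(2) Sc] .
        \<comment> \<open>The \<open>p\<close>-elements of \<open>?M\<close> lie in
          \<open>P\<close>, which centralizes \<open>S\<close>; its \<open>q\<close>-elements for
          other primes centralize \<open>S\<close> by \<open>commutes_with_minimal\<close>.\<close>
        let ?M = "{g \<in> carrier G. normalizes g P} \<inter> {g \<in> carrier G. normalizes g S}"
        have M: "subgroup ?M G"
          using normalizer_subgroup[OF subgroup.subset[OF sP]] normalizer_subgroup[OF Sc] by (rule subgroups_Inter_pair)
        have "?M \<subseteq> C"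
        proof (rule prime_power_generation[OF M])
          fix q m assume q: "prime q" "pelement q m" and m: "m \<in> ?M"
          show "m \<in> C"
          proof (cases "q = p")
            case True
            then show ?thesis using sylow_contains_normalizing[OF p subgroup_self P(1), of m] q m PC by blast
          next
            case False
            then have "conjugate m s = s" if "s \<in> S" for s
              using commutes_with_minimal[OF p q(1) False pP sS cS P(2) SP q(2) _ _ that] m by blast
            then show ?thesis using m by (simp add: C_def centralizer_set_def)
          qed
        qed (simp add: subgroup.m_closed[OF C])
        moreover have "inv c \<otimes> n \<in> ?M" using c(2) mS cc nc by simp
        ultimately have "inv c \<otimes> n \<in> C" by (rule subsetD)
        then have "c \<otimes> (inv c \<otimes> n) \<in> C" using c(1) C by (simp add: subgroup.m_closed)
        then have "n \<in> C" using cc nc by simp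
        then show ?thesis using s sc by (simp add: C_def centralizer_set_def)
      qed
      then have "\<forall>n\<in>R. normalizes n S \<longrightarrow> (\<forall>s\<in>S. comm n s \<in> {\<one>})" by blast
      moreover have "sylow_in p A {\<one>}" using True triv_subgroup by (simp add: sylow_in_def)
      moreover have "\<forall>g\<in>R. normalizes g {\<one>}" using Rc by (simp add: normalizes_def)
      ultimately show ?thesis using triv_subgroup subgroup.one_closed[OF R] by blast
    qed
    then obtain B where B: "subgroup B G" "B \<subseteq> R" "\<And>g. g \<in> R \<Longrightarrow> normalizes g B" "sylow_in p A B"
      "\<And>n s. n \<in> R \<Longrightarrow> normalizes n S \<Longrightarrow> s \<in> S \<Longrightarrow> comm n s \<in> B" by blast
    obtain K where K: "subgroup K G" "x \<notin> K" "\<forall>q y. prime q \<longrightarrow> q \<noteq> p \<longrightarrow> pelement q y \<longrightarrow> y \<in> R \<longrightarrow> y \<in> K"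
      using burnside_transfer[OF p R S B(1-3) B(4) A(2) cSA x B(5)] by blast
    have "R \<subseteq> K" unfolding R_def by (rule generate_subgroup_incl[OF _ K(1)]) (use K(3) YR in blast)
    then show False using K(2) x SR by blast
  qed
  then have "pi_elements (\<lambda>q. q \<noteq> p) = R" using pi_elements_eq[OF R, of "\<lambda>q. q \<noteq> p"] YR by blast
  then show ?thesis using R by simp
qed

end

section \<open>The lower central series and the nilpotent residual\<close>

context finite_group begin

definition normal_sub :: "'a set \<Rightarrow> bool" where
  "normal_sub N \<longleftrightarrow> subgroup N G \<and> (\<forall>g\<in>carrier G. normalizes g N)"

lemma normal_subD:
  assumes "normal_sub N"
  shows "subgroup N G" "g \<in> carrier G \<Longrightarrow> normalizes g N" "g \<in> carrier G \<Longrightarrow> x \<in> N \<Longrightarrow> conjugate g x \<in> N"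
  using assms by (auto simp: normal_sub_def normalizes_def)

lemma normal_sub_iff: "normal_sub N \<longleftrightarrow> N \<lhd> G"
proof
  assume "normal_sub N" then show "N \<lhd> G" using normal_subD by (intro normal_invI) auto
next
  assume N: "N \<lhd> G"
  then show "normal_sub N" using normal_imp_subgroup[OF N] normal_invE(2)[OF N] by (auto simp: normal_sub_def normalizes_def)
qed

lemma normal_sub_carrier: "normal_sub (carrier G)"
  by (simp add: normal_sub_def normalizes_def subgroup_self)

lemma commutator_subset:
  assumes "subgroup T G" "\<And>h k. h \<in> H \<Longrightarrow> k \<in> K \<Longrightarrow> comm h k \<in> T"
  shows "commutator G H K \<subseteq> T"
  unfolding commutator_def by (rule generate_subgroup_incl[OF _ assms(1)]) (use assms(2) in auto)

lemma commutator_normal: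
  assumes H: "normal_sub H" shows "normal_sub (commutator G H (carrier G))" "commutator G H (carrier G) \<subseteq> H"
proof -
  let ?S = "{comm h k | h k. h \<in> H \<and> k \<in> carrier G}"
  have Hc: "\<And>h. h \<in> H \<Longrightarrow> h \<in> carrier G" using normal_subD(1)[OF H] subgroup_carrier by blast
  have S: "?S \<subseteq> carrier G" using Hc by auto
  have "normalizes g (generate G ?S)" if g: "g \<in> carrier G" for g
  proof (rule normalizes_generate[OF g S])
    fix s assume "s \<in> ?S"
    then obtain h k where hk: "h \<in> H" "k \<in> carrier G" "s = comm h k" by blast
    have hc: "h \<in> carrier G" using Hc hk by blast
    have "conjugate g s = conjugate (g \<otimes> h \<otimes> inv g) (g \<otimes> k \<otimes> inv g) \<otimes> inv (conjugate g k)"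
      unfolding hk(3) using g hc hk(2) by (simp add: group_simps)
    moreover have "conjugate g h \<in> H" "conjugate g k \<in> carrier G" using normal_subD(3)[OF H g hk(1)] g hk(2) by auto
    ultimately have "conjugate g s \<in> ?S" by blast
    then show "conjugate g s \<in> generate G ?S" by (rule generate.incl)
  qed
  then show "normal_sub (commutator G H (carrier G))"
    unfolding commutator_def normal_sub_def using subgroup_generate[OF S] by blast
  show "commutator G H (carrier G) \<subseteq> H"
  proof (rule commutator_subset[OF normal_subD(1)[OF H]])
    fix h k assume hk: "h \<in> H" "k \<in> carrier G"
    have "conjugate k (inv h) \<in> H" using normal_subD[OF H] hk by (simp add: subgroup.m_inv_closed)
    then have "h \<otimes> conjugate k (inv h) \<in> H" using normal_subD(1)[OF H] hk by (simp add: subgroup.m_closed)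
    then show "comm h k \<in> H" using hk Hc by (simp add: m_assoc)
  qed
qed

lemma lower_central_normal: "normal_sub (lower_central G n)"
  by (induction n) (auto simp: normal_sub_carrier commutator_normal)

lemma lower_central_antimono: "m \<le> n \<Longrightarrow> lower_central G n \<subseteq> lower_central G m"
  by (induction rule: dec_induct) (use commutator_normal(2)[OF lower_central_normal] in auto)

lemma lower_central_stable: "\<exists>n. lower_central G (Suc n) = lower_central G n"
proof (rule ccontr)
  assume c: "\<nexists>n. lower_central G (Suc n) = lower_central G n"
  have "card (lower_central G n) + n \<le> card (carrier G)" for n
  proof (induction n)
    case (Suc n)
    have "lower_central G (Suc n) \<noteq> lower_central G n" using c by blast
    then have "lower_central G (Suc n) \<subset> lower_central G n"
      by (intro psubsetI lower_central_antimono) simp_all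
    then have "card (lower_central G (Suc n)) < card (lower_central G n)"
      using psubset_card_mono subgroup_finite[OF normal_subD(1)[OF lower_central_normal]] by blast
    then show ?case using Suc by simp
  qed simp
  from this[of "Suc (card (carrier G))"] show False by simp
qed

lemma lower_central_FactGroup:
  assumes N: "N \<lhd> G"
  shows "lower_central (G Mod N) n = (\<lambda>x. N #> x) ` lower_central G n"
proof (induction n)
  case 0
  show ?case by (simp add: carrier_FactGroup)
next
  case (Suc n)
  interpret N: normal N G by (rule N)
  interpret Q: group "G Mod N" by (rule N.factorgroup_is_group)
  interpret \<phi>: group_hom G "G Mod N" "\<lambda>x. N #> x" by unfold_locales (rule N.r_coset_hom_Mod)
  let ?H = "lower_central G n"
  have Hc: "\<And>h. h \<in> ?H \<Longrightarrow> h \<in> carrier G" using normal_subD(1)[OF lower_central_normal] subgroup_carrier by blast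
  let ?S = "{comm h k | h k. h \<in> ?H \<and> k \<in> carrier G}"
  have S: "?S \<subseteq> carrier G" using Hc by auto
  have eq: "N #> (comm h k) = (N #> h) \<otimes>\<^bsub>G Mod N\<^esub> (N #> k) \<otimes>\<^bsub>G Mod N\<^esub> inv\<^bsub>G Mod N\<^esub> (N #> h) \<otimes>\<^bsub>G Mod N\<^esub> inv\<^bsub>G Mod N\<^esub> (N #> k)"
    if "h \<in> ?H" "k \<in> carrier G" for h k
    using that Hc[OF that(1)] \<phi>.hom_mult \<phi>.hom_inv by (simp del: mult_FactGroup)
  have "{h \<otimes>\<^bsub>G Mod N\<^esub> k \<otimes>\<^bsub>G Mod N\<^esub> inv\<^bsub>G Mod N\<^esub> h \<otimes>\<^bsub>G Mod N\<^esub> inv\<^bsub>G Mod N\<^esub> k |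
      h k. h \<in> (\<lambda>x. N #> x) ` ?H \<and> k \<in> carrier (G Mod N)} = (\<lambda>x. N #> x) ` ?S" (is "?L = ?R")
  proof
    show "?L \<subseteq> ?R"
    proof
      fix z assume "z \<in> ?L"
      then obtain h k where hk: "h \<in> ?H" "k \<in> carrier G" "z = (N #> h) \<otimes>\<^bsub>G Mod N\<^esub> (N #> k) \<otimes>\<^bsub>G Mod N\<^esub> inv\<^bsub>G Mod N\<^esub> (N #> h) \<otimes>\<^bsub>G Mod N\<^esub> inv\<^bsub>G Mod N\<^esub> (N #> k)"
        unfolding carrier_FactGroup by blast
      then have "z = N #> (comm h k)" using eq by simp
      then show "z \<in> ?R" using hk by blast
    qed
    show "?R \<subseteq> ?L"
    proof
      fix z assume "z \<in> ?R"
      then obtain h k where hk: "h \<in> ?H" "k \<in> carrier G" "z = N #> (comm h k)" by blast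
      moreover have "N #> k \<in> carrier (G Mod N)" using hk(2) by (simp add: carrier_FactGroup)
      ultimately show "z \<in> ?L" using eq by blast
    qed
  qed
  then have "commutator (G Mod N) ((\<lambda>x. N #> x) ` ?H) (carrier (G Mod N)) = (\<lambda>x. N #> x) ` commutator G ?H (carrier G)"
    unfolding commutator_def using \<phi>.generate_img[OF S] by simp
  then show ?case using Suc by simp
qed

lemma nilpotent_FactGroup_iff:
  assumes N: "N \<lhd> G"
  shows "nilpotent_group (G Mod N) \<longleftrightarrow> (\<exists>n. lower_central G n \<subseteq> N)"
proof -
  interpret N: normal N G by (rule N)
  have "(\<lambda>x. N #> x) ` lower_central G n = {N} \<longleftrightarrow> lower_central G n \<subseteq> N" for n
  proof -
    note L = normal_subD(1)[OF lower_central_normal, of n]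
    have c: "N #> x = N \<longleftrightarrow> x \<in> N" if "x \<in> lower_central G n" for x
      using coset_join1[OF _ _ N.subgroup_axioms, of x] coset_join2[OF _ N.subgroup_axioms, of x] subgroup_carrier[OF L that] N.subset by auto
    have "\<one> \<in> lower_central G n" using subgroup.one_closed[OF L] .
    then show ?thesis using c by (auto simp: image_def)
  qed
  then show ?thesis by (simp add: nilpotent_group_def N.factorgroup_is_group lower_central_FactGroup[OF N])
qed

text \<open>A quotient is nilpotent exactly when its kernel contains some term of the lower central
  series, so the residual is the term at which the series becomes stationary. Stationarity is what
  the structure lemmas for the residual exploit.\<close>

lemma nilpotent_residual_eq:
  "\<exists>n. nilpotent_residual G = lower_central G n \<and> commutator G (lower_central G n) (carrier G) = lower_central G n"
proof -
  obtain n where n: "lower_central G (Suc n) = lower_central G n" using lower_central_stable by blast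
  let ?D = "lower_central G n"
  have ge: "lower_central G (n + k) = ?D" for k by (induction k) (use n in auto)
  have le: "?D \<subseteq> lower_central G k" for k
  proof (cases "k \<le> n")
    case False then show ?thesis using ge[of "k - n"] by simp
  qed (rule lower_central_antimono)
  have "?D \<lhd> G" using lower_central_normal normal_sub_iff by blast
  moreover from this have "nilpotent_group (G Mod ?D)" using nilpotent_FactGroup_iff by blast
  ultimately have "nilpotent_residual G \<subseteq> ?D" unfolding nilpotent_residual_def by blast
  moreover have "?D \<subseteq> N" if "N \<lhd> G" "nilpotent_group (G Mod N)" for N
    using nilpotent_FactGroup_iff[OF that(1)] that(2) le by blast
  then have "?D \<subseteq> nilpotent_residual G" unfolding nilpotent_residual_def by blast
  ultimately show ?thesis using n by auto
qed

lemma normal_sub_inter: "normal_sub M \<Longrightarrow> normal_sub N \<Longrightarrow> normal_sub (M \<inter> N)"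
  unfolding normal_sub_def by (auto intro: subgroups_Inter_pair simp: normalizes_def)

text \<open>Dual to the nontriviality of the centre of a \<open>p\<close>-group: the fixed cosets of a maximal
  \<open>G\<close>-invariant subgroup \<open>M\<close> of \<open>D\<close> form a strictly larger invariant subgroup.\<close>

lemma residual_in_p_complement:
  assumes p: "prime p" and N: "normal_sub N" "card (carrier G) = card N * p ^ k"
    and D: "normal_sub D" "D \<subseteq> commutator G D (carrier G)"
  shows "D \<subseteq> N"
proof (rule ccontr)
  assume nD: "\<not> D \<subseteq> N"
  note sN = normal_subD(1)[OF N(1)] and sD = normal_subD(1)[OF D(1)]
  have DN: "normal_sub (D \<inter> N)" using normal_sub_inter D N by blast
  \<comment> \<open>Containing \<open>D \<inter> N\<close> makes \<open>N\<close> act trivially on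
    the cosets of \<open>M\<close> in \<open>D\<close>, so that \<open>G\<close> acts on them
    through a \<open>p\<close>-group.\<close>
  define \<M> where "\<M> = {M. normal_sub M \<and> D \<inter> N \<subseteq> M \<and> M \<subset> D}"
  have "finite \<M>" unfolding \<M>_def by (rule finite_subset[of _ "Pow (carrier G)"]) (use fin subgroup.subset[OF sD] in auto)
  moreover have "\<M> \<noteq> {}" using DN nD by (auto simp: \<M>_def)
  ultimately obtain M where M: "M \<in> \<M>" "\<And>W. W \<in> \<M> \<Longrightarrow> M \<subseteq> W \<Longrightarrow> M = W" using finite_has_maximal by metis
  have nM: "normal_sub M" and DNM: "D \<inter> N \<subseteq> M" and MD: "M \<subset> D" using M by (auto simp: \<M>_def)
  note sM = normal_subD(1)[OF nM]
  have Dc: "\<And>x. x \<in> D \<Longrightarrow> x \<in> carrier G" and Nc: "\<And>x. x \<in> N \<Longrightarrow> x \<in> carrier G"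
    and Mc: "\<And>x. x \<in> M \<Longrightarrow> x \<in> carrier G" using sD sN sM subgroup_carrier by auto
  define X where "X = (\<lambda>d. l_coset G d M) ` D"
  define act where "act g C = (\<lambda>c. conjugate g c) ` C" for g C
  have act: "act g (l_coset G d M) = l_coset G (conjugate g d) M" if g: "g \<in> carrier G" and d: "d \<in> D" for g d
  proof
    have dc: "d \<in> carrier G" using d Dc by blast
    show "act g (l_coset G d M) \<subseteq> l_coset G (conjugate g d) M"
    proof
      fix z assume "z \<in> act g (l_coset G d M)"
      then obtain m where m: "m \<in> M" "z = conjugate g (d \<otimes> m)" by (auto simp: act_def l_coset_def)
      then have "z = conjugate g d \<otimes> conjugate g m" using g dc Mc by (simp add: group_simps)
      then show "z \<in> l_coset G (conjugate g d) M" using normal_subD(3)[OF nM g m(1)] by (auto simp: l_coset_def)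
    qed
    show "l_coset G (conjugate g d) M \<subseteq> act g (l_coset G d M)"
    proof
      fix z assume "z \<in> l_coset G (conjugate g d) M"
      then obtain m where m: "m \<in> M" "z = conjugate g d \<otimes> m" by (auto simp: l_coset_def)
      have "inv g \<otimes> m \<otimes> g \<in> M" using normal_subD(3)[OF nM, of "inv g" m] g m by simp
      moreover have "z = g \<otimes> (d \<otimes> (inv g \<otimes> m \<otimes> g)) \<otimes> inv g" using g dc m Mc by (simp add: group_simps)
      ultimately show "z \<in> act g (l_coset G d M)" unfolding act_def l_coset_def by blast
    qed
  qed
  let ?F = "{C\<in>X. \<forall>g\<in>carrier G. act g C = C}"
  have "[card X = card ?F] (mod p)"
  proof (rule card_fixed_points[where N=N and k=k])
    show "finite X" unfolding X_def using subgroup_finite[OF sD] by blast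
    show "\<And>a x. a \<in> carrier G \<Longrightarrow> x \<in> X \<Longrightarrow> act a x \<in> X"
      unfolding X_def using act normal_subD(3)[OF D(1)] by auto
    show "\<And>x. x \<in> X \<Longrightarrow> act \<one> x = x" unfolding X_def using act Dc by auto
    show "\<And>a b x. a \<in> carrier G \<Longrightarrow> b \<in> carrier G \<Longrightarrow> x \<in> X \<Longrightarrow> act (a \<otimes> b) x = act a (act b x)"
      unfolding X_def using act normal_subD(3)[OF D(1)] Dc by (auto simp: group_simps)
    fix n C assume n: "n \<in> N" and "C \<in> X"
    then obtain d where d: "d \<in> D" "C = l_coset G d M" by (auto simp: X_def)
    have nc: "n \<in> carrier G" and dc: "d \<in> carrier G" using n d Nc Dc by auto
    have "inv d \<otimes> conjugate n d \<in> D"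
      using normal_subD(3)[OF D(1) nc d(1)] sD d(1) by (simp add: subgroup.m_closed subgroup.m_inv_closed)
    moreover have "inv d \<otimes> conjugate n d \<in> N"
    proof -
      have "inv d \<otimes> n \<otimes> d \<in> N" using normal_subD(3)[OF N(1), of "inv d" n] dc n by simp
      then have "(inv d \<otimes> n \<otimes> d) \<otimes> inv n \<in> N" using n sN by (simp add: subgroup.m_closed subgroup.m_inv_closed)
      then show ?thesis using nc dc by (simp add: m_assoc)
    qed
    ultimately have "inv d \<otimes> conjugate n d \<in> M" using DNM by blast
    then show "act n C = C" unfolding d(2) act[OF nc d(1)] using lcoset_eq[OF sM dc] nc dc by simp
  qed (use p N sN subgroup_self subgroup.subset[OF sN] in auto)
  moreover have "p dvd card X"
  proof -
    have XM: "card X * card M = card D" unfolding X_def using card_lcosets[OF sM sD] MD by blast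
    have sDN: "subgroup (D <#> N) G"
      by (rule set_mult_subgroup[OF sD sN]) (use normal_subD(3)[OF D(1)] Nc in blast)
    obtain i where i: "card (D <#> N) = card N * i" using subgroup_card_dvd[OF sN sDN set_mult_incl(2)[OF sD sN]] by (auto elim: dvdE)
    obtain i' where i': "card (carrier G) = card (D <#> N) * i'" using subgroup_card_dvd[OF sDN subgroup_self subgroup.subset[OF sDN]] by (auto elim: dvdE)
    have "i * i' = p ^ k" using i i' N(2) subgroup_card_pos[OF sN] by simp
    then have "i dvd p ^ k" by (metis dvd_triv_left)
    then obtain j where j: "i = p ^ j" using divides_primepow_nat[OF p] by blast
    have "card N * (i * card (D \<inter> N)) = card N * card D" using card_set_mult[OF sD sN] i by (simp add: mult.assoc mult.commute)
    then have cD: "card D = p ^ j * card (D \<inter> N)" using subgroup_card_pos[OF sN] j by simp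
    obtain l where l: "card M = card (D \<inter> N) * l" using subgroup_card_dvd[OF normal_subD(1)[OF DN] sM DNM] by (auto elim: dvdE)
    have "card X * l = p ^ j" using XM l cD subgroup_card_pos[OF normal_subD(1)[OF DN]] by simp
    then have "card X dvd p ^ j" by (metis dvd_triv_left)
    then obtain t where t: "card X = p ^ t" using divides_primepow_nat[OF p] by blast
    have "card M < card D" using MD psubset_card_mono[OF subgroup_finite[OF sD]] by blast
    then have "card X \<noteq> 1" using XM by auto
    then show ?thesis using t by (cases t) auto
  qed
  ultimately have pF: "p dvd card ?F" by (simp add: cong_dvd_iff)
  have "\<exists>C\<in>?F. C \<noteq> M"
  proof (rule ccontr)
    assume "\<not> (\<exists>C\<in>?F. C \<noteq> M)"
    then have "?F \<subseteq> {M}" by blast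
    moreover have "M \<in> ?F"
    proof -
      have "l_coset G \<one> M = M" using lcos_mult_one[OF subgroup.subset[OF sM]] .
      moreover have "\<one> \<in> D" using subgroup.one_closed[OF sD] .
      ultimately show ?thesis unfolding X_def using act[of _ \<one>] by auto
    qed
    ultimately have "?F = {M}" by blast
    then have "card ?F = 1" by simp
    then show False using pF p not_prime_unit by metis
  qed
  then obtain d where d: "d \<in> D" "l_coset G d M \<noteq> M" "\<And>g. g \<in> carrier G \<Longrightarrow> act g (l_coset G d M) = l_coset G d M"
    unfolding X_def by blast
  \<comment> \<open>\<open>W/M\<close> is the group of fixed points of \<open>G\<close> on
    \<open>D/M\<close>. It is not trivial, so maximality gives \<open>W = D\<close>, and then the
    commutators of \<open>D\<close> with \<open>G\<close> all lie in \<open>M\<close>.\<close>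
  define W where "W = {w \<in> D. \<forall>g\<in>carrier G. comm g w \<in> M}"
  have WD: "W \<subseteq> D" by (auto simp: W_def)
  have MW: "M \<subseteq> W"
    unfolding W_def using MD normal_subD(3)[OF nM] sM by (auto simp: subgroup.m_closed subgroup.m_inv_closed)
  have sW: "subgroup W G"
  proof (rule subgroupI_finite)
    show "W \<subseteq> carrier G" using WD Dc by blast
    show "\<one> \<in> W" using MW subgroup.one_closed[OF sM] by blast
    fix a b assume ab: "a \<in> W" "b \<in> W"
    have c: "a \<in> carrier G" "b \<in> carrier G" using ab WD Dc by auto
    have "comm g (a \<otimes> b) \<in> M" if g: "g \<in> carrier G" for g
    proof -
      have "conjugate a (g \<otimes> b \<otimes> inv g \<otimes> inv b) \<in> M" using normal_subD(3)[OF nM c(1)] ab g by (simp add: W_def)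
      moreover have "comm g a \<in> M" using ab g by (simp add: W_def)
      ultimately have "comm g a \<otimes> conjugate a (g \<otimes> b \<otimes> inv g \<otimes> inv b) \<in> M"
        by (rule subgroup.m_closed[OF sM, rotated])
      moreover have "comm g a \<otimes> conjugate a (g \<otimes> b \<otimes> inv g \<otimes> inv b) = comm g (a \<otimes> b)"
        using c g by (simp add: group_simps)
      ultimately show ?thesis by simp
    qed
    moreover have "a \<otimes> b \<in> D" using ab WD sD by (auto intro: subgroup.m_closed)
    ultimately show "a \<otimes> b \<in> W" by (simp add: W_def)
  qed
  have "normal_sub W"
  proof -
    have "conjugate h w \<in> W" if h: "h \<in> carrier G" and w: "w \<in> W" for h w
    proof -
      have wc: "w \<in> carrier G" using w WD Dc by blast
      have "comm h w \<in> W" using w h MW by (auto simp: W_def)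
      then have "comm h w \<otimes> w \<in> W" using w by (rule subgroup.m_closed[OF sW])
      then show ?thesis using h wc by (simp add: m_assoc)
    qed
    then show ?thesis using sW by (auto simp: normal_sub_def normalizes_def)
  qed
  moreover have "d \<in> W"
  proof -
    have dc: "d \<in> carrier G" using d Dc by blast
    have "comm g d \<in> M" if g: "g \<in> carrier G" for g
    proof -
      have "inv d \<otimes> conjugate g d \<in> M"
        using lcoset_eqD[OF sM dc, of "conjugate g d"] d(3)[OF g] act[OF g d(1)] g dc by simp
      then have "d \<otimes> (inv d \<otimes> conjugate g d) \<otimes> inv d \<in> M" using normal_subD(3)[OF nM dc] by blast
      then show ?thesis using g dc by simp
    qed
    then show ?thesis using d(1) by (simp add: W_def)
  qed
  moreover have "d \<notin> M" using d(2) lcoset_eq[OF sM, of \<one> d] lcos_mult_one[OF subgroup.subset[OF sM]] Dc[OF d(1)] by auto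
  ultimately have "W \<notin> \<M>" using M(2) MW by blast
  then have "W = D" using \<open>normal_sub W\<close> WD MW DNM by (auto simp: \<M>_def)
  have "commutator G D (carrier G) \<subseteq> M"
  proof (rule commutator_subset[OF sM])
    fix h k assume hk: "h \<in> D" "k \<in> carrier G"
    then have "comm k h \<in> M" using \<open>W = D\<close> by (auto simp: W_def)
    then have "inv (comm k h) \<in> M" using sM by (simp add: subgroup.m_inv_closed)
    then show "comm h k \<in> M" using hk Dc by (simp add: group_simps)
  qed
  then show False using D(2) MD by blast
qed

end

section \<open>Normality of Sylow subgroups of prime order\<close>

context finite_group begin

lemma pi_elements_normal_sub: "subgroup (pi_elements \<pi>) G \<Longrightarrow> normal_sub (pi_elements \<pi>)"
  by (simp add: normal_sub_def pi_elements_normal)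

lemma pelement_small_action:
  assumes p: "prime p" "prime q" "p \<le> q" and S: "subgroup S G" "card S = p" and y: "pelement q y" "normalizes y S"
  shows "y \<in> centralizer_set S"
proof -
  let ?Y = "generate G {y}"
  have yc: "y \<in> carrier G" using pelement_carrier y(1) .
  have Sc: "S \<subseteq> carrier G" using subgroup.subset[OF S(1)] .
  have Y: "psubgroup q ?Y" using psubgroup_generate[OF p(2) y(1)] .
  then have sY: "subgroup ?Y G" by (simp add: psubgroup_def)
  have yY: "y \<in> ?Y" using generate_singleton_mem[OF yc] .
  have "?Y \<subseteq> {g \<in> carrier G. normalizes g S}"
    by (rule generate_subgroup_incl[OF _ normalizer_subgroup[OF Sc]]) (use y yc in simp)
  then have "\<And>g. g \<in> ?Y \<Longrightarrow> normalizes g S" by blast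
  then have "\<forall>s\<in>S. conjugate y s = s" using psubgroup_centralizes[OF p Y S _ yY] by blast
  then show ?thesis using yc by (simp add: centralizer_set_def)
qed

lemma conj_power_commute:
  assumes c: "g \<in> carrier G" "h \<in> carrier G" "x \<in> carrier G"
    and g: "conjugate g x = x [^] (a::nat)" and h: "conjugate h x = x [^] (b::nat)"
  shows "conjugate (g \<otimes> h) x = conjugate (h \<otimes> g) x"
proof -
  have *: "conjugate (u \<otimes> v) x = x [^] (m * n)"
    if "u \<in> carrier G" "v \<in> carrier G" "conjugate u x = x [^] m" "conjugate v x = x [^] n" for u v and m n :: nat
  proof -
    have "conjugate (u \<otimes> v) x = conjugate u (v \<otimes> x \<otimes> inv v)" using that(1,2) c by (simp add: group_simps)
    also have "\<dots> = u \<otimes> x [^] n \<otimes> inv u" using that(4) by simp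
    also have "\<dots> = (x [^] m) [^] n" using conj_pow[OF that(1) c(3), of n] that(3) by simp
    finally show ?thesis using c(3) by (simp add: nat_pow_pow)
  qed
  show ?thesis using *[OF c(1,2) g h] *[OF c(2,1) h g] by (simp add: mult.commute)
qed

text \<open>This set is the centralizer of the factor \<open>K/L\<close>. Being a subgroup, it
  contains the commutator subgroup as soon as it contains all commutators.\<close>

lemma factor_centralizer_subgroup:
  assumes L: "normal_sub L" and K: "normal_sub K"
  shows "subgroup {c \<in> carrier G. \<forall>k\<in>K. comm c k \<in> L} G" (is "subgroup ?T G")
proof (rule subgroupI_finite)
  note sL = normal_subD(1)[OF L] and sK = normal_subD(1)[OF K]
  have Kc: "\<And>k. k \<in> K \<Longrightarrow> k \<in> carrier G" using sK subgroup_carrier by blast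
  show "\<one> \<in> ?T" using Kc subgroup.one_closed[OF sL] by auto
  fix a b assume ab: "a \<in> ?T" "b \<in> ?T"
  have "comm (a \<otimes> b) k \<in> L" if k: "k \<in> K" for k
  proof -
    have c: "a \<in> carrier G" "b \<in> carrier G" "k \<in> carrier G" using ab k Kc by auto
    have "comm b k \<in> L" using ab k by blast
    then have "conjugate a (b \<otimes> k \<otimes> inv b \<otimes> inv k) \<in> L" using normal_subD(3)[OF L c(1)] by blast
    moreover have "comm a k \<in> L" using ab k by blast
    ultimately have "conjugate a (b \<otimes> k \<otimes> inv b \<otimes> inv k) \<otimes> comm a k \<in> L"
      by (rule subgroup.m_closed[OF sL])
    moreover have "conjugate a (b \<otimes> k \<otimes> inv b \<otimes> inv k) \<otimes> comm a k = comm (a \<otimes> b) k"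
      using c by (simp add: group_simps)
    ultimately show ?thesis by simp
  qed
  then show "a \<otimes> b \<in> ?T" using ab by blast
qed auto

text \<open>The automorphism group of a group of prime order is abelian.\<close>

lemma commutators_centralize_prime_factor:
  assumes r: "prime r" and L: "normal_sub L" and K: "normal_sub K" "L \<subseteq> K" "card K = r * card L"
    and gh: "g \<in> carrier G" "h \<in> carrier G" and k: "k \<in> K"
  shows "comm (g \<otimes> h \<otimes> inv g \<otimes> inv h) k \<in> L"
proof -
  note sL = normal_subD(1)[OF L] and sK = normal_subD(1)[OF K(1)]
  have Kc: "\<And>k. k \<in> K \<Longrightarrow> k \<in> carrier G" and Lc: "\<And>k. k \<in> L \<Longrightarrow> k \<in> carrier G" using sK sL subgroup_carrier by auto
  have "L \<lhd> G" using L normal_sub_iff by blast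
  then interpret L: normal L G .
  interpret Q: group "G Mod L" by (rule L.factorgroup_is_group)
  have finQ: "finite (carrier (G Mod L))" using fin by (simp add: carrier_FactGroup)
  interpret Q: finite_group "G Mod L" by unfold_locales (rule finQ)
  interpret \<phi>: group_hom G "G Mod L" "\<lambda>x. L #> x" by unfold_locales (rule L.r_coset_hom_Mod)
  let ?\<phi> = "\<lambda>x. L #> x"
  have \<phi>1: "x \<otimes> inv y \<in> L" if "x \<in> carrier G" "y \<in> carrier G" "?\<phi> x = ?\<phi> y" for x y
  proof -
    have "x \<in> L #> y" using rcos_self[OF that(1) sL] that(3) by simp
    then obtain l where "l \<in> L" "x = l \<otimes> y" by (auto simp: r_coset_def)
    then show ?thesis using that Lc by (simp add: m_assoc)
  qed
  have "card L < card K" using K(3) subgroup_card_pos[OF sL] prime_gt_1_nat[OF r] by simp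
  then obtain x where x: "x \<in> K" "x \<notin> L" using K(2) by (metis less_irrefl subsetI subset_antisym)
  have xc: "x \<in> carrier G" using x Kc by blast
  let ?X = "generate G {x}"
  have sX: "subgroup ?X G" using subgroup_generate xc by simp
  have LX: "subgroup (L <#> ?X) G" by (rule set_mult_subgroup[OF sL sX]) (use normal_subD(3)[OF L] sX subgroup_carrier in blast)
  have XK: "?X \<subseteq> K" by (rule generate_subgroup_incl[OF _ sK]) (use x in simp)
  have "L <#> ?X \<subseteq> K" unfolding set_mult_def using XK K(2) sK by (auto intro: subgroup.m_closed)
  moreover have "x \<in> L <#> ?X" using set_mult_incl(2)[OF sL sX] generate_singleton_mem[OF xc] by blast
  ultimately have Keq: "L <#> ?X = K" using prime_index_maximal[OF r sK sL LX set_mult_incl(1)[OF sL sX] _ K(3) _ x(2)] by blast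
  have pw: "\<exists>a::nat. ?\<phi> y = ?\<phi> x [^]\<^bsub>G Mod L\<^esub> a" if y: "y \<in> K" for y
  proof -
    obtain l z where lz: "l \<in> L" "z \<in> ?X" "y = l \<otimes> z" using y Keq by (auto simp: set_mult_def)
    obtain a where a: "z = x [^] (a::nat)" using lz(2) generate_singleton[OF xc] by auto
    have zc: "z \<in> carrier G" using a xc by simp
    have "?\<phi> l = \<one>\<^bsub>G Mod L\<^esub>" using coset_join2[OF Lc[OF lz(1)] sL lz(1)] by simp
    then have "?\<phi> y = ?\<phi> z" using \<phi>.hom_mult[OF Lc[OF lz(1)] zc] lz(3) Q.l_one[OF \<phi>.hom_closed[OF zc]] by metis
    then show ?thesis using a \<phi>.hom_nat_pow[OF xc, of a] by metis
  qed
  have \<phi>conj: "?\<phi> (conjugate u x) = ?\<phi> u \<otimes>\<^bsub>G Mod L\<^esub> ?\<phi> x \<otimes>\<^bsub>G Mod L\<^esub> inv\<^bsub>G Mod L\<^esub> ?\<phi> u" if "u \<in> carrier G" for u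
    using that xc \<phi>.hom_mult \<phi>.hom_inv by (simp del: mult_FactGroup)
  obtain a where a: "?\<phi> (conjugate g x) = ?\<phi> x [^]\<^bsub>G Mod L\<^esub> (a::nat)" using pw normal_subD(3)[OF K(1) gh(1) x(1)] by blast
  obtain b where b: "?\<phi> (conjugate h x) = ?\<phi> x [^]\<^bsub>G Mod L\<^esub> (b::nat)" using pw normal_subD(3)[OF K(1) gh(2) x(1)] by blast
  have e: "?\<phi> (conjugate (g \<otimes> h) x) = ?\<phi> (conjugate (h \<otimes> g) x)"
  proof -
    have "?\<phi> g \<otimes>\<^bsub>G Mod L\<^esub> ?\<phi> h \<otimes>\<^bsub>G Mod L\<^esub> ?\<phi> x \<otimes>\<^bsub>G Mod L\<^esub> inv\<^bsub>G Mod L\<^esub> (?\<phi> g \<otimes>\<^bsub>G Mod L\<^esub> ?\<phi> h) =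
      ?\<phi> h \<otimes>\<^bsub>G Mod L\<^esub> ?\<phi> g \<otimes>\<^bsub>G Mod L\<^esub> ?\<phi> x \<otimes>\<^bsub>G Mod L\<^esub> inv\<^bsub>G Mod L\<^esub> (?\<phi> h \<otimes>\<^bsub>G Mod L\<^esub> ?\<phi> g)"
      by (rule Q.conj_power_commute[OF _ _ _ a[unfolded \<phi>conj[OF gh(1)]] b[unfolded \<phi>conj[OF gh(2)]]])
        (use gh xc \<phi>.hom_closed in auto)
    then show ?thesis using \<phi>conj[of "g \<otimes> h"] \<phi>conj[of "h \<otimes> g"] gh \<phi>.hom_mult[OF gh] \<phi>.hom_mult[OF gh(2,1)] by simp
  qed
  define c where "c = comm g h"
  have cc: "c \<in> carrier G" using gh by (simp add: c_def)
  \<comment> \<open>Modulo \<open>L\<close>, this element commutes with \<open>c\<close>, because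
    \<open>g \<otimes> h\<close> and \<open>h \<otimes> g\<close> act alike on \<open>x\<close>. One
    element outside \<open>L\<close> is enough: those commuting with \<open>c\<close> modulo
    \<open>L\<close> form a subgroup between \<open>L\<close> and \<open>K\<close>, and
    \<open>L\<close> has prime index.\<close>
  define y where "y = conjugate (h \<otimes> g) x"
  have yK: "y \<in> K" unfolding y_def using normal_subD(3)[OF K(1) _ x(1)] gh by simp
  have yc: "y \<in> carrier G" using yK Kc by blast
  have yL: "y \<notin> L"
  proof
    assume "y \<in> L"
    then have "inv (h \<otimes> g) \<otimes> y \<otimes> inv (inv (h \<otimes> g)) \<in> L" using normal_subD(3)[OF L, of "inv (h \<otimes> g)" y] gh by simp
    then show False using x(2) gh xc by (simp add: y_def group_simps)
  qed
  have "conjugate c y = conjugate (g \<otimes> h) x" unfolding c_def y_def using gh xc by (simp add: group_simps)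
  then have "?\<phi> (conjugate c y) = ?\<phi> y" using e by (simp add: y_def)
  then have cy: "comm c y \<in> L" using \<phi>1 cc yc by simp
  let ?T = "{k \<in> K. comm c k \<in> L}"
  have T: "subgroup ?T G"
  proof (rule subgroupI_finite)
    show "\<one> \<in> ?T" using subgroup.one_closed[OF sK] subgroup.one_closed[OF sL] cc by simp
    fix u v assume uv: "u \<in> ?T" "v \<in> ?T"
    have uvc: "u \<in> carrier G" "v \<in> carrier G" using uv Kc by auto
    have "conjugate u (c \<otimes> v \<otimes> inv c \<otimes> inv v) \<in> L" using uv normal_subD(3)[OF L uvc(1)] by blast
    then have "comm c u \<otimes> conjugate u (c \<otimes> v \<otimes> inv c \<otimes> inv v) \<in> L"
      by (rule subgroup.m_closed[OF sL, rotated]) (use uv in blast)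
    moreover have "comm c u \<otimes> conjugate u (c \<otimes> v \<otimes> inv c \<otimes> inv v) = comm c (u \<otimes> v)"
      using cc uvc by (simp add: group_simps)
    moreover have "u \<otimes> v \<in> K" using uv sK by (auto intro: subgroup.m_closed)
    ultimately show "u \<otimes> v \<in> ?T" by simp
  qed (use Kc in auto)
  have "l \<in> ?T" if l: "l \<in> L" for l
    using l K(2) normal_subD(3)[OF L cc l] sL by (auto simp: subgroup.m_closed subgroup.m_inv_closed)
  then have "?T = K" using prime_index_maximal[OF r sK sL T _ _ K(3) _ yL] yK cy by blast
  then show ?thesis using k unfolding c_def by blast
qed

lemma pi_elements_all: "pi_elements (\<lambda>_. True) = carrier G" by (simp add: pi_elements_def)

lemma pelement_dvd_ord:
  assumes "prime q" "pelement q y" "y \<noteq> \<one>" shows "q dvd ord y"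
proof -
  obtain k where k: "ord y = q ^ k" using pelement_ord assms by blast
  have "k \<noteq> 0" using assms(3) k ord_eq_1[OF pelement_carrier[OF assms(2)]] by (cases k) auto
  then show ?thesis using k by simp
qed

lemma sylow_in_pi:
  assumes "prime p" "\<pi> p" "subgroup (pi_elements \<pi>) G" "sylow_in p P (carrier G)"
  shows "sylow_in p P (pi_elements \<pi>)"
proof (rule sylow_in_between[OF assms(1) subgroup_self assms(4,3) _ pi_elements_carrier])
  show "P \<subseteq> pi_elements \<pi>"
    using psubgroup_pelement[OF sylow_inD(3)[OF assms(4)]] pelement_pi[OF assms(1)] assms(2) by blast
qed

lemma prime_order_subgroup_incl:
  assumes p: "prime p" and P: "subgroup P G" "card P = p" and L: "subgroup L G" and z: "z \<in> P" "z \<in> L" "z \<noteq> \<one>"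
  shows "P \<subseteq> L"
proof -
  have s: "subgroup (P \<inter> L) G" using P(1) L by (rule subgroups_Inter_pair)
  have "card (P \<inter> L) dvd p" using subgroup_card_dvd[OF s P(1)] P(2) by simp
  moreover have "card (P \<inter> L) \<noteq> 1" using card_one_iff[OF s] z by auto
  ultimately have "card (P \<inter> L) = card P" using p P(2) prime_nat_iff by blast
  then have "P \<inter> L = P" using card_subset_eq[OF subgroup_finite[OF P(1)], of "P \<inter> L"] by simp
  then show ?thesis by blast
qed

text \<open>An element of order \<open>p\<close> of \<open>L\<close> is conjugate in
  \<open>K\<close> to an element of \<open>P\<close>, which still lies in \<open>L\<close> and
  generates \<open>P\<close>.\<close>

lemma normalized_contains_prime_sylow:
  assumes p: "prime p" and K: "subgroup K G" and P: "sylow_in p P K" "card P = p"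
    and L: "subgroup L G" "L \<subseteq> K" "\<And>g. g \<in> K \<Longrightarrow> normalizes g L" and pd: "p dvd card L"
  shows "P \<subseteq> L"
proof -
  obtain z where z: "z \<in> L" "ord z = p" using cauchy_element[OF p L(1) pd] by blast
  have zc: "z \<in> carrier G" using z L(1) subgroup_carrier by blast
  have pz: "pelement p z" using pow_ord_eq_1[OF zc] z(2) zc by (auto simp: pelement_def intro: exI[of _ 1])
  have "generate G {z} \<subseteq> K" by (rule generate_subgroup_incl[OF _ K]) (use z L(2) in auto)
  then obtain h where h: "h \<in> K" "\<forall>a\<in>generate G {z}. inv h \<otimes> a \<otimes> h \<in> P"
    using sylow_conj_sub[OF p K P(1) psubgroup_generate[OF p pz]] by blast
  have hc: "h \<in> carrier G" using h(1) K subgroup_carrier by blast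
  have w: "inv h \<otimes> z \<otimes> h \<in> P" using h(2) generate_singleton_mem[OF zc] by blast
  have wL: "inv h \<otimes> z \<otimes> h \<in> L"
    using normalizes_inv[OF L(3)[OF h(1)] subgroup.subset[OF L(1)]] z(1) hc by (simp add: normalizes_def)
  have "inv h \<otimes> z \<otimes> h \<noteq> \<one>"
  proof
    assume "inv h \<otimes> z \<otimes> h = \<one>"
    then have "conjugate h (inv h \<otimes> z \<otimes> h) = \<one>" using hc by simp
    then have "z = \<one>" using hc zc by (simp add: m_assoc)
    then show False using z(2) p not_prime_1 ord_id by metis
  qed
  then show ?thesis using prime_order_subgroup_incl[OF p sylow_inD(1)[OF P(1)] P(2) L(1) w wL] by blast
qed

end

section \<open>The normal series that removes the primes in increasing order\<close>

context hall_embedded_group begin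

text \<open>The \<open>K\<^sub>m\<close> of the overview. All natural numbers serve as indices, so
  that plain induction applies; the series is constant at numbers that are not prime.\<close>

abbreviation upper :: "nat \<Rightarrow> 'a set" where "upper m \<equiv> pi_elements (\<lambda>q. m \<le> q)"

lemma upper_Suc_not_prime: "\<not> prime m \<Longrightarrow> upper (Suc m) = upper m"
  unfolding pi_elements_def by (metis Suc_le_eq le_eq_less_or_eq)

text \<open>If the Sylow \<open>p\<close>-subgroups do not have order \<open>p\<close>,
  \<open>upper p\<close> is intersected with the normal \<open>p\<close>-complement of
  \<open>G\<close>. If they do, only primes \<open>q \<ge> p\<close> occur in
  \<open>upper p\<close>, so the normalizer of \<open>P\<close> in it centralizes \<open>P\<close>,
  and Burnside's condition holds modulo the trivial group.\<close>

lemma upper_subgroup: "subgroup (upper m) G"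
proof (induction m)
  case 0
  show ?case using pi_elements_all subgroup_self by simp
next
  case (Suc p)
  show ?case
  proof (cases "prime p")
    case False
    then show ?thesis using upper_Suc_not_prime Suc by simp
  next
    case p: True
    obtain P where P: "sylow_in p P (carrier G)" using sylow_exists[OF p subgroup_self] by blast
    show ?thesis
    proof (cases "card P = p")
      case False
      have "upper p \<inter> pi_elements (\<lambda>q. q \<noteq> p) = upper (Suc p)"
        unfolding pi_elements_Int by (auto simp: pi_elements_def Suc_le_eq)
      moreover have "subgroup (upper p \<inter> pi_elements (\<lambda>q. q \<noteq> p)) G"
        using Suc p_complement_of_large_sylow[OF p P False] by (rule subgroups_Inter_pair)
      ultimately show ?thesis by simp
    next
      case cP: True
      let ?K = "upper p"
      have PK: "sylow_in p P ?K" using sylow_in_pi[OF p _ Suc P] by simp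
      note sP = sylow_inD(1)[OF P]
      have Kc: "\<And>x. x \<in> ?K \<Longrightarrow> x \<in> carrier G" using pi_elements_carrier by blast
      have "P \<noteq> {\<one>}" using card_one_iff[OF sP] cP p not_prime_1 by auto
      then obtain x where x: "x \<in> P" "x \<notin> {\<one>}" using subgroup.one_closed[OF sP] by auto
      let ?N = "{g \<in> carrier G. normalizes g P} \<inter> ?K"
      have N: "subgroup ?N G" using normalizer_subgroup[OF subgroup.subset[OF sP]] Suc by (rule subgroups_Inter_pair)
      note C = centralizer_set_subgroup[OF subgroup.subset[OF sP]]
      have NC: "?N \<subseteq> centralizer_set P"
      proof (rule prime_power_generation[OF N])
        fix q y assume q: "prime q" "pelement q y" and y: "y \<in> ?N"
        show "y \<in> centralizer_set P"
        proof (cases "y = \<one>")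
          case True then show ?thesis using subgroup.one_closed[OF C] by simp
        next
          case False
          then have "p \<le> q" using pelement_dvd_ord[OF q False] y q(1) by (auto simp: pi_elements_def)
          then show ?thesis using pelement_small_action[OF p q(1) _ sP cP q(2)] y by blast
        qed
      qed (simp add: subgroup.m_closed[OF C])
      have "\<exists>L. subgroup L G \<and> L \<subseteq> ?K \<and> (\<forall>g\<in>?K. normalizes g L) \<and> x \<notin> L \<and>
        (\<forall>q y. prime q \<longrightarrow> q \<noteq> p \<longrightarrow> pelement q y \<longrightarrow> y \<in> ?K \<longrightarrow> y \<in> L)"
      proof (rule burnside_transfer[OF p Suc PK triv_subgroup _ _ _ _ _ x])
        show "{\<one>} \<subseteq> ?K" using subgroup.one_closed[OF Suc] by simp
        show "\<And>g. g \<in> ?K \<Longrightarrow> normalizes g {\<one>}" using Kc by (simp add: normalizes_def)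
        show "sylow_in p {\<one>} {\<one>}" using triv_subgroup by (simp add: sylow_in_def)
        show "{\<one>} \<subseteq> P" using subgroup.one_closed[OF sP] by simp
        show "card P = p * card {\<one>}" using cP by simp
        fix n s assume n: "n \<in> ?K" "normalizes n P" and s: "s \<in> P"
        have "n \<in> centralizer_set P" using NC n Kc by blast
        then have "conjugate n s = s" using s by (simp add: centralizer_set_def)
        then show "comm n s \<in> {\<one>}" using s sP subgroup_carrier by simp
      qed
      then obtain L where L: "subgroup L G" "L \<subseteq> ?K" "\<And>g. g \<in> ?K \<Longrightarrow> normalizes g L" "x \<notin> L"
        "\<And>q y. prime q \<Longrightarrow> q \<noteq> p \<Longrightarrow> pelement q y \<Longrightarrow> y \<in> ?K \<Longrightarrow> y \<in> L" by blast
      have "pi_elements (\<lambda>q. Suc p \<le> q) = L"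
      proof (rule pi_elements_eq[OF L(1)])
        fix q y assume q: "prime q" "Suc p \<le> q" "pelement q y"
        have "y \<in> ?K" by (rule pelement_pi[OF q(1,3)]) (use q(2) in simp)
        then show "y \<in> L" using L(5)[OF q(1) _ q(3)] q(2) by simp
      next
        fix q assume q: "prime q" "q dvd card L"
        then have "q dvd card ?K" using subgroup_card_dvd[OF L(1) Suc L(2)] by (meson dvd_trans)
        then have "p \<le> q" using pi_elements_card[OF Suc q(1)] by simp
        \<comment> \<open>Transfer only shows that \<open>L\<close> misses the element
          \<open>x\<close> of \<open>P\<close>. Since \<open>P\<close> has order \<open>p\<close>,
          this already makes the order of \<open>L\<close> prime to \<open>p\<close>.\<close>
        moreover have "q \<noteq> p"
        proof
          assume "q = p"
          then have "P \<subseteq> L" using normalized_contains_prime_sylow[OF p Suc PK cP L(1-3)] q(2) by simp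
          then show False using x(1) L(4) by blast
        qed
        ultimately show "Suc p \<le> q" by simp
      qed
      then show ?thesis using L(1) by simp
    qed
  qed
qed

lemma upper_normal: "normal_sub (upper m)"
  using pi_elements_normal_sub upper_subgroup by blast

text \<open>A prime \<open>q\<close> dividing the index of \<open>?L <#> R\<close> in
  \<open>?K\<close> is at least \<open>r\<close>. It is not \<open>r\<close>, because
  \<open>R\<close> is a Sylow subgroup, and not larger, because \<open>?L\<close> contains a Sylow
  \<open>q\<close>-subgroup of \<open>G\<close>.\<close>

lemma card_upper_prime:
  assumes r: "prime r" and R: "sylow_in r R (carrier G)" "card R = r"
  shows "card (upper r) = r * card (upper (Suc r))"
proof -
  let ?K = "upper r" and ?L = "upper (Suc r)"
  note sR = sylow_inD(1)[OF R(1)]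
  have LK: "?L \<subseteq> ?K" by (rule pi_elements_mono) simp
  have RK: "sylow_in r R ?K" using sylow_in_pi[OF r _ upper_subgroup R(1)] by simp
  have H: "subgroup (?L <#> R) G"
    by (rule set_mult_subgroup[OF upper_subgroup sR]) (use normal_subD(3)[OF upper_normal] sR subgroup_carrier in blast)
  have HK: "?L <#> R \<subseteq> ?K" unfolding set_mult_def
    using LK sylow_inD(2)[OF RK] upper_subgroup[of r] by (auto intro: subgroup.m_closed)
  have "?L \<inter> R = {\<one>}"
  proof -
    have s: "subgroup (?L \<inter> R) G" using upper_subgroup sR by (rule subgroups_Inter_pair)
    have "card (?L \<inter> R) dvd r" using subgroup_card_dvd[OF s sR] R(2) by simp
    moreover have "\<not> r dvd card ?L" using pi_elements_card[OF upper_subgroup[of "Suc r"] r] by auto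
    then have "card (?L \<inter> R) \<noteq> r" using subgroup_card_dvd[OF s upper_subgroup[of "Suc r"]] by auto
    ultimately have "card (?L \<inter> R) = 1" using r prime_nat_iff by blast
    then show ?thesis using card_one_iff[OF s] by simp
  qed
  then have cH: "card (?L <#> R) = r * card ?L" using card_set_mult[OF upper_subgroup[of "Suc r"] sR] R(2) by simp
  obtain d where d: "card ?K = card (?L <#> R) * d" using subgroup_card_dvd[OF H upper_subgroup HK] by (auto elim: dvdE)
  have "d = 1"
  proof (rule ccontr)
    assume "d \<noteq> 1"
    then obtain q where q: "prime q" "q dvd d" using prime_factor_nat by blast
    have "r \<le> q" using pi_elements_card[OF upper_subgroup[of r] q(1)] q(2) d by simp
    show False
    proof (cases "q = r")
      case True
      have "card ?K = card R * (card ?L * d)" using d cH R(2) by simp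
      then have "\<not> r dvd card ?L * d" by (rule sylow_index[OF r upper_subgroup RK])
      then show False using q(2) True by simp
    next
      case False
      then have qr: "Suc r \<le> q" using \<open>r \<le> q\<close> by simp
      obtain Q where Q: "sylow_in q Q (carrier G)" using sylow_exists[OF q(1) subgroup_self] by blast
      have QK: "sylow_in q Q ?K" using sylow_in_pi[OF q(1) _ upper_subgroup Q] \<open>r \<le> q\<close> by simp
      have QL: "sylow_in q Q ?L" using sylow_in_pi[OF q(1) _ upper_subgroup Q] qr by simp
      obtain e where e: "card ?L = card Q * e"
        using subgroup_card_dvd[OF sylow_inD(1)[OF QL] upper_subgroup sylow_inD(2)[OF QL]] by (auto elim: dvdE)
      have "card ?K = card Q * (r * e * d)" using d cH e by simp
      then have "\<not> q dvd r * e * d" by (rule sylow_index[OF q(1) upper_subgroup QK])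
      then show False using q(2) by simp
    qed
  qed
  then show ?thesis using d cH by simp
qed

text \<open>The descent shows that \<open>G\<close> is the product of \<open>upper m\<close> and the
  normalizer of \<open>P\<close>, for every \<open>m\<close>; beyond the order of \<open>G\<close>
  the first factor is trivial. By \<open>cen\<close>, \<open>upper r\<close> normalizes
  \<open>upper (Suc r) <#> P\<close>, and there the Frattini argument leads from \<open>r\<close> to
  \<open>Suc r\<close>.\<close>

lemma minimal_sylow_normal:
  assumes p: "prime p" and P: "sylow_in p P (carrier G)" "card P = p"
    and D: "P \<subseteq> commutator G (carrier G) (carrier G)"
  shows "normal_sub P"
proof -
  note sP = sylow_inD(1)[OF P(1)]
  have Pc: "\<And>x. x \<in> P \<Longrightarrow> x \<in> carrier G" using sP subgroup_carrier by blast
  have cen: "comm l u \<in> upper (Suc r)" if r: "prime r" and l: "l \<in> upper r" and u: "u \<in> P" for r l u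
  proof -
    have lc: "l \<in> carrier G" and uc: "u \<in> carrier G" using l u Pc pi_elements_carrier by auto
    obtain R where R: "sylow_in r R (carrier G)" using sylow_exists[OF r subgroup_self] by blast
    \<comment> \<open>If the factor has order \<open>r\<close>, its centralizer contains the
      commutator subgroup and so \<open>P\<close>. Otherwise \<open>P\<close> lies in the normal
      \<open>r\<close>-complement, which meets \<open>upper r\<close> in
      \<open>upper (Suc r)\<close>.\<close>
    show ?thesis
    proof (cases "card R = r")
      case True
      let ?T = "{c \<in> carrier G. \<forall>k\<in>upper r. comm c k \<in> upper (Suc r)}"
      have LK: "upper (Suc r) \<subseteq> upper r" by (rule pi_elements_mono) simp
      have "commutator G (carrier G) (carrier G) \<subseteq> ?T"
        by (rule commutator_subset[OF factor_centralizer_subgroup[OF upper_normal upper_normal]])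
          (use commutators_centralize_prime_factor[OF r upper_normal upper_normal LK card_upper_prime[OF r R True]] in simp)
      then have "comm u l \<in> upper (Suc r)" using D u l by blast
      then have "inv (comm u l) \<in> upper (Suc r)" by (rule subgroup.m_inv_closed[OF upper_subgroup])
      then show ?thesis using lc uc by (simp add: group_simps)
    next
      case False
      let ?C = "pi_elements (\<lambda>q. q \<noteq> r)"
      have "r \<noteq> p" using False P R by (auto simp: sylow_in_def)
      have C: "subgroup ?C G" using p_complement_of_large_sylow[OF r R False] .
      have uC: "u \<in> ?C" by (rule pelement_pi[OF p psubgroup_pelement[OF sylow_inD(3)[OF P(1)] u]]) (use \<open>r \<noteq> p\<close> in simp)
      have "conjugate l u \<in> ?C" using normal_subD(3)[OF pi_elements_normal_sub[OF C] lc uC] .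
      then have "comm l u \<in> ?C" using uC C by (simp add: subgroup.m_closed subgroup.m_inv_closed)
      moreover have "conjugate u (inv l) \<in> upper r"
        using normal_subD(3)[OF upper_normal uc] subgroup.m_inv_closed[OF upper_subgroup l] by blast
      then have "l \<otimes> conjugate u (inv l) \<in> upper r" by (rule subgroup.m_closed[OF upper_subgroup l])
      then have "comm l u \<in> upper r" using lc uc by (simp add: m_assoc)
      ultimately have "comm l u \<in> upper r \<inter> ?C" by blast
      moreover have "upper r \<inter> ?C = upper (Suc r)" unfolding pi_elements_Int by (auto simp: pi_elements_def Suc_le_eq)
      ultimately show ?thesis by simp
    qed
  qed
  have step: "\<exists>l\<in>upper m. normalizes (inv l \<otimes> g) P" if g: "g \<in> carrier G" for g m
  proof (induction m)
    case 0
    have "normalizes (inv g \<otimes> g) P" using g Pc by (simp add: normalizes_def)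
    moreover have "upper 0 = carrier G" using pi_elements_all by simp
    ultimately show ?case using g by blast
  next
    case (Suc r)
    then obtain l where l: "l \<in> upper r" "normalizes (inv l \<otimes> g) P" by blast
    have lc: "l \<in> carrier G" using l pi_elements_carrier by blast
    show ?case
    proof (cases "prime r")
      case False
      then show ?thesis using l upper_Suc_not_prime by auto
    next
      case r: True
      let ?L = "upper (Suc r)"
      have Lc: "\<And>a. a \<in> ?L \<Longrightarrow> a \<in> carrier G" using pi_elements_carrier by blast
      have H: "subgroup (?L <#> P) G"
        by (rule set_mult_subgroup[OF upper_subgroup sP]) (use normal_subD(3)[OF upper_normal] Pc in blast)
      have PH: "sylow_in p P (?L <#> P)"
        by (rule sylow_in_between[OF p subgroup_self P(1) H set_mult_incl(2)[OF upper_subgroup sP] subgroup.subset[OF H]])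
      have "normalizes l (?L <#> P)"
      proof -
        have "conjugate l s \<in> ?L <#> P" if "s \<in> ?L <#> P" for s
        proof -
          obtain a u where au: "a \<in> ?L" "u \<in> P" "s = a \<otimes> u" using \<open>s \<in> ?L <#> P\<close> by (auto simp: set_mult_def)
          have "conjugate l s = conjugate l a \<otimes> comm l u \<otimes> u"
            unfolding au(3) using lc Lc[OF au(1)] Pc[OF au(2)] by (simp add: group_simps)
          moreover have "conjugate l a \<otimes> comm l u \<in> ?L"
            by (rule subgroup.m_closed[OF upper_subgroup normal_subD(3)[OF upper_normal lc au(1)] cen[OF r l(1) au(2)]])
          ultimately show ?thesis using set_multI au(2) by metis
        qed
        then show ?thesis using lc by (simp add: normalizes_def)
      qed
      then obtain b where b: "b \<in> ?L <#> P" "normalizes (inv b \<otimes> l) P" using frattini[OF p H PH] by blast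
      obtain a u where au: "a \<in> ?L" "u \<in> P" "b = a \<otimes> u" using b(1) by (auto simp: set_mult_def)
      have c: "a \<in> carrier G" "u \<in> carrier G" using au Lc Pc by auto
      have Ps: "P \<subseteq> carrier G" using Pc by blast
      \<comment> \<open>In \<open>b = a \<otimes> u\<close> the factor \<open>u\<close> lies in
        \<open>P\<close> and so normalizes it; absorbing \<open>u\<close> leaves the representative
        \<open>a\<close> in \<open>?L\<close>.\<close>
      have "normalizes (u \<otimes> (inv b \<otimes> l) \<otimes> (inv l \<otimes> g)) P"
        using normalizes_mult[OF normalizes_mult[OF normalizes_self[OF sP au(2)] b(2) Ps] l(2) Ps] .
      moreover have "u \<otimes> (inv b \<otimes> l) \<otimes> (inv l \<otimes> g) = inv a \<otimes> g" unfolding au(3) using c lc g by (simp add: group_simps)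
      ultimately show ?thesis using au(1) by auto
    qed
  qed
  have "normalizes g P" if g: "g \<in> carrier G" for g
  proof -
    obtain l where l: "l \<in> upper (Suc (order G))" "normalizes (inv l \<otimes> g) P" using step[OF g] by blast
    have lc: "l \<in> carrier G" using l pi_elements_carrier by blast
    have "ord l = 1"
    proof (rule ccontr)
      assume "ord l \<noteq> 1"
      then obtain q where q: "prime q" "q dvd ord l" using prime_factor_nat by blast
      then have "Suc (order G) \<le> q" using l(1) by (simp add: pi_elements_def)
      moreover have "q \<le> ord l" using q ord_ge_1[OF fin lc] by (intro dvd_imp_le) auto
      moreover have "ord l \<le> order G" using ord_le_group_order[OF fin lc] .
      ultimately show False by simp
    qed
    then have "l = \<one>" using ord_eq_1[OF lc] by simp
    then show ?thesis using l(2) g by simp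
  qed
  then show ?thesis using sP by (simp add: normal_sub_def)
qed

end

section \<open>Products with the residual\<close>

context finite_group begin

text \<open>If \<open>i\<close> is least with \<open>lower_central G i \<subseteq> N\<close>, the
  preceding term normalizes \<open>N\<close>, since its commutators with \<open>N\<close> lie in
  \<open>N\<close>.\<close>

lemma normalizer_growth:
  assumes N: "subgroup N G" "lower_central G n \<subseteq> N" "N \<noteq> carrier G"
  shows "\<exists>g\<in>carrier G. g \<notin> N \<and> normalizes g N"
proof -
  define i where "i = (LEAST i. lower_central G i \<subseteq> N)"
  have i: "lower_central G i \<subseteq> N" unfolding i_def using N(2) by (rule LeastI)
  have "i \<noteq> 0"
  proof
    assume "i = 0"
    then show False using i N(3) subgroup.subset[OF N(1)] by auto
  qed
  then obtain j where j: "i = Suc j" by (cases i) auto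
  then have "\<not> lower_central G j \<subseteq> N" using not_less_Least[of j "\<lambda>i. lower_central G i \<subseteq> N"] by (simp add: i_def)
  then obtain g where g: "g \<in> lower_central G j" "g \<notin> N" by blast
  have gc: "g \<in> carrier G" using g normal_subD(1)[OF lower_central_normal] subgroup_carrier by blast
  have "conjugate g s \<in> N" if s: "s \<in> N" for s
  proof -
    have sc: "s \<in> carrier G" using s N(1) subgroup_carrier by blast
    have "comm g s \<in> commutator G (lower_central G j) (carrier G)"
      unfolding commutator_def using g sc by (intro generate.incl) blast
    then have "comm g s \<in> N" using i j by auto
    then have "comm g s \<otimes> s \<in> N" using s by (rule subgroup.m_closed[OF N(1)])
    then show ?thesis using gc sc by (simp add: m_assoc)
  qed
  then show ?thesis using g gc by (auto simp: normalizes_def)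
qed

lemma normal_product_subgroup: "normal_sub D \<Longrightarrow> subgroup Q G \<Longrightarrow> subgroup (D <#> Q) G"
  using set_mult_subgroup[OF normal_subD(1)] normal_subD(3) subgroup_carrier by blast

lemma normalizes_product:
  assumes "normalizes g D" "normalizes g Q" "D \<subseteq> carrier G" "Q \<subseteq> carrier G"
  shows "normalizes g (D <#> Q)"
proof -
  have "conjugate g s \<in> D <#> Q" if s: "s \<in> D <#> Q" for s
  proof -
    obtain d u where du: "d \<in> D" "u \<in> Q" "s = d \<otimes> u" using s by (auto simp: set_mult_def)
    have "g \<in> carrier G" "d \<in> carrier G" "u \<in> carrier G" using du assms normalizes_carrier by auto
    then have "conjugate g s = conjugate g d \<otimes> conjugate g u" unfolding du(3) by (simp add: group_simps)
    then show ?thesis using du assms by (simp add: normalizes_def set_multI)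
  qed
  then show ?thesis using normalizes_carrier[OF assms(1)] by (simp add: normalizes_def)
qed

text \<open>Sylow subgroups of the nilpotent quotient by \<open>D\<close> are normal. Concretely,
  the normalizer of \<open>D <#> Q\<close> is its own normalizer by the Frattini argument, and by
  \<open>normalizer_growth\<close> such a subgroup is not proper.\<close>

lemma sylow_product_normal:
  assumes D: "normal_sub D" "lower_central G n \<subseteq> D" and q: "prime q" and Q: "sylow_in q Q (carrier G)"
  shows "normal_sub (D <#> Q)"
proof -
  note sD = normal_subD(1)[OF D(1)] and sQ = sylow_inD(1)[OF Q]
  let ?H = "D <#> Q"
  have H: "subgroup ?H G" using normal_product_subgroup[OF D(1) sQ] .
  let ?N = "{g \<in> carrier G. normalizes g ?H}"
  have N: "subgroup ?N G" using normalizer_subgroup[OF subgroup.subset[OF H]] .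
  have HN: "?H \<subseteq> ?N" using normalizes_self[OF H] subgroup_carrier[OF H] by blast
  have DH: "D \<subseteq> ?H" and QH: "Q \<subseteq> ?H" using set_mult_incl[OF sD sQ] by auto
  have "?N = carrier G"
  proof (rule ccontr)
    assume "?N \<noteq> carrier G"
    then obtain g where g: "g \<in> carrier G" "g \<notin> ?N" "normalizes g ?N"
      using normalizer_growth[OF N _ , of n] D(2) DH HN by blast
    have "sylow_in q Q ?N" by (rule sylow_in_between[OF q subgroup_self Q N]) (use QH HN in auto)
    then obtain b where b: "b \<in> ?N" "normalizes (inv b \<otimes> g) Q" using frattini[OF q N _ g(3)] by blast
    have bc: "b \<in> carrier G" using b by blast
    have "normalizes (inv b \<otimes> g) ?H"
      by (rule normalizes_product[OF normal_subD(2)[OF D(1)] b(2) subgroup.subset[OF sD] subgroup.subset[OF sQ]])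
        (use bc g in simp)
    then have "inv b \<otimes> g \<in> ?N" using normalizes_carrier by blast
    then have "b \<otimes> (inv b \<otimes> g) \<in> ?N" by (rule subgroup.m_closed[OF N b(1)])
    then show False using g bc by simp
  qed
  then show ?thesis using H by (auto simp: normal_sub_def)
qed

text \<open>The witness \<open>D <#> A\<close> permutes with \<open>P\<close> because
  \<open>D\<close> and \<open>D <#> P\<close> are normal. A prime dividing both the order of
  \<open>A\<close> and its index \<open>m\<close> in the witness divides the order of
  \<open>D\<close>, hence not the index of \<open>D\<close>. So it divides both factors of
  \<open>m * card (D \<inter> A) = card D\<close>, against square-freeness.\<close>

lemma hall_embedded_of_residual:
  assumes D: "normal_sub D" "lower_central G n \<subseteq> D" and hall: "hall_subgroup D G" and sf: "squarefree (card D)"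
    and A: "subgroup A G"
  shows "hall_S_quasinormally_embedded A G"
proof -
  note sD = normal_subD(1)[OF D(1)]
  let ?E = "D <#> A"
  have E: "subgroup ?E G" using normal_product_subgroup[OF D(1) A] .
  have AE: "A \<subseteq> ?E" using set_mult_incl(2)[OF sD A] .
  have "S_quasinormal ?E G" unfolding S_quasinormal_def
  proof (intro conjI allI impI)
    fix P assume "sylow_subgroup P G"
    then obtain p where p: "prime p" "sylow_in p P (carrier G)" using sylow_subgroup_iff by blast
    note sP = sylow_inD(1)[OF p(2)]
    have nD: "D \<lhd> G" and nH: "D <#> P \<lhd> G" using D(1) sylow_product_normal[OF D p] normal_sub_iff by auto
    have c: "D \<subseteq> carrier G" "A \<subseteq> carrier G" "P \<subseteq> carrier G" using sD A sP subgroup.subset by auto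
    have "?E <#> P = A <#> D <#> P" using commut_normal[OF A nD] by simp
    also have "\<dots> = A <#> (D <#> P)" using set_mult_assoc[OF c(2,1,3)] .
    also have "\<dots> = D <#> P <#> A" using commut_normal[OF A nH] .
    also have "\<dots> = P <#> D <#> A" using commut_normal[OF sP nD] by simp
    also have "\<dots> = P <#> ?E" using set_mult_assoc[OF c(3,1,2)] .
    finally show "?E <#> P = P <#> ?E" .
  qed (rule E)
  moreover have "hall_subgroup A (G\<lparr>carrier := ?E\<rparr>)"
  proof -
    let ?GE = "G\<lparr>carrier := ?E\<rparr>"
    interpret E: finite_group ?GE using finite_group_subgroup E by blast
    have sA: "subgroup A ?GE" using subgroup_incl[OF A E AE] .
    define m where "m = card (rcosets\<^bsub>?GE\<^esub> A)"
    have m: "m * card A = card ?E" using E.lagrange[OF sA] by (simp add: m_def order_def)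
    define i where "i = card (rcosets D)"
    have i: "i * card D = card (carrier G)" using lagrange[OF sD] by (simp add: i_def order_def)
    obtain e where e: "card (carrier G) = card ?E * e" using subgroup_card_dvd[OF E subgroup_self subgroup.subset[OF E]] by (auto elim: dvdE)
    have pf: "card ?E * card (D \<inter> A) = card D * card A" using card_set_mult[OF sD A] .
    have mD: "m * card (D \<inter> A) = card D" using pf subgroup_card_pos[OF A] unfolding m[symmetric] by (simp add: mult.assoc mult.left_commute)
    \<comment> \<open>Both sides equal the order of \<open>G\<close> times the order of
      \<open>D \<inter> A\<close>.\<close>
    have "card D * (card A * e) = card D * (i * card (D \<inter> A))"
    proof -
      have "card D * (card A * e) = (card ?E * card (D \<inter> A)) * e" unfolding pf by simp
      also have "\<dots> = (card ?E * e) * card (D \<inter> A)" by simp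
      also have "\<dots> = (i * card D) * card (D \<inter> A)" using e i by simp
      finally show ?thesis by (simp only: ac_simps)
    qed
    then have Ae: "card A * e = i * card (D \<inter> A)" using subgroup_card_pos[OF sD] by simp
    have "coprime (card A) m"
    proof (rule coprime_nat_primeI)
      fix q assume q: "prime q" and qA: "q dvd card A" and qm: "q dvd m"
      have "q dvd card D" using qm mD by (metis dvd_mult2)
      then have "\<not> q dvd i" using hall q not_prime_unit unfolding hall_subgroup_def i_def by (meson coprime_common_divisor)
      moreover have "q dvd i * card (D \<inter> A)" using qA Ae by (metis dvd_mult2)
      ultimately have "q dvd card (D \<inter> A)" using q prime_dvd_mult_iff by blast
      then have "q * q dvd card D" using qm mD mult_dvd_mono by metis
      then show False using sf q not_prime_unit unfolding squarefree_def power2_eq_square by blast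
    qed
    then show ?thesis using sA by (simp add: hall_subgroup_def m_def)
  qed
  ultimately show ?thesis unfolding hall_S_quasinormally_embedded_def by blast
qed

section \<open>Coprime orders, cyclic generators and the lower central series of a subgroup\<close>

lemma coprime_psubgroups_inter:
  assumes "prime p" "prime q" "p \<noteq> q" "psubgroup p A" "psubgroup q B"
  shows "A \<inter> B = {\<one>}"
proof -
  have sA: "subgroup A G" and sB: "subgroup B G" using assms by (auto simp: psubgroup_def)
  have s: "subgroup (A \<inter> B) G" using sA sB by (rule subgroups_Inter_pair)
  obtain i j where "card A = p ^ i" "card B = q ^ j" using assms by (auto simp: psubgroup_def)
  then have "coprime (card A) (card B)" using coprime_prime_powers assms by simp
  moreover have "card (A \<inter> B) dvd card A" "card (A \<inter> B) dvd card B" using subgroup_card_dvd s sA sB by auto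
  ultimately have "card (A \<inter> B) dvd 1" by (metis coprime_common_divisor)
  then show ?thesis using card_one_iff[OF s] by simp
qed

lemma prime_power_of_unique_prime_divisor:
  assumes p: "prime (p::nat)" and d: "d > 0" "\<And>q. prime q \<Longrightarrow> q dvd d \<Longrightarrow> q = p"
  shows "\<exists>k. d = p ^ k"
proof -
  obtain y where y: "d = p ^ multiplicity p d * y" "\<not> p dvd y"
    using multiplicity_decompose'[of d p] d(1) p not_prime_unit by blast
  have "y = 1"
  proof (rule ccontr)
    assume "y \<noteq> 1"
    then obtain q where q: "prime q" "q dvd y" using prime_factor_nat by blast
    then have "q dvd d" using y(1) by (metis dvd_mult)
    then show False using d(2) q y(2) by blast
  qed
  then show ?thesis using y(1) by (metis mult_1_right)
qed

lemma ord_mult_coprime: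
  assumes c: "x \<in> carrier G" "y \<in> carrier G" "x \<otimes> y = y \<otimes> x" and co: "coprime (ord x) (ord y)"
  shows "ord (x \<otimes> y) = ord x * ord y"
proof (rule dvd_antisym)
  show "ord (x \<otimes> y) dvd ord x * ord y" using ord_mul_divides[OF c(3) c(1,2)] .
  let ?n = "ord (x \<otimes> y)"
  have xy: "(x \<otimes> y) [^] ?n = \<one>" using c by simp
  have *: "ord u dvd ?n" if "u \<in> carrier G" "v \<in> carrier G" "u \<otimes> v = v \<otimes> u" "coprime (ord u) (ord v)" "(u \<otimes> v) [^] ?n = \<one>" for u v
  proof -
    have "(u \<otimes> v) [^] (?n * ord v) = \<one>"
      using nat_pow_pow[of "u \<otimes> v" ?n "ord v"] that by simp
    then have "u [^] (?n * ord v) \<otimes> v [^] (?n * ord v) = \<one>" using pow_mult_distrib[OF that(3,1,2)] by simp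
    moreover have "v [^] (?n * ord v) = \<one>" using pow_eq_id[OF that(2)] by simp
    ultimately have "u [^] (?n * ord v) = \<one>" using that by simp
    then have "ord u dvd ?n * ord v" using pow_eq_id[OF that(1)] by simp
    then show ?thesis using that(4) coprime_dvd_mult_left_iff by blast
  qed
  have "ord x dvd ?n" using *[OF c(1,2,3) co xy] .
  moreover have "ord y dvd ?n" using *[OF c(2,1) c(3)[symmetric]] co xy c(3) by (simp add: coprime_commute)
  ultimately show "ord x * ord y dvd ?n" using co divides_mult by blast
qed

lemma cyclic_group_of_generator:
  assumes D: "subgroup D G" and x: "x \<in> D" "ord x = card D"
  shows "cyclic_group (G\<lparr>carrier := D\<rparr>)"
proof -
  interpret D: finite_group "G\<lparr>carrier := D\<rparr>" using finite_group_subgroup D by blast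
  have xc: "x \<in> carrier G" using x D subgroup_carrier by blast
  have "generate G {x} \<subseteq> D" by (rule generate_subgroup_incl[OF _ D]) (use x in simp)
  then have "generate G {x} = D" using card_subset_eq[OF subgroup_finite[OF D]] card_generate_singleton[OF xc] x(2) by simp
  then have D_eq: "D = range (\<lambda>k::nat. x [^] k)" using generate_singleton[OF xc] by simp
  have "carrier (G\<lparr>carrier := D\<rparr>) = range (\<lambda>n::int. x [^]\<^bsub>G\<lparr>carrier := D\<rparr>\<^esub> n)"
  proof
    show "range (\<lambda>n::int. x [^]\<^bsub>G\<lparr>carrier := D\<rparr>\<^esub> n) \<subseteq> carrier (G\<lparr>carrier := D\<rparr>)"
      using D.int_pow_closed[of x] x by auto
    show "carrier (G\<lparr>carrier := D\<rparr>) \<subseteq> range (\<lambda>n::int. x [^]\<^bsub>G\<lparr>carrier := D\<rparr>\<^esub> n)"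
    proof
      fix z assume "z \<in> carrier (G\<lparr>carrier := D\<rparr>)"
      then have "z \<in> range (\<lambda>k::nat. x [^] k)" using D_eq by simp
      then obtain k :: nat where "z = x [^] k" by blast
      then have "z = x [^]\<^bsub>G\<lparr>carrier := D\<rparr>\<^esub> int k" by (simp add: int_pow_int nat_pow_consistent[symmetric])
      then show "z \<in> range (\<lambda>n::int. x [^]\<^bsub>G\<lparr>carrier := D\<rparr>\<^esub> n)" by (rule range_eqI)
    qed
  qed
  then show ?thesis using D.cyclic_group x(1) by auto
qed

lemma normalizer_eq:
  assumes "M \<subseteq> carrier G" shows "normalizer G M = {g \<in> carrier G. normalizes g M}"
proof -
  have im: "g <# M #> inv g = conjugate g ` M" for g by (auto simp: l_coset_def r_coset_def)
  have "conjugate g ` M = M \<longleftrightarrow> normalizes g M" if "g \<in> carrier G" for g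
    using normalizes_image[OF _ assms, of g] that by (auto simp: normalizes_def)
  then show ?thesis using assms by (auto simp: normalizer_def stabilizer_def im)
qed

text \<open>Serves to show that a complement of the residual is nilpotent: a suitable term of its
  series lies in the residual as well as in the complement.\<close>

lemma lower_central_subgroup:
  assumes M: "subgroup M G"
  shows "lower_central (G\<lparr>carrier := M\<rparr>) k \<subseteq> lower_central G k \<inter> M"
proof (induction k)
  case 0
  show ?case using subgroup.subset[OF M] by simp
next
  case (Suc k)
  let ?M = "G\<lparr>carrier := M\<rparr>"
  interpret M: finite_group ?M using finite_group_subgroup M by blast
  let ?T = "lower_central G (Suc k) \<inter> M"
  have T: "subgroup ?T G" using normal_subD(1)[OF lower_central_normal] M by (rule subgroups_Inter_pair)
  have TM: "subgroup ?T ?M" using subgroup_incl[OF T M] by blast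
  have "commutator ?M (lower_central ?M k) (carrier ?M) \<subseteq> ?T"
  proof (rule M.commutator_subset[OF TM])
    fix h u assume hu: "h \<in> lower_central ?M k" "u \<in> carrier ?M"
    have h: "h \<in> lower_central G k" "h \<in> M" using hu(1) Suc by auto
    have u: "u \<in> M" "u \<in> carrier G" using hu(2) subgroup_carrier[OF M] by auto
    have "comm h u \<in> commutator G (lower_central G k) (carrier G)"
      unfolding commutator_def using h u by (intro generate.incl) blast
    moreover have "comm h u \<in> M" using h u M by (simp add: subgroup.m_closed subgroup.m_inv_closed)
    ultimately show "h \<otimes>\<^bsub>?M\<^esub> u \<otimes>\<^bsub>?M\<^esub> inv\<^bsub>?M\<^esub> h \<otimes>\<^bsub>?M\<^esub> inv\<^bsub>?M\<^esub> u \<in> ?T"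
      using h u by (simp add: m_inv_consistent[OF M])
  qed
  then show ?case by simp
qed

end

section \<open>The residual and its complement\<close>

context hall_embedded_group begin

text \<open>\<open>D\<close> enters as a stationary term of the lower central series. This form
  gives direct access to the two facts used: it equals its commutator with \<open>G\<close>, and its
  quotient is nilpotent.\<close>

context
  fixes D n
  assumes D_def: "D = lower_central G n" and stable: "commutator G D (carrier G) = D"
begin

lemma D_normal: "normal_sub D" unfolding D_def by (rule lower_central_normal)

lemmas D_sub = normal_subD(1)[OF D_normal]

lemma D_carrier: "x \<in> D \<Longrightarrow> x \<in> carrier G"
  using D_sub subgroup_carrier by blast

text \<open>If the order were not \<open>p\<close>, the normal \<open>p\<close>-complement would
  have \<open>p\<close>-power index, and a group equal to its commutator with \<open>G\<close> would
  lie inside it, although \<open>p\<close> divides the order of \<open>D\<close>. Once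
  \<open>P\<close> has order \<open>p\<close>, it lies in \<open>D\<close>, hence in the commutator
  subgroup, as \<open>minimal_sylow_normal\<close> requires.\<close>

lemma residual_sylow:
  assumes p: "prime p" "p dvd card D" and P: "sylow_in p P (carrier G)"
  shows "card P = p" "P \<subseteq> D" "normal_sub P"
proof -
  show cP: "card P = p"
  proof (rule ccontr)
    assume "card P \<noteq> p"
    let ?C = "pi_elements (\<lambda>q. q \<noteq> p)"
    have C: "subgroup ?C G" using p_complement_of_large_sylow[OF p(1) P \<open>card P \<noteq> p\<close>] .
    obtain d where d: "card (carrier G) = card ?C * d" using subgroup_card_dvd[OF C subgroup_self pi_elements_carrier] by (auto elim: dvdE)
    have "\<exists>k. d = p ^ k"
    proof (rule prime_power_of_unique_prime_divisor[OF p(1)])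
      show "d > 0" using d subgroup_card_pos[OF subgroup_self] by (cases d) auto
      fix q assume q: "prime q" "q dvd d"
      show "q = p"
      proof (rule ccontr)
        assume "q \<noteq> p"
        obtain Q where Q: "sylow_in q Q (carrier G)" using sylow_exists[OF q(1) subgroup_self] by blast
        have QC: "sylow_in q Q ?C" using sylow_in_pi[OF q(1) _ C Q] \<open>q \<noteq> p\<close> by simp
        obtain e where e: "card ?C = card Q * e" using subgroup_card_dvd[OF sylow_inD(1)[OF QC] C sylow_inD(2)[OF QC]] by (auto elim: dvdE)
        have "card (carrier G) = card Q * (e * d)" using d e by simp
        then have "\<not> q dvd e * d" by (rule sylow_index[OF q(1) subgroup_self Q])
        then show False using q(2) by simp
      qed
    qed
    then obtain k where "card (carrier G) = card ?C * p ^ k" using d by blast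
    then have "D \<subseteq> ?C"
      by (rule residual_in_p_complement[OF p(1) pi_elements_normal_sub[OF C] _ D_normal]) (simp add: stable)
    then have "card D dvd card ?C" by (rule subgroup_card_dvd[OF D_sub C])
    then have "p dvd card ?C" using p(2) dvd_trans by blast
    then show False using pi_elements_card[OF C p(1)] by simp
  qed
  show PD: "P \<subseteq> D"
    by (rule normalized_contains_prime_sylow[OF p(1) subgroup_self P cP D_sub subgroup.subset[OF D_sub] _ p(2)])
      (rule normal_subD(2)[OF D_normal])
  have "D \<subseteq> commutator G (carrier G) (carrier G)"
  proof -
    have "D = commutator G D (carrier G)" using stable by simp
    also have "\<dots> \<subseteq> commutator G (carrier G) (carrier G)"
      unfolding commutator_def by (rule mono_generate) (use D_carrier in blast)
    finally show ?thesis .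
  qed
  then show "normal_sub P" using minimal_sylow_normal[OF p(1) P cP] PD by blast
qed

text \<open>Sylow \<open>p\<close>-subgroups have order \<open>p\<close>, so \<open>p\<close>
  divides the order of \<open>G\<close> only once. Both the Hall property and square-freeness come
  from this.\<close>

lemma residual_index:
  assumes p: "prime p" "p dvd card D" and m: "card (carrier G) = card D * m" and e: "card D = p * e"
  shows "\<not> p dvd e * m"
proof -
  obtain P where P: "sylow_in p P (carrier G)" using sylow_exists[OF p(1) subgroup_self] by blast
  have "card (carrier G) = card P * (e * m)" using m e residual_sylow(1)[OF p P] by simp
  then show ?thesis by (rule sylow_index[OF p(1) subgroup_self P])
qed

lemma residual_card: "\<exists>m. card (carrier G) = card D * m"
  using subgroup_card_dvd[OF D_sub subgroup_self subgroup.subset[OF D_sub]] by (auto elim: dvdE)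

lemma residual_hall: "hall_subgroup D G"
proof -
  define m where "m = card (rcosets D)"
  have m: "card (carrier G) = card D * m" using lagrange[OF D_sub] by (simp add: m_def order_def mult.commute)
  have "coprime (card D) m"
  proof (rule coprime_nat_primeI)
    fix q assume q: "prime q" and qD: "q dvd card D" and qm: "q dvd m"
    obtain e where "card D = q * e" using qD by (elim dvdE)
    then have "\<not> q dvd e * m" by (rule residual_index[OF q qD m])
    then show False using qm by simp
  qed
  then show ?thesis using D_sub by (simp add: hall_subgroup_def m_def)
qed

lemma residual_factor_coprime:
  assumes "prime p" "card D = p * e" shows "\<not> p dvd e"
proof -
  obtain m where m: "card (carrier G) = card D * m" using residual_card by blast
  have "p dvd card D" using assms(2) by simp
  then have "\<not> p dvd e * m" using residual_index[OF assms(1) _ m assms(2)] by blast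
  then show ?thesis by auto
qed

lemma residual_squarefree: "squarefree (card D)"
  unfolding squarefree_def
proof (intro allI impI)
  fix x :: nat assume x: "x\<^sup>2 dvd card D"
  show "is_unit x"
  proof (rule ccontr)
    assume "\<not> is_unit x"
    then have "x \<noteq> 1" by simp
    then obtain q where q: "prime q" "q dvd x" using prime_factor_nat by blast
    have "q * q dvd x * x" using q(2) by (simp add: mult_dvd_mono)
    then have "q * q dvd card D" using x by (metis dvd_trans power2_eq_square)
    then obtain e where "card D = q * q * e" by (elim dvdE)
    then have "card D = q * (q * e)" by simp
    then have "\<not> q dvd q * e" by (rule residual_factor_coprime[OF q(1)])
    then show False by simp
  qed
qed

lemma pelement_in_residual_sylow:
  assumes p: "prime p" "p dvd card D" and P: "sylow_in p P (carrier G)" and x: "pelement p x"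
  shows "x \<in> P"
  using sylow_contains_normalizing[OF p(1) subgroup_self P] pelement_carrier[OF x] x
    normal_subD(2)[OF residual_sylow(3)[OF p P]] by blast

text \<open>For equal primes both elements lie in one group of order \<open>p\<close>. For different
  primes the commutator lies in two normal Sylow subgroups that meet trivially.\<close>

lemma residual_pelements_commute:
  assumes x: "prime p" "pelement p x" "x \<in> D" and y: "prime q" "pelement q y" "y \<in> D"
  shows "conjugate y x = x"
proof (cases "x = \<one> \<or> y = \<one>")
  case True
  then show ?thesis using D_carrier x(3) y(3) by auto
next
  case False
  have xc: "x \<in> carrier G" and yc: "y \<in> carrier G" using D_carrier x y by auto
  have pD: "p dvd card D" using pelement_dvd_ord[OF x(1,2)] ord_subgroup_dvd[OF D_sub x(3)] False dvd_trans by blast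
  have qD: "q dvd card D" using pelement_dvd_ord[OF y(1,2)] ord_subgroup_dvd[OF D_sub y(3)] False dvd_trans by blast
  obtain P where P: "sylow_in p P (carrier G)" using sylow_exists[OF x(1) subgroup_self] by blast
  obtain Q where Q: "sylow_in q Q (carrier G)" using sylow_exists[OF y(1) subgroup_self] by blast
  have xP: "x \<in> P" using pelement_in_residual_sylow[OF x(1) pD P x(2)] .
  have yQ: "y \<in> Q" using pelement_in_residual_sylow[OF y(1) qD Q y(2)] .
  note nP = residual_sylow(3)[OF x(1) pD P] and nQ = residual_sylow(3)[OF y(1) qD Q]
  show ?thesis
  proof (cases "p = q")
    case True
    then have yP: "y \<in> P" using pelement_in_residual_sylow[OF x(1) pD P] y(2) by simp
    show ?thesis
      by (rule psubgroup_centralizes[OF x(1) x(1) order_refl sylow_inD(3)[OF P] sylow_inD(1)[OF P] residual_sylow(1)[OF x(1) pD P] _ yP xP])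
        (rule normalizes_self[OF sylow_inD(1)[OF P]])
  next
    case False
    have "conjugate y x \<in> P" using normal_subD(3)[OF nP yc xP] .
    then have "comm y x \<in> P" using xP normal_subD(1)[OF nP] by (simp add: subgroup.m_closed subgroup.m_inv_closed)
    moreover have "conjugate x (inv y) \<in> Q" using normal_subD(3)[OF nQ xc] yQ normal_subD(1)[OF nQ] by (simp add: subgroup.m_inv_closed)
    then have "y \<otimes> conjugate x (inv y) \<in> Q" by (rule subgroup.m_closed[OF normal_subD(1)[OF nQ] yQ])
    then have "comm y x \<in> Q" using xc yc by (simp add: m_assoc)
    ultimately have "comm y x = \<one>"
      using coprime_psubgroups_inter[OF x(1) y(1) False sylow_inD(3)[OF P] sylow_inD(3)[OF Q]] by blast
    then have "comm y x \<otimes> x = x" using xc by simp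
    then show ?thesis using xc yc by (simp add: m_assoc)
  qed
qed

text \<open>\<open>prime_power_generation\<close> is used once in each argument.\<close>

lemma residual_abelian:
  assumes "x \<in> D" "y \<in> D" shows "conjugate y x = x"
proof -
  have 1: "D \<subseteq> centralizer_set {x}" if x: "prime p" "pelement p x" "x \<in> D" for p x
  proof (rule prime_power_generation[OF D_sub])
    fix q y assume "prime q" "pelement q y" "y \<in> D"
    then show "y \<in> centralizer_set {x}"
      using residual_pelements_commute[OF x] D_carrier by (simp add: centralizer_set_def)
  qed (use D_carrier[OF x(3)] in \<open>simp add: subgroup.m_closed[OF centralizer_set_subgroup]\<close>)
  have yc: "y \<in> carrier G" using D_carrier assms by blast
  let ?Y = "{x \<in> carrier G. conjugate y x = x}"
  have "D \<subseteq> ?Y"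
  proof (rule prime_power_generation[OF D_sub])
    fix q z assume z: "prime q" "pelement q z" "z \<in> D"
    then have "y \<in> centralizer_set {z}" using 1 assms(2) by blast
    then show "z \<in> ?Y" using D_carrier[OF z(3)] by (simp add: centralizer_set_def)
  next
    fix a b assume ab: "a \<in> ?Y" "b \<in> ?Y"
    have "a \<in> carrier G" "b \<in> carrier G" using ab by auto
    then have "conjugate y (a \<otimes> b) = conjugate y a \<otimes> conjugate y b" using yc by (simp add: group_simps)
    then show "a \<otimes> b \<in> ?Y" using ab by simp
  qed
  then show ?thesis using assms(1) by blast
qed

lemma residual_commute: "x \<in> D \<Longrightarrow> y \<in> D \<Longrightarrow> x \<otimes> y = y \<otimes> x"
proof -
  assume xy: "x \<in> D" "y \<in> D"
  then have c: "x \<in> carrier G" "y \<in> carrier G" using D_carrier by auto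
  have "x \<otimes> y = conjugate y x \<otimes> y" using residual_abelian[OF xy] by simp
  also have "\<dots> = y \<otimes> x" using c by (simp add: m_assoc)
  finally show ?thesis .
qed

text \<open>All divisors are treated so that the induction can split off one prime at a time; that
  prime occurs only once in the order of \<open>D\<close>, which makes the orders of the two factors
  coprime.\<close>

lemma residual_element_of_ord: "d dvd card D \<Longrightarrow> \<exists>x\<in>D. ord x = d"
proof (induction d rule: less_induct)
  case (less d)
  show ?case
  proof (cases "d = 1")
    case True
    then show ?thesis using subgroup.one_closed[OF D_sub] ord_id by blast
  next
    case False
    then obtain q where q: "prime q" "q dvd d" using prime_factor_nat by blast
    obtain e where e: "d = q * e" using q(2) by (elim dvdE)
    have dpos: "d > 0" using less.prems subgroup_card_pos[OF D_sub] by (auto intro: Nat.gr0I)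
    then have "e < d" using e prime_gt_1_nat[OF q(1)] by simp
    moreover have "e dvd card D" using less.prems e dvd_trans dvd_triv_right by metis
    ultimately obtain y where y: "y \<in> D" "ord y = e" using less.IH by blast
    have "q dvd card D" using q(2) less.prems dvd_trans by blast
    then obtain x where x: "x \<in> D" "ord x = q" using cauchy_element[OF q(1) D_sub] by blast
    obtain f where "card D = d * f" using less.prems by (elim dvdE)
    then have "card D = q * (e * f)" using e by simp
    then have "\<not> q dvd e * f" by (rule residual_factor_coprime[OF q(1)])
    then have "\<not> q dvd e" by auto
    then have "coprime q e" by (rule prime_imp_coprime[OF q(1)])
    then have "ord (x \<otimes> y) = d"
      using ord_mult_coprime[OF D_carrier[OF x(1)] D_carrier[OF y(1)] residual_commute[OF x(1) y(1)]] x(2) y(2) e by simp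
    then show ?thesis using x(1) y(1) subgroup.m_closed[OF D_sub] by blast
  qed
qed

lemma residual_cyclic: "cyclic_group (G\<lparr>carrier := D\<rparr>)"
  using residual_element_of_ord[of "card D"] cyclic_group_of_generator[OF D_sub] by auto

text \<open>For \<open>d\<close> in \<open>D\<close>, the power \<open>d [^] e\<close> is a
  \<open>p\<close>-element and lies in \<open>P\<close>. If \<open>P\<close> were central, the
  commutators of \<open>D\<close> with \<open>G\<close> would have trivial \<open>e\<close>-th
  power, \<open>D\<close> being abelian. But they generate \<open>D\<close>, which contains an
  element of order \<open>p\<close>, and \<open>p\<close> is prime to \<open>e\<close>.\<close>

lemma residual_sylow_not_central:
  assumes p: "prime p" "p dvd card D" and P: "sylow_in p P (carrier G)"
  shows "\<not> carrier G \<subseteq> centralizer_set P"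
proof
  assume cen: "carrier G \<subseteq> centralizer_set P"
  obtain e where e: "card D = p * e" using p(2) by (elim dvdE)
  let ?T = "{z \<in> D. z [^] e = \<one>}"
  have T: "subgroup ?T G"
  proof (rule subgroupI_finite)
    show "\<one> \<in> ?T" using subgroup.one_closed[OF D_sub] by simp
    fix a b assume ab: "a \<in> ?T" "b \<in> ?T"
    then have "(a \<otimes> b) [^] e = a [^] e \<otimes> b [^] e" using D_carrier by (intro pow_mult_distrib residual_commute) auto
    then show "a \<otimes> b \<in> ?T" using ab subgroup.m_closed[OF D_sub] by simp
  qed (use D_carrier in auto)
  have "commutator G D (carrier G) \<subseteq> ?T"
  proof (rule commutator_subset[OF T])
    fix d g assume d: "d \<in> D" and g: "g \<in> carrier G"
    have dc: "d \<in> carrier G" using D_carrier d by blast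
    let ?w = "conjugate g (inv d)"
    have wD: "?w \<in> D" using normal_subD(3)[OF D_normal g] subgroup.m_inv_closed[OF D_sub d] by blast
    have "(d [^] e) [^] p = \<one>"
      using pow_card_subgroup[OF D_sub d] dc unfolding e by (simp add: nat_pow_pow mult.commute)
    then have "pelement p (d [^] e)" using dc by (auto simp: pelement_def intro: exI[of _ 1])
    then have "d [^] e \<in> P" using pelement_in_residual_sylow[OF p P] by blast
    then have c: "g \<otimes> d [^] e \<otimes> inv g = d [^] e" using cen g by (auto simp: centralizer_set_def)
    have "(d \<otimes> ?w) [^] e = d [^] e \<otimes> ?w [^] e"
      using dc g by (intro pow_mult_distrib residual_commute[OF d wD]) auto
    also have "?w [^] e = conjugate g (inv (d [^] e))" using conj_pow[OF g, of "inv d" e] dc by (simp add: nat_pow_inv)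
    also have "\<dots> = inv (g \<otimes> d [^] e \<otimes> inv g)" using g dc by (simp add: group_simps)
    also have "\<dots> = inv (d [^] e)" using c by simp
    finally have "(d \<otimes> ?w) [^] e = \<one>" using dc by simp
    moreover have "d \<otimes> ?w = comm d g" using dc g by (simp add: m_assoc)
    moreover have "d \<otimes> ?w \<in> D" using subgroup.m_closed[OF D_sub d wD] .
    ultimately show "comm d g \<in> ?T" by simp
  qed
  then have "D \<subseteq> ?T" using stable by simp
  moreover obtain x where x: "x \<in> D" "ord x = p" using cauchy_element[OF p(1) D_sub p(2)] by blast
  ultimately have xe: "x [^] e = \<one>" by blast
  have xp: "x [^] p = \<one>" using pow_ord_eq_1[OF D_carrier[OF x(1)]] x(2) by simp
  have "coprime p e" by (rule prime_imp_coprime[OF p(1) residual_factor_coprime[OF p(1) e]])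
  then have "x = \<one>" using coprime_pow_one[OF D_carrier[OF x(1)] xp xe] by blast
  then show False using x(2) p(1) not_prime_1 ord_id by metis
qed

text \<open>For a minimal supplement \<open>M\<close>, suppose that \<open>p\<close> divides the
  order of \<open>D \<inter> M\<close>. Then \<open>P\<close> lies in \<open>M\<close>, and some
  \<open>q\<close>-element \<open>y\<close> of \<open>M\<close> does not centralize
  \<open>P\<close>. The normalizer in \<open>M\<close> of a Sylow subgroup \<open>Q\<close>
  containing \<open>y\<close> is again a supplement, hence all of \<open>M\<close>; so
  \<open>P\<close> and \<open>Q\<close> normalize each other and commute, a contradiction. Finally,
  an element of \<open>D\<close> that normalizes \<open>M\<close> is central, and a non-trivial one
  would make a Sylow subgroup central.\<close>

lemma residual_complement:
  "\<exists>M. subgroup M G \<and> D <#> M = carrier G \<and> D \<inter> M = {\<one>} \<and> normalizer G M = M"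
proof -
  define \<M> where "\<M> = {M. subgroup M G \<and> D <#> M = carrier G}"
  have "finite \<M>" unfolding \<M>_def by (rule finite_subset[of _ "Pow (carrier G)"]) (use fin subgroup.subset in auto)
  moreover have "carrier G \<in> \<M>"
    using set_mult_incl(2)[OF D_sub subgroup_self] normal_product_subgroup[OF D_normal subgroup_self] subgroup.subset subgroup_self
    unfolding \<M>_def by blast
  ultimately obtain M where M: "M \<in> \<M>" "\<And>W. W \<in> \<M> \<Longrightarrow> W \<subseteq> M \<Longrightarrow> M = W" using finite_has_minimal by (metis empty_iff)
  have sM: "subgroup M G" and DM: "D <#> M = carrier G" using M(1) by (auto simp: \<M>_def)
  have Mc: "\<And>x. x \<in> M \<Longrightarrow> x \<in> carrier G" using sM subgroup_carrier by blast
  have sI: "subgroup (D \<inter> M) G" using D_sub sM by (rule subgroups_Inter_pair)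
  have carrier_subset: "carrier G \<subseteq> C" if "subgroup C G" "D \<subseteq> C" "M \<subseteq> C" for C
    unfolding DM[symmetric] set_mult_def using that by (auto intro: subgroup.m_closed)
  have D_centralizes: "D \<subseteq> centralizer_set S" if "S \<subseteq> D" for S
    using residual_abelian D_carrier that by (auto simp: centralizer_set_def)
  have DM1: "D \<inter> M = {\<one>}"
  proof (rule ccontr)
    assume "D \<inter> M \<noteq> {\<one>}"
    then have "card (D \<inter> M) \<noteq> 1" using card_one_iff[OF sI] by simp
    then obtain p where p: "prime p" "p dvd card (D \<inter> M)" using prime_factor_nat by blast
    have "card (D \<inter> M) dvd card D" using subgroup_card_dvd[OF sI D_sub] by simp
    then have pD: "p dvd card D" using p(2) dvd_trans by blast
    obtain P where P: "sylow_in p P (carrier G)" using sylow_exists[OF p(1) subgroup_self] by blast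
    note cP = residual_sylow(1)[OF p(1) pD P] and PD = residual_sylow(2)[OF p(1) pD P] and nP = residual_sylow(3)[OF p(1) pD P]
    note sP = sylow_inD(1)[OF P]
    obtain z where z: "z \<in> D \<inter> M" "ord z = p" using cauchy_element[OF p(1) sI p(2)] by blast
    have zc: "z \<in> carrier G" using z D_carrier by blast
    have "pelement p z" using pow_ord_eq_1[OF zc] z(2) zc by (auto simp: pelement_def intro: exI[of _ 1])
    then have "z \<in> P" using pelement_in_residual_sylow[OF p(1) pD P] by blast
    moreover have "z \<noteq> \<one>" using z(2) p(1) not_prime_1 ord_id by metis
    ultimately have PM: "P \<subseteq> M" using prime_order_subgroup_incl[OF p(1) sP cP sM] z by blast
    note C = centralizer_set_subgroup[OF subgroup.subset[OF sP]]
    \<comment> \<open>\<open>D\<close> is abelian and centralizes \<open>P\<close>, so a non-central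
      \<open>P\<close> is not centralized by \<open>M\<close>, and this shows on an element of prime
      power order.\<close>
    have "\<not> M \<subseteq> centralizer_set P"
      using residual_sylow_not_central[OF p(1) pD P] carrier_subset[OF C D_centralizes[OF PD]] by blast
    then have "\<exists>q y. prime q \<and> pelement q y \<and> y \<in> M \<and> y \<notin> centralizer_set P"
      using prime_power_generation[OF sM, of "centralizer_set P"] subgroup.m_closed[OF C] by blast
    then obtain q y where q: "prime q" "pelement q y" and y: "y \<in> M" "y \<notin> centralizer_set P" by blast
    have qD: "\<not> q dvd card D"
    proof
      assume qD: "q dvd card D"
      obtain Q where Q: "sylow_in q Q (carrier G)" using sylow_exists[OF q(1) subgroup_self] by blast
      have "y \<in> D" using pelement_in_residual_sylow[OF q(1) qD Q q(2)] residual_sylow(2)[OF q(1) qD Q] by blast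
      then show False using D_centralizes[OF PD] y(2) by blast
    qed
    have pq: "p \<noteq> q" using pD qD by blast
    obtain Q where Q: "sylow_in q Q M" "y \<in> Q" using pelement_in_sylow[OF q(1) sM q(2) y(1)] by blast
    note sQ = sylow_inD(1)[OF Q(1)] and QM = sylow_inD(2)[OF Q(1)]
    \<comment> \<open>\<open>sylow_product_normal\<close> asks for a Sylow subgroup of
      \<open>G\<close>. As \<open>q\<close> does not divide the order of \<open>D\<close>, the
      supplement \<open>M\<close> already carries the full power of \<open>q\<close>.\<close>
    have QG: "sylow_in q Q (carrier G)"
    proof -
      obtain j where j: "card M = card Q * j" using subgroup_card_dvd[OF sQ sM QM] by (auto elim: dvdE)
      have qj: "\<not> q dvd j" using sylow_index[OF q(1) sM Q(1) j] .
      obtain l where l: "card (carrier G) = card Q * l" using subgroup_card_dvd[OF sQ subgroup_self subgroup.subset[OF sQ]] by (auto elim: dvdE)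
      have "card Q * (l * card (D \<inter> M)) = card Q * (card D * j)"
        using card_set_mult[OF D_sub sM] unfolding DM j l by (simp only: ac_simps)
      then have lj: "l * card (D \<inter> M) = card D * j" using subgroup_card_pos[OF sQ] by simp
      have "\<not> q dvd l"
      proof
        assume "q dvd l"
        then have "q dvd card D * j" unfolding lj[symmetric] by simp
        then show False using qD qj q(1) prime_dvd_mult_iff by blast
      qed
      then show ?thesis using sylow_inI[OF q(1) sylow_inD(3)[OF Q(1)] subgroup.subset[OF sQ] l] by blast
    qed
    have H: "normal_sub (D <#> Q)" using sylow_product_normal[OF D_normal _ q(1) QG, of n] D_def by simp
    let ?H = "(D <#> Q) \<inter> M"
    have sH: "subgroup ?H G" using normal_subD(1)[OF H] sM by (rule subgroups_Inter_pair)
    have QH: "Q \<subseteq> ?H" using set_mult_incl(2)[OF D_sub sQ] QM by blast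
    have QH': "sylow_in q Q ?H" by (rule sylow_in_between[OF q(1) sM Q(1) sH QH]) blast
    let ?M' = "{g \<in> carrier G. normalizes g Q} \<inter> M"
    have sM': "subgroup ?M' G" using normalizer_subgroup[OF subgroup.subset[OF sQ]] sM by (rule subgroups_Inter_pair)
    have M_fac: "\<exists>d\<in>D. inv d \<otimes> m \<in> ?M'" if m: "m \<in> M" for m
    proof -
      have "normalizes m ?H"
        using normal_subD(2)[OF H Mc[OF m]] normalizes_self[OF sM m] unfolding normalizes_def by blast
      then obtain b where b: "b \<in> ?H" "normalizes (inv b \<otimes> m) Q" using frattini[OF q(1) sH QH'] by blast
      obtain d u where du: "d \<in> D" "u \<in> Q" "b = d \<otimes> u" using b(1) by (auto simp: set_mult_def)
      have c: "d \<in> carrier G" "u \<in> carrier G" "m \<in> carrier G" using du m Mc D_carrier sQ subgroup_carrier by auto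
      \<comment> \<open>Of \<open>b = d \<otimes> u\<close>, the part \<open>u\<close> in
        \<open>Q\<close> is absorbed into the normalizer of \<open>Q\<close>, so that only a factor
        from \<open>D\<close> is split off.\<close>
      have "normalizes (u \<otimes> (inv b \<otimes> m)) Q"
        using normalizes_mult[OF normalizes_self[OF sQ du(2)] b(2) subgroup.subset[OF sQ]] .
      moreover have "u \<otimes> (inv b \<otimes> m) = inv d \<otimes> m" unfolding du(3) using c by (simp add: group_simps)
      moreover have "u \<otimes> (inv b \<otimes> m) \<in> M"
        using b(1) m du(2) QM by (intro subgroup.m_closed[OF sM] subgroup.m_inv_closed[OF sM]) auto
      ultimately have "inv d \<otimes> m \<in> ?M'" using c by simp
      then show ?thesis using du(1) by blast
    qed
    have "D <#> ?M' = carrier G"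
    proof
      show "D <#> ?M' \<subseteq> carrier G" using subgroup.subset[OF normal_product_subgroup[OF D_normal sM']] .
      show "carrier G \<subseteq> D <#> ?M'"
      proof
        fix g assume "g \<in> carrier G"
        then obtain d0 m where dm: "d0 \<in> D" "m \<in> M" "g = d0 \<otimes> m" unfolding DM[symmetric] by (auto simp: set_mult_def)
        obtain d where d: "d \<in> D" "inv d \<otimes> m \<in> ?M'" using M_fac[OF dm(2)] by blast
        have "g = (d0 \<otimes> d) \<otimes> (inv d \<otimes> m)" using dm d Mc D_carrier by (simp add: m_assoc)
        then show "g \<in> D <#> ?M'" using set_multI[OF subgroup.m_closed[OF D_sub dm(1) d(1)] d(2)] by simp
      qed
    qed
    then have "M = ?M'" using M(2)[of ?M'] sM' by (simp add: \<M>_def)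
    then have PQ: "normalizes x Q" if "x \<in> P" for x using PM that by blast
    have yc: "y \<in> carrier G" using y(1) Mc by blast
    have "conjugate y x = x" if x: "x \<in> P" for x
    proof -
      have xc: "x \<in> carrier G" using x sP subgroup_carrier by blast
      have "conjugate y x \<in> P" using normal_subD(3)[OF nP yc x] .
      then have "comm y x \<in> P" using x sP by (simp add: subgroup.m_closed subgroup.m_inv_closed)
      moreover have "conjugate x (inv y) \<in> Q" using PQ[OF x] Q(2) sQ by (simp add: normalizes_def subgroup.m_inv_closed)
      then have "y \<otimes> conjugate x (inv y) \<in> Q" by (rule subgroup.m_closed[OF sQ Q(2)])
      then have "comm y x \<in> Q" using xc yc by (simp add: m_assoc)
      ultimately have "comm y x = \<one>"
        using coprime_psubgroups_inter[OF p(1) q(1) pq sylow_inD(3)[OF P] sylow_inD(3)[OF Q(1)]] by blast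
      then have "comm y x \<otimes> x = x" using xc by simp
      then show ?thesis using xc yc by (simp add: m_assoc)
    qed
    then have "y \<in> centralizer_set P" using yc by (simp add: centralizer_set_def)
    then show False using y(2) by blast
  qed
  have "normalizer G M = M"
  proof
    show "M \<subseteq> normalizer G M"
      unfolding normalizer_eq[OF subgroup.subset[OF sM]] using normalizes_self[OF sM] Mc by blast
    show "normalizer G M \<subseteq> M"
    proof
      fix g assume "g \<in> normalizer G M"
      then have g: "g \<in> carrier G" "normalizes g M" unfolding normalizer_eq[OF subgroup.subset[OF sM]] by auto
      then obtain d m where dm: "d \<in> D" "m \<in> M" "g = d \<otimes> m" unfolding DM[symmetric] by (auto simp: set_mult_def)
      have dc: "d \<in> carrier G" and mc: "m \<in> carrier G" using dm D_carrier Mc by auto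
      have "normalizes (g \<otimes> inv m) M"
        using normalizes_mult[OF g(2) normalizes_self[OF sM subgroup.m_inv_closed[OF sM dm(2)]] subgroup.subset[OF sM]] .
      moreover have "g \<otimes> inv m = d" unfolding dm(3) using dc mc by (simp add: m_assoc)
      ultimately have nd: "normalizes d M" by simp
      let ?Z = "{h \<in> carrier G. conjugate h d = d}"
      have Zd: "centralizer_set {d} = ?Z" by (simp add: centralizer_set_def)
      then have Z: "subgroup ?Z G" using centralizer_set_subgroup[of "{d}"] dc by simp
      have "D \<subseteq> ?Z" using residual_abelian[OF dm(1)] D_carrier by blast
      moreover have "M \<subseteq> ?Z"
      proof
        fix k assume k: "k \<in> M"
        have kc: "k \<in> carrier G" using k Mc by blast
        have "conjugate d (inv k) \<in> M" using nd subgroup.m_inv_closed[OF sM k] by (simp add: normalizes_def)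
        then have "k \<otimes> conjugate d (inv k) \<in> M" by (rule subgroup.m_closed[OF sM k])
        then have "comm k d \<in> M" using kc dc by (simp add: m_assoc)
        moreover have "comm k d \<in> D"
          by (rule subgroup.m_closed[OF D_sub normal_subD(3)[OF D_normal kc dm(1)] subgroup.m_inv_closed[OF D_sub dm(1)]])
        ultimately have "comm k d = \<one>" using DM1 by blast
        then have "comm k d \<otimes> d = d" using dc by simp
        then show "k \<in> ?Z" using kc dc by (simp add: m_assoc)
      qed
      ultimately have all: "carrier G \<subseteq> ?Z" by (rule carrier_subset[OF Z])
      have "d = \<one>"
      proof (rule ccontr)
        assume "d \<noteq> \<one>"
        then have "ord d \<noteq> 1" using ord_eq_1[OF dc] by simp
        then obtain p where p: "prime p" "p dvd ord d" using prime_factor_nat by blast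
        have pD: "p dvd card D" using p(2) ord_subgroup_dvd[OF D_sub dm(1)] dvd_trans by blast
        obtain P where P: "sylow_in p P (carrier G)" using sylow_exists[OF p(1) subgroup_self] by blast
        let ?C = "centralizer_set (carrier G)"
        have C: "subgroup ?C G" using centralizer_set_subgroup by blast
        have "{d} \<subseteq> ?C" using centralizer_set_sym[of "carrier G" "{d}"] dc all Zd by simp
        then have "d \<in> ?C" by simp
        then have "p dvd card ?C" using p(2) ord_subgroup_dvd[OF C] dvd_trans by blast
        moreover have "normalizes g ?C" if "g \<in> carrier G" for g
        proof -
          have "carrier G \<subseteq> centralizer_set ?C" using centralizer_set_sym[OF subgroup.subset[OF C]] by simp
          then show ?thesis using that by (auto simp: centralizer_set_def normalizes_def)
        qed
        ultimately have "P \<subseteq> ?C"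
          using normalized_contains_prime_sylow[OF p(1) subgroup_self P residual_sylow(1)[OF p(1) pD P] C subgroup.subset[OF C]] by blast
        then have "carrier G \<subseteq> centralizer_set P" using centralizer_set_sym[OF subgroup.subset[OF sylow_inD(1)[OF P]] order_refl] by blast
        then show False using residual_sylow_not_central[OF p(1) pD P] by blast
      qed
      then show "g \<in> M" using dm mc by simp
    qed
  qed
  then show ?thesis using sM DM DM1 by blast
qed

end
end

section \<open>The equivalence\<close>

theorem corollary1p10:
  fixes G :: "('a, 'b) monoid_scheme"
  assumes "group G" and "finite (carrier G)"
  shows "(\<forall>A. subgroup A G \<longrightarrow> hall_S_quasinormally_embedded A G) \<longleftrightarrow>
    (\<exists>D M. semidirect_decomposition G D M \<and>
       D = nilpotent_residual G \<and>
       hall_subgroup D G \<and>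
       cyclic_group (G\<lparr>carrier := D\<rparr>) \<and>
       squarefree (card D) \<and>
       carter_subgroup M G)"
proof -
  interpret finite_group G using assms by (simp add: finite_group_def finite_group_axioms_def)
  obtain n where n: "nilpotent_residual G = lower_central G n"
    "commutator G (lower_central G n) (carrier G) = lower_central G n"
    using nilpotent_residual_eq by blast
  let ?D = "lower_central G n"
  show ?thesis
  proof
    assume emb: "\<forall>A. subgroup A G \<longrightarrow> hall_S_quasinormally_embedded A G"
    interpret hall_embedded_group G by unfold_locales (use emb in blast)
    obtain M where M: "subgroup M G" "?D <#>\<^bsub>G\<^esub> M = carrier G" "?D \<inter> M = {\<one>\<^bsub>G\<^esub>}" "normalizer G M = M"
      using residual_complement[OF refl n(2)] by blast
    \<comment> \<open>The residual is the \<open>n\<close>-th term for \<open>G\<close>, so the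
      \<open>n\<close>-th term for \<open>M\<close> lies in \<open>?D \<inter> M\<close>.\<close>
    have "lower_central (G\<lparr>carrier := M\<rparr>) n \<subseteq> {\<one>\<^bsub>G\<^esub>}" using lower_central_subgroup[OF M(1)] M(3) by blast
    moreover have "\<one>\<^bsub>G\<^esub> \<in> lower_central (G\<lparr>carrier := M\<rparr>) n"
    proof -
      interpret M: finite_group "G\<lparr>carrier := M\<rparr>" using finite_group_subgroup M(1) by blast
      show ?thesis using subgroup.one_closed[OF M.normal_subD(1)[OF M.lower_central_normal[of n]]] by simp
    qed
    ultimately have "nilpotent_group (G\<lparr>carrier := M\<rparr>)"
      using subgroup_imp_group[OF M(1)] unfolding nilpotent_group_def by auto
    then have "carter_subgroup M G" using M by (simp add: carter_subgroup_def)
    moreover have "semidirect_decomposition G ?D M"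
      using M lower_central_normal normal_sub_iff by (auto simp: semidirect_decomposition_def)
    ultimately show "\<exists>D M. semidirect_decomposition G D M \<and> D = nilpotent_residual G \<and> hall_subgroup D G \<and>
       cyclic_group (G\<lparr>carrier := D\<rparr>) \<and> squarefree (card D) \<and> carter_subgroup M G"
      using n(1) residual_hall[OF refl n(2)] residual_cyclic[OF refl n(2)] residual_squarefree[OF refl n(2)] by metis
  next
    assume "\<exists>D M. semidirect_decomposition G D M \<and> D = nilpotent_residual G \<and> hall_subgroup D G \<and>
       cyclic_group (G\<lparr>carrier := D\<rparr>) \<and> squarefree (card D) \<and> carter_subgroup M G"
    then have "hall_subgroup ?D G" "squarefree (card ?D)" using n(1) by auto
    then show "\<forall>A. subgroup A G \<longrightarrow> hall_S_quasinormally_embedded A G"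
      using hall_embedded_of_residual[OF lower_central_normal order_refl] by blast
  qed
qed

end
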